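(* Let $\mathcal{X}$ be a nonsingular (compact) algebraic curve and let $\varrho:\mathcal{X}\to\mathbb{C}\mathbb{P}^2$ be an immersion such that $\mathcal{C}=\varrho(\mathcal{X})=\{z\in\mathbb{C}\mathbb{P}^2:P(z)=0\}$ is a plane curve of degree $d=\deg P$ with at most nodes as singularities. Assume that $\mathcal{C}\cap\{z_0=0\}=\{z^{(1)},\dots,z^{(r)}\}$ consists of $r$ points with multiplicities $m_1,\dots,m_r$, $\sum_{i=1}^rm_i=d$, and put $\mathring{\mathcal{C}}=\mathcal{C}\setminus\{z^{(1)},\dots,z^{(r)}\}$, $\mathring{\mathcal{X}}=\mathcal{X}\setminus\{\varrho^{-1}(z^{(1)}),\dots,\varrho^{-1}(z^{(r)})\}$. Let $\phi\in\mathcal{E}^{(0,1)}(\mathring{\mathcal{X}})$ be a smooth $(0,1)$-form and let $\phi_*$ be its direct image on $\mathring{\mathcal{C}}$. If for some integer $\ell>d-3$ the form $\zeta_0^{\ell}\phi_*(\zeta)$ (of homogeneity $\ell$) admits an extension $\psi\in C^{(0,1)}(\mathcal{C})$ to a continuous $(0,1)$-form on $\mathcal{C}$, then there exist a function $g\in\mathcal{E}(\mathring{\mathcal{X}})$ and a constant $C$ such that $$\bar\partial g=\phi\quad\text{and}\quad |g(\zeta)|\le C|\zeta_0|^{-\ell}\quad\text{on }\mathring{\mathcal{X}}.$$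
   Context: $\mathcal{E}$ and $\mathcal{E}^{(0,1)}$ denote $C^\infty$ functions and $(0,1)$-forms. $\zeta=(\zeta_0,\zeta_1,\zeta_2)$ are homogeneous coordinates on $\mathbb{C}\mathbb{P}^2$ normalized by $|\zeta|=1$; a point of $\mathring{\mathcal{X}}$ is identified with the coordinates $\zeta$ of its image under $\varrho$ when writing $|g(\zeta)|\le C|\zeta_0|^{-\ell}$. Forms of homogeneity $\ell$ are forms with values in $\mathcal{O}(\ell)$, written in homogeneous coordinates as $\Phi$ with $\Phi(\lambda\zeta)=\lambda^\ell\Phi(\zeta)$. Direct image: $\phi_*$ is, away from the nodes, the form $\phi$ transported to $\mathring{\mathcal{C}}$ by $\varrho$ (which is biholomorphic onto its image outside the preimages of nodes). Near a node $p$, choose local coordinates $z_1,z_2$ of $\mathbb{C}\mathbb{P}^2$ centered at $p$ with $\mathcal{C}$ the union of the branches $\mathcal{C}_1=\{z_2=0\}$, $\mathcal{C}_2=\{z_1=0\}$; write $\phi=\phi_jd\bar z_j$ on the branch $\mathcal{C}_j$, extend $\phi_j$ to $\tilde\phi_j$ with $\tilde\phi_j|_{\mathcal{C}_j}=\phi_j$, $\partial\tilde\phi_j/\partial\bar z_k=0$ for $k\neq j$, and put $\phi_*=\tilde\phi_1d\bar z_1+\tilde\phi_2d\bar z_2$. *)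

theory Defs
  imports "HOL-Complex_Analysis.Complex_Analysis"
begin

section \<open>Smooth functions\<close>

text \<open>Real differentiability classes; only used for open \<open>S\<close>.\<close>

primrec Ck_on :: "nat \<Rightarrow> 'a::euclidean_space set \<Rightarrow> ('a \<Rightarrow> complex) \<Rightarrow> bool" where
  "Ck_on 0 S f \<longleftrightarrow> continuous_on S f"
| "Ck_on (Suc k) S f \<longleftrightarrow>
     f differentiable_on S \<and> (\<forall>b\<in>Basis. Ck_on k S (\<lambda>x. frechet_derivative f (at x) b))"

definition smooth_on :: "'a::euclidean_space set \<Rightarrow> ('a \<Rightarrow> complex) \<Rightarrow> bool" where
  "smooth_on S f \<longleftrightarrow> (\<forall>k. Ck_on k S f)"

text \<open>The Wirtinger derivative $\partial f/\partial\bar w = \frac12(f_x + i f_y)$.\<close>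

definition dzbar :: "(complex \<Rightarrow> complex) \<Rightarrow> complex \<Rightarrow> complex" where
  "dzbar f w = (frechet_derivative f (at w) 1 + \<i> * frechet_derivative f (at w) \<i>) / 2"


section \<open>The projective plane and plane curves\<close>

text \<open>A point of the projective plane is the set of all its homogeneous coordinate vectors.
  Coordinates are indexed by \<open>0, 1, 2 :: 3\<close> (in the library type \<open>3\<close> the index \<open>3\<close>
  is the same as \<open>0\<close>).\<close>

typedef cp2 = "{L. \<exists>\<zeta>::complex^3. \<zeta> \<noteq> 0 \<and> L = {c *s \<zeta> | c. c \<noteq> 0}}"
  morphisms hcoords Abs_cp2
proof -
  have "(axis 0 1 :: complex^3) \<noteq> 0" by (simp add: axis_eq_0_iff)
  then show ?thesis by blast
qed

definition line_at_infinity :: "cp2 set" where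
  "line_at_infinity = {p. \<forall>\<zeta>\<in>hcoords p. \<zeta> $ 0 = 0}"

definition affine_chart_domain :: "3 \<Rightarrow> cp2 set" where
  "affine_chart_domain i = {p. \<forall>\<zeta>\<in>hcoords p. \<zeta> $ i \<noteq> 0}"

text \<open>The coordinates $\zeta_j/\zeta_i$ of the \<open>i\<close>-th standard affine chart, together with
  the constant $1$ in position \<open>i\<close>: the homogeneous coordinates with $\zeta_i = 1$.\<close>

definition affine_coords :: "3 \<Rightarrow> cp2 \<Rightarrow> complex^3" where
  "affine_coords i p = (THE \<zeta>. \<zeta> \<in> hcoords p \<and> \<zeta> $ i = 1)"

definition hom_poly :: "nat \<Rightarrow> (complex^3 \<Rightarrow> complex) \<Rightarrow> bool" where
  "hom_poly d P \<longleftrightarrow> (\<exists>\<zeta>. P \<zeta> \<noteq> 0) \<and>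
     (\<exists>a :: nat \<Rightarrow> nat \<Rightarrow> complex. \<forall>\<zeta>.
        P \<zeta> = (\<Sum>j\<le>d. \<Sum>k\<le>d - j. a j k * (\<zeta> $ 0) ^ (d - j - k) * (\<zeta> $ 1) ^ j * (\<zeta> $ 2) ^ k))"

definition curve :: "(complex^3 \<Rightarrow> complex) \<Rightarrow> cp2 set" where
  "curve P = {p. \<forall>\<zeta>\<in>hcoords p. P \<zeta> = 0}"

definition singular_points :: "(complex^3 \<Rightarrow> complex) \<Rightarrow> cp2 set" where
  "singular_points P =
     {p \<in> curve P. \<forall>\<zeta>\<in>hcoords p. \<forall>v. frechet_derivative P (at \<zeta>) v = 0}"

definition hessian :: "(complex^3 \<Rightarrow> complex) \<Rightarrow> complex^3 \<Rightarrow> complex^3 \<Rightarrow> complex^3 \<Rightarrow> complex" where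
  "hessian P \<zeta> u v = frechet_derivative (\<lambda>\<eta>. frechet_derivative P (at \<eta>) u) (at \<zeta>) v"

text \<open>A node is a singular point at which the Hessian of a local affine equation is
  nondegenerate (a double point with two distinct tangents). In homogeneous coordinates the
  Hessian of \<open>P\<close> at a singular point \<open>\<zeta>\<close> always has \<open>\<zeta>\<close> in its kernel, by Euler's identity,
  and nondegeneracy of the affine Hessian, which lives on the quotient by the line spanned by
  \<open>\<zeta>\<close>, says that the kernel is no larger.\<close>

definition nodes :: "(complex^3 \<Rightarrow> complex) \<Rightarrow> cp2 set" where
  "nodes P = {p \<in> singular_points P.
     \<forall>\<zeta>\<in>hcoords p. \<forall>u. (\<forall>v. hessian P \<zeta> u v = 0) \<longrightarrow> (\<exists>c. u = c *s \<zeta>)}"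

text \<open>Intersection multiplicity at \<open>p\<close> of the curve with the line $\zeta_0 = 0$: the order of
  vanishing at \<open>p\<close> of the restriction of \<open>P\<close> to that line. It is meaningful if \<open>p\<close> is on the
  line and \<open>P\<close> does not vanish identically on it.\<close>

definition has_multiplicity_at_infinity :: "(complex^3 \<Rightarrow> complex) \<Rightarrow> cp2 \<Rightarrow> nat \<Rightarrow> bool" where
  "has_multiplicity_at_infinity P p m \<longleftrightarrow>
     (\<forall>\<zeta>\<in>hcoords p. \<forall>v. v $ 0 = 0 \<and> (\<nexists>c. v = c *s \<zeta>) \<longrightarrow>
        zorder (\<lambda>t. P (\<zeta> + t *s v)) 0 = int m)"


section \<open>Riemann surfaces, functions and forms on them\<close>

text \<open>A chart is a pair of its domain and its coordinate function.\<close>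

type_synonym 'a chart = "'a set \<times> ('a \<Rightarrow> complex)"

definition complex_atlas :: "'a::topological_space chart set \<Rightarrow> bool" where
  "complex_atlas A \<longleftrightarrow>
     (\<Union>(U, z)\<in>A. U) = UNIV \<and>
     (\<forall>(U, z)\<in>A. open U \<and> open (z ` U) \<and> homeomorphism U (z ` U) z (inv_into U z)) \<and>
     (\<forall>(U, z)\<in>A. \<forall>(V, w)\<in>A. (w \<circ> inv_into U z) holomorphic_on z ` (U \<inter> V))"

definition smooth_function :: "'a chart set \<Rightarrow> 'a set \<Rightarrow> ('a \<Rightarrow> complex) \<Rightarrow> bool" where
  "smooth_function A S g \<longleftrightarrow> (\<forall>(U, z)\<in>A. smooth_on (z ` (S \<inter> U)) (g \<circ> inv_into U z))"

text \<open>A \<open>(0,1)\<close>-form \<open>\<phi>\<close> is given by its coefficients: on the domain of the chart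
  \<open>(U, z)\<close> it is $\phi_{(U,z)}\,d\bar z$.\<close>

type_synonym 'a form = "'a chart \<Rightarrow> 'a \<Rightarrow> complex"

definition smooth_form01 :: "'a chart set \<Rightarrow> 'a set \<Rightarrow> 'a form \<Rightarrow> bool" where
  "smooth_form01 A S \<phi> \<longleftrightarrow>
     (\<forall>(U, z)\<in>A. \<forall>(V, w)\<in>A. \<forall>x\<in>S \<inter> U \<inter> V.
        \<phi> (U, z) x = \<phi> (V, w) x * cnj (deriv (w \<circ> inv_into U z) (z x))) \<and>
     (\<forall>(U, z)\<in>A. smooth_on (z ` (S \<inter> U)) (\<phi> (U, z) \<circ> inv_into U z))"

definition dbar_eq :: "'a chart set \<Rightarrow> 'a set \<Rightarrow> ('a \<Rightarrow> complex) \<Rightarrow> 'a form \<Rightarrow> bool" where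
  "dbar_eq A S g \<phi> \<longleftrightarrow>
     (\<forall>(U, z)\<in>A. \<forall>x\<in>S \<inter> U. dzbar (g \<circ> inv_into U z) (z x) = \<phi> (U, z) x)"

definition holomorphic_curve ::
  "'a::topological_space chart set \<Rightarrow> complex set \<Rightarrow> (complex \<Rightarrow> 'a) \<Rightarrow> bool" where
  "holomorphic_curve A D \<sigma> \<longleftrightarrow> continuous_on D \<sigma> \<and>
     (\<forall>(U, z)\<in>A. (z \<circ> \<sigma>) holomorphic_on (D \<inter> \<sigma> -` U))"

text \<open>$f\,d\bar t$ is the pullback of \<open>\<phi>\<close> along \<open>\<sigma>\<close>, where \<open>t\<close> is the coordinate on \<open>D\<close>.\<close>

definition pullback01_eq ::
  "'a chart set \<Rightarrow> complex set \<Rightarrow> (complex \<Rightarrow> 'a) \<Rightarrow> 'a form \<Rightarrow> (complex \<Rightarrow> complex) \<Rightarrow> bool" where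
  "pullback01_eq A D \<sigma> \<phi> f \<longleftrightarrow>
     (\<forall>(U, z)\<in>A. \<forall>t\<in>D \<inter> \<sigma> -` U. f t = \<phi> (U, z) (\<sigma> t) * cnj (deriv (z \<circ> \<sigma>) t))"


section \<open>Immersions into the projective plane\<close>

text \<open>The map \<open>\<rho>\<close> expressed in the chart \<open>(U, z)\<close> and the \<open>i\<close>-th affine chart.\<close>

definition affine_rep :: "('a \<Rightarrow> cp2) \<Rightarrow> 'a chart \<Rightarrow> 3 \<Rightarrow> complex \<Rightarrow> complex^3" where
  "affine_rep \<rho> c i = affine_coords i \<circ> \<rho> \<circ> inv_into (fst c) (snd c)"

definition affine_rep_deriv :: "('a \<Rightarrow> cp2) \<Rightarrow> 'a chart \<Rightarrow> 3 \<Rightarrow> complex \<Rightarrow> complex^3" where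
  "affine_rep_deriv \<rho> c i w = (\<chi> j. deriv (\<lambda>s. affine_rep \<rho> c i s $ j) w)"

definition holomorphic_immersion ::
  "'a::topological_space chart set \<Rightarrow> ('a \<Rightarrow> cp2) \<Rightarrow> bool" where
  "holomorphic_immersion A \<rho> \<longleftrightarrow>
     (\<forall>i. open (\<rho> -` affine_chart_domain i)) \<and>
     (\<forall>(U, z)\<in>A. \<forall>i.
        (\<forall>j. (\<lambda>w. affine_rep \<rho> (U, z) i w $ j)
               holomorphic_on z ` (U \<inter> \<rho> -` affine_chart_domain i)) \<and>
        (\<forall>w\<in>z ` (U \<inter> \<rho> -` affine_chart_domain i). affine_rep_deriv \<rho> (U, z) i w \<noteq> 0))"


section \<open>Forms on plane curves\<close>

definition cone_over :: "cp2 set \<Rightarrow> (complex^3) set" where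
  "cone_over S = (\<Union>p\<in>S. hcoords p)"

text \<open>The tangent space at \<open>\<zeta>\<close> of the cone over the curve; at a node it is the whole space.\<close>

definition cone_tangent :: "(complex^3 \<Rightarrow> complex) \<Rightarrow> complex^3 \<Rightarrow> (complex^3) set" where
  "cone_tangent P \<zeta> = {v. frechet_derivative P (at \<zeta>) v = 0}"

text \<open>A \<open>(0,1)\<close>-form of homogeneity \<open>l\<close> on a part \<open>S\<close> of the curve \<open>P = 0\<close>, in homogeneous
  coordinates: \<open>\<Phi> \<zeta> v\<close> is the value at \<open>\<zeta>\<close> of the form
  $\Phi = \sum_j a_j(\zeta)\,d\bar\zeta_j$ on the tangent vector \<open>v\<close>. Vanishing on the direction
  \<open>\<zeta>\<close> expresses that \<open>\<Phi>\<close> comes from the projective plane, and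
  $\Phi(\lambda\zeta) = \lambda^l\Phi(\zeta)$ is an identity of forms, so that
  the differentials $d\bar\zeta_j$ are scaled as well.\<close>

definition curve_form01 ::
  "(complex^3 \<Rightarrow> complex) \<Rightarrow> cp2 set \<Rightarrow> int \<Rightarrow> (complex^3 \<Rightarrow> complex^3 \<Rightarrow> complex) \<Rightarrow> bool" where
  "curve_form01 P S l \<Phi> \<longleftrightarrow> (\<forall>\<zeta>\<in>cone_over S.
     (\<forall>u\<in>cone_tangent P \<zeta>. \<forall>v\<in>cone_tangent P \<zeta>. \<Phi> \<zeta> (u + v) = \<Phi> \<zeta> u + \<Phi> \<zeta> v) \<and>
     (\<forall>c. \<forall>v\<in>cone_tangent P \<zeta>. \<Phi> \<zeta> (c *s v) = cnj c * \<Phi> \<zeta> v) \<and>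
     \<Phi> \<zeta> \<zeta> = 0 \<and>
     (\<forall>c. \<forall>v\<in>cone_tangent P \<zeta>. c \<noteq> 0 \<longrightarrow> \<Phi> (c *s \<zeta>) (c *s v) = (c powi l) * \<Phi> \<zeta> v))"

text \<open>Continuous forms on the (possibly singular) curve are locally restrictions of continuous
  forms on the ambient space.\<close>

definition continuous_curve_form01 ::
  "(complex^3 \<Rightarrow> complex) \<Rightarrow> cp2 set \<Rightarrow> int \<Rightarrow> (complex^3 \<Rightarrow> complex^3 \<Rightarrow> complex) \<Rightarrow> bool" where
  "continuous_curve_form01 P S l \<Phi> \<longleftrightarrow> curve_form01 P S l \<Phi> \<and>
     (\<forall>\<zeta>\<in>cone_over S. \<exists>W (a :: complex^3 \<Rightarrow> complex^3). open W \<and> \<zeta> \<in> W \<and> continuous_on W a \<and>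
        (\<forall>\<eta>\<in>cone_over S \<inter> W. \<forall>v\<in>cone_tangent P \<eta>. \<Phi> \<eta> v = (\<Sum>j\<in>UNIV. a \<eta> $ j * cnj (v $ j))))"


section \<open>The direct image\<close>

text \<open>Local coordinates $z_1, z_2$ of the projective plane centered at \<open>p\<close>, given by the inverse
  of the coordinate map, lifted to homogeneous coordinates: a holomorphic \<open>\<kappa>\<close> on the ball of
  radius \<open>r\<close> inducing an injective immersion into the projective plane (whose tangent space at
  the line spanned by \<open>\<kappa> z\<close> is the quotient by that line).\<close>

definition local_coordinates :: "cp2 \<Rightarrow> real \<Rightarrow> (complex^2 \<Rightarrow> complex^3) \<Rightarrow> bool" where
  "local_coordinates p r \<kappa> \<longleftrightarrow> r > 0 \<and> \<kappa> 0 \<in> hcoords p \<and>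
     (\<forall>z\<in>ball 0 r. \<kappa> z \<noteq> 0 \<and>
        (\<exists>D. (\<kappa> has_derivative D) (at z) \<and> (\<forall>c v. D (c *s v) = c *s D v) \<and>
             (\<forall>c v. D v = c *s \<kappa> z \<longrightarrow> v = 0))) \<and>
     (\<forall>z\<in>ball 0 r. \<forall>w\<in>ball 0 r. \<forall>c. \<kappa> z = c *s \<kappa> w \<longrightarrow> z = w)"

text \<open>The branch \<open>j\<close> is parametrized by $t \mapsto$ \<open>axis j t\<close>, and \<open>\<sigma> j\<close> is its lift to the
  Riemann surface; \<open>f j\<close> is the coefficient of \<open>\<phi>\<close> on the branch \<open>j\<close> and \<open>F j\<close> its extension,
  which is holomorphic in the other coordinate.\<close>

definition direct_image_at_node ::
  "'a::topological_space chart set \<Rightarrow> ('a \<Rightarrow> cp2) \<Rightarrow> (complex^3 \<Rightarrow> complex) \<Rightarrow> 'a set \<Rightarrow>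
   'a form \<Rightarrow> (complex^3 \<Rightarrow> complex^3 \<Rightarrow> complex) \<Rightarrow> cp2 \<Rightarrow> bool" where
  "direct_image_at_node A \<rho> P S \<phi> \<Phi> p \<longleftrightarrow>
     (\<exists>r \<kappa> (\<sigma> :: 2 \<Rightarrow> complex \<Rightarrow> 'a) (f :: 2 \<Rightarrow> complex \<Rightarrow> complex)
         (F :: 2 \<Rightarrow> complex^2 \<Rightarrow> complex).
        local_coordinates p r \<kappa> \<and>
        (\<forall>z\<in>ball 0 r. P (\<kappa> z) = 0 \<longleftrightarrow> z $ 1 = 0 \<or> z $ 2 = 0) \<and>
        (\<forall>j. holomorphic_curve A (ball 0 r) (\<sigma> j) \<and>
             (\<forall>t\<in>ball 0 r. \<sigma> j t \<in> S \<and> \<kappa> (axis j t) \<in> hcoords (\<rho> (\<sigma> j t))) \<and>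
             pullback01_eq A (ball 0 r) (\<sigma> j) \<phi> (f j) \<and>
             smooth_on (ball 0 r) (F j) \<and>
             (\<forall>t\<in>ball 0 r. F j (axis j t) = f j t) \<and>
             (\<forall>k. k \<noteq> j \<longrightarrow> (\<forall>z\<in>ball 0 r. dzbar (\<lambda>s. F j (z + axis k s)) 0 = 0))) \<and>
        (\<forall>z\<in>ball 0 r. P (\<kappa> z) = 0 \<longrightarrow>
           (\<forall>v. frechet_derivative \<kappa> (at z) v \<in> cone_tangent P (\<kappa> z) \<longrightarrow>
              \<Phi> (\<kappa> z) (frechet_derivative \<kappa> (at z) v) =
                F 1 z * cnj (v $ 1) + F 2 z * cnj (v $ 2))))"

text \<open>\<open>\<Phi>\<close> is the direct image under \<open>\<rho>\<close> of the form \<open>\<phi>\<close> on \<open>S\<close>. Away from the nodes, \<open>\<phi>\<close> is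
  transported by \<open>\<rho>\<close>: the value of \<open>\<Phi>\<close> on the image under \<open>\<rho>\<close> of the coordinate vector
  $\partial/\partial z$ of a chart is the coefficient of \<open>\<phi>\<close> in that chart.\<close>

definition is_direct_image ::
  "'a::topological_space chart set \<Rightarrow> ('a \<Rightarrow> cp2) \<Rightarrow> (complex^3 \<Rightarrow> complex) \<Rightarrow> 'a set \<Rightarrow>
   'a form \<Rightarrow> (complex^3 \<Rightarrow> complex^3 \<Rightarrow> complex) \<Rightarrow> bool" where
  "is_direct_image A \<rho> P S \<phi> \<Phi> \<longleftrightarrow>
     curve_form01 P (\<rho> ` S) 0 \<Phi> \<and>
     (\<forall>(U, z)\<in>A. \<forall>x\<in>S \<inter> U. \<rho> x \<notin> nodes P \<longrightarrow>
        (\<forall>i. \<rho> x \<in> affine_chart_domain i \<longrightarrow>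
           \<Phi> (affine_coords i (\<rho> x)) (affine_rep_deriv \<rho> (U, z) i (z x)) = \<phi> (U, z) x)) \<and>
     (\<forall>p\<in>\<rho> ` S \<inter> nodes P. direct_image_at_node A \<rho> P S \<phi> \<Phi> p)"

end

theory Submission
  imports Defs
begin

text \<open>
  Choose a point $(0:1:c)$ off the curve and project from it. In the affine coordinates
  $w = z_1/z_0$ and $x = (z_2 - c z_1)/z_0$ the curve has an equation $p(x,w) = 0$, and the divided
  difference $Q(x,w,W) = (p(x,W) - p(x,w))/(W - w) = \sum_{k<d} c_k(x,w)\,W^k$ vanishes if $(x,w)$ and
  $(x,W)$ are different points of the curve, while $Q(x,w,w) = \partial p/\partial w$. So, for a form
  $\varphi = f\,d\bar x$ supported in a small set on which \<open>x\<close> is a coordinate, one pushes the functions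
  $f c_k/Q$ forward to the $x$-plane and takes their Cauchy transforms $u_k$; then
  $g = \sum_{k<d} u_k(x) w^k$ solves $\bar\partial g = \varphi$ on the whole affine curve, since the
  contributions at the other points over \<open>x\<close> cancel. As $u_k = O(1/|x|)$ and $w = O(|x|)$, this
  $g$ grows at most like $|x|^{d-2}$, which is where $\ell > d - 3$ enters.

  Only finitely many points of the compact surface (those at infinity, over nodes, or ramified for \<open>x\<close>)
  are not covered by such sets. Near each of them one first solves locally, at infinity for
  $\zeta_0^\ell\varphi$, which extends continuously, and subtracts the cut-off local solutions, so that
  the remaining form vanishes near these points.
\<close>

section \<open>Smooth functions of a complex variable\<close>

text \<open>For fixed x the quotient Q(x,w,W)/Q(x,w,w) is a Lagrange interpolation polynomial in W:
  it is 1 at W = w and 0 at the other points of the curve over x. Its coefficients are functions of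
  x alone once a small piece of the curve is fixed. Their Cauchy transforms are therefore smooth
  functions of x, and g is smooth on the whole affine part, also over nodes and at ramification
  points. The price is the denominator Q(x,w,w), which vanishes at precisely those points; this is
  why the form must first be made to vanish near them. Two estimates shape the analysis. The polar
  form of the Cauchy transform yields only a linear bound, so the decay 1/|x| is obtained by
  subtracting a linear polynomial in x. At infinity the data is merely continuous at one point, so a
  bounded solution is needed there that is smooth off this point. The bound w = O(|x|) rests on the
  centre of projection lying off the curve. Growth is recorded as a condition at each point of the
  compact surface, and the single constant appears only at the end.\<close>

lemma Ck_on_subset: "Ck_on k S f \<Longrightarrow> T \<subseteq> S \<Longrightarrow> Ck_on k T f"
proof (induction k arbitrary: f)
  case 0 then show ?case by (auto intro: continuous_on_subset)
next
  case (Suc k) then show ?case by (auto intro: differentiable_on_subset)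
qed

lemma Ck_on_SucD: "Ck_on (Suc k) S f \<Longrightarrow> Ck_on k S f"
  by (induction k arbitrary: f) (auto simp: differentiable_imp_continuous_on)

lemma Ck_on_cong:
  assumes "open S" "Ck_on k S f" "\<And>x. x \<in> S \<Longrightarrow> f x = g x"
  shows "Ck_on k S g"
  using assms(2,3)
proof (induction k arbitrary: f g)
  case 0 then show ?case by (auto cong: continuous_on_cong)
next
  case (Suc k)
  have d: "f differentiable at x" if "x \<in> S" for x
    using Suc.prems(1) \<open>open S\<close> that by (simp add: differentiable_on_eq_differentiable_at)
  have e: "frechet_derivative f (at x) = frechet_derivative g (at x)" if "x \<in> S" for x
    by (rule frechet_derivative_transform_within_open[OF d[OF that] \<open>open S\<close> that Suc.prems(2)])
  have "g differentiable at x" if "x \<in> S" for x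
    using d[OF that] \<open>open S\<close> that Suc.prems(2)
    by (metis differentiable_def has_derivative_transform_within_open)
  then have "g differentiable_on S"
    by (simp add: differentiable_at_imp_differentiable_on)
  moreover have "Ck_on k S (\<lambda>x. frechet_derivative g (at x) b)" if "b \<in> Basis" for b
    by (rule Suc.IH[of "\<lambda>x. frechet_derivative f (at x) b"]) (use that Suc.prems e in auto)
  ultimately show ?case by simp
qed

lemma Ck_on_local:
  assumes "\<And>x. x \<in> S \<Longrightarrow> \<exists>W. open W \<and> x \<in> W \<and> Ck_on k W f"
  shows "Ck_on k S f"
  using assms
proof (induction k arbitrary: f)
  case 0
  then have "\<And>x. x \<in> S \<Longrightarrow> isCont f x"
    by (metis Ck_on.simps(1) continuous_on_eq_continuous_at)
  then show ?case by (simp add: continuous_at_imp_continuous_on)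
next
  case (Suc k)
  have "f differentiable at x" if "x \<in> S" for x
    using Suc.prems[OF that] by (auto simp: differentiable_on_eq_differentiable_at)
  then have "f differentiable_on S"
    by (simp add: differentiable_at_imp_differentiable_on)
  moreover have "Ck_on k S (\<lambda>x. frechet_derivative f (at x) b)" if "b \<in> Basis" for b
    by (rule Suc.IH) (use Suc.prems that in force)
  ultimately show ?case by simp
qed

text \<open>\<open>Ck_on\<close> speaks of the chosen \<open>frechet_derivative\<close>. This rule
  accepts an explicit derivative instead, so that closure properties become inductions on
  \<open>k\<close> whose step applies the hypothesis to the terms of a differentiation
  formula.\<close>

lemma Ck_on_SucI:
  assumes "open S" "\<And>x. x \<in> S \<Longrightarrow> (f has_derivative f' x) (at x)"
    "\<And>b. b \<in> Basis \<Longrightarrow> Ck_on k S (\<lambda>x. f' x b)"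
  shows "Ck_on (Suc k) S f"
proof -
  have e: "frechet_derivative f (at x) = f' x" if "x \<in> S" for x
    using assms(2)[OF that] by (metis frechet_derivative_at)
  have "f differentiable_on S"
    using assms(2) by (meson differentiable_at_imp_differentiable_on differentiableI)
  moreover have "Ck_on k S (\<lambda>x. frechet_derivative f (at x) b)" if "b \<in> Basis" for b
    by (rule Ck_on_cong[OF assms(1) assms(3)[OF that]]) (simp add: e)
  ultimately show ?thesis by simp
qed

lemma Ck_on_SucE:
  assumes "open S" "Ck_on (Suc k) S f" "x \<in> S"
  shows "(f has_derivative frechet_derivative f (at x)) (at x)"
  using assms by (simp add: differentiable_on_eq_differentiable_at frechet_derivative_works[symmetric])

lemma Ck_on_const: "Ck_on k S (\<lambda>x. c)"
proof (induction k arbitrary: c)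
  case 0 then show ?case by simp
next
  case (Suc k)
  then show ?case by (simp add: differentiable_on_const)
qed

lemma Ck_on_add:
  assumes "open S" "Ck_on k S f" "Ck_on k S g"
  shows "Ck_on k S (\<lambda>x. f x + g x)"
  using assms(2,3)
proof (induction k arbitrary: f g)
  case 0 then show ?case by (auto intro: continuous_intros)
next
  case (Suc k)
  show ?case
  proof (rule Ck_on_SucI[OF \<open>open S\<close>])
    fix x assume "x \<in> S"
    then show "((\<lambda>x. f x + g x) has_derivative
        (\<lambda>h. frechet_derivative f (at x) h + frechet_derivative g (at x) h)) (at x)"
      using Ck_on_SucE[OF \<open>open S\<close>] Suc.prems by (blast intro: has_derivative_add)
  qed (use Suc in auto)
qed

lemma Ck_on_mult:
  assumes "open S" "Ck_on k S f" "Ck_on k S g"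
  shows "Ck_on k S (\<lambda>x. f x * g x)"
  using assms(2,3)
proof (induction k arbitrary: f g)
  case 0 then show ?case by (auto intro: continuous_intros)
next
  case (Suc k)
  show ?case
  proof (rule Ck_on_SucI[OF \<open>open S\<close>])
    fix x assume "x \<in> S"
    then show "((\<lambda>x. f x * g x) has_derivative
        (\<lambda>h. f x * frechet_derivative g (at x) h + frechet_derivative f (at x) h * g x)) (at x)"
      using Ck_on_SucE[OF \<open>open S\<close>] Suc.prems by (blast intro: has_derivative_mult)
  next
    fix b :: 'a assume "b \<in> Basis"
    then show "Ck_on k S (\<lambda>x. f x * frechet_derivative g (at x) b + frechet_derivative f (at x) b * g x)"
      using Suc.prems Suc.prems[THEN Ck_on_SucD] by (intro Ck_on_add \<open>open S\<close> Suc.IH) simp_all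
  qed
qed

lemma Ck_on_cnj:
  assumes "open S" "Ck_on k S f"
  shows "Ck_on k S (\<lambda>x. cnj (f x))"
  using assms(2)
proof (induction k arbitrary: f)
  case 0 then show ?case by (auto intro: continuous_intros)
next
  case (Suc k)
  show ?case
  proof (rule Ck_on_SucI[OF \<open>open S\<close>])
    fix x assume "x \<in> S"
    then show "((\<lambda>x. cnj (f x)) has_derivative (\<lambda>h. cnj (frechet_derivative f (at x) h))) (at x)"
      using Ck_on_SucE[OF \<open>open S\<close>] Suc.prems
      by (blast intro: bounded_linear.has_derivative[OF bounded_linear_cnj])
  qed (use Suc in auto)
qed

lemma Ck_on_inverse:
  assumes "open S" "Ck_on k S f" "\<And>x. x \<in> S \<Longrightarrow> f x \<noteq> 0"
  shows "Ck_on k S (\<lambda>x. inverse (f x))"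
  using assms(2,3)
proof (induction k arbitrary: f)
  case 0 then show ?case by (auto intro: continuous_intros)
next
  case (Suc k)
  show ?case
  proof (rule Ck_on_SucI[OF \<open>open S\<close>])
    fix x assume x: "x \<in> S"
    show "((\<lambda>x. inverse (f x)) has_derivative
        (\<lambda>h. (- 1) * (inverse (f x) * frechet_derivative f (at x) h * inverse (f x)))) (at x)"
      using Deriv.has_derivative_inverse[OF Suc.prems(2)[OF x] Ck_on_SucE[OF \<open>open S\<close> Suc.prems(1) x]]
      by simp
  next
    fix b :: 'a assume "b \<in> Basis"
    then show "Ck_on k S (\<lambda>x. (- 1) * (inverse (f x) * frechet_derivative f (at x) b * inverse (f x)))"
      using Suc.prems Ck_on_SucD[OF Suc.prems(1)]
      by (intro Ck_on_mult Ck_on_const \<open>open S\<close> Suc.IH) simp_all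
  qed
qed

lemma Ck_on_holomorphic:
  assumes "open S" "f holomorphic_on S"
  shows "Ck_on k S f"
  using assms(2)
proof (induction k arbitrary: f)
  case 0 then show ?case by (simp add: holomorphic_on_imp_continuous_on)
next
  case (Suc k)
  show ?case
  proof (rule Ck_on_SucI[OF \<open>open S\<close>])
    fix x assume "x \<in> S"
    then show "(f has_derivative (\<lambda>h. deriv f x * h)) (at x)"
      using Suc.prems \<open>open S\<close> by (metis has_field_derivative_def holomorphic_derivI)
  next
    fix b :: complex assume "b \<in> Basis"
    show "Ck_on k S (\<lambda>x. deriv f x * b)"
      by (intro Suc.IH holomorphic_intros holomorphic_deriv Suc.prems \<open>open S\<close>)
  qed
qed

lemma real_linear_complex:
  fixes F :: "complex \<Rightarrow> complex"
  assumes "linear F"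
  shows "F h = of_real (Re h) * F 1 + of_real (Im h) * F \<i>"
proof -
  have "F h = F (Re h *\<^sub>R 1 + Im h *\<^sub>R \<i>)"
    by (rule arg_cong[where f = F]) (simp add: complex_eq_iff)
  also have "\<dots> = Re h *\<^sub>R F 1 + Im h *\<^sub>R F \<i>"
    using assms by (simp add: linear_add linear_scale)
  finally show ?thesis by (simp add: scaleR_conv_of_real)
qed

lemma Ck_on_of_real_Re:
  assumes "open S" "Ck_on k S f"
  shows "Ck_on k S (\<lambda>x. of_real (Re (f x)))"
proof -
  have "Ck_on k S (\<lambda>x. (1/2) * (f x + cnj (f x)))"
    by (intro Ck_on_mult Ck_on_add Ck_on_cnj Ck_on_const assms)
  then show ?thesis
    by (rule Ck_on_cong[OF assms(1)]) (simp add: complex_add_cnj)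
qed

text \<open>The real chain rule involves the real and imaginary parts of
  \<open>deriv h x * b\<close>. The imaginary part is written as \<open>Re (- \<i> * _)\<close>, so
  that both fall under \<open>Ck_on_of_real_Re\<close>; the partial derivatives of \<open>f\<close>
  composed with \<open>h\<close> fall under the induction hypothesis.\<close>

lemma Ck_on_compose_holomorphic:
  assumes "open S" "open T" "Ck_on k S f" "h holomorphic_on T" "h ` T \<subseteq> S"
  shows "Ck_on k T (\<lambda>t. f (h t))"
  using assms(3)
proof (induction k arbitrary: f)
  case 0 then show ?case
    using assms by (auto intro: continuous_on_compose2 holomorphic_on_imp_continuous_on)
next
  case (Suc k)
  define D where "D b x = frechet_derivative f (at x) b" for b x
  have Re: "of_real (Im z) = of_real (Re (- \<i> * z))" for z by simp
  show ?case
  proof (rule Ck_on_SucI[OF \<open>open T\<close>])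
    fix x assume x: "x \<in> T"
    have 1: "(h has_derivative (\<lambda>b. deriv h x * b)) (at x)"
      using assms x by (metis has_field_derivative_def holomorphic_derivI)
    have "h x \<in> S" using assms(5) x by auto
    then have 2: "(f has_derivative frechet_derivative f (at (h x))) (at (h x))"
      using Ck_on_SucE[OF \<open>open S\<close> Suc.prems(1)] by blast
    have lin: "linear (frechet_derivative f (at (h x)))"
      using 2 has_derivative_linear by blast
    show "((\<lambda>t. f (h t)) has_derivative
        (\<lambda>b. of_real (Re (deriv h x * b)) * D 1 (h x) + of_real (Re (- \<i> * (deriv h x * b))) * D \<i> (h x))) (at x)"
      using has_derivative_compose[OF 1 2] unfolding D_def real_linear_complex[OF lin, of "deriv h x * _"]
      by (simp add: add.commute)
  next
    fix b :: complex
    have D: "Ck_on k T (\<lambda>x. D c (h x))" if "c \<in> Basis" for c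
      unfolding D_def by (rule Suc.IH) (use Suc.prems that in simp)
    have hb: "Ck_on k T (\<lambda>x. deriv h x * b)" "Ck_on k T (\<lambda>x. - \<i> * (deriv h x * b))"
      by (intro Ck_on_holomorphic \<open>open T\<close> holomorphic_intros holomorphic_deriv assms)+
    show "Ck_on k T (\<lambda>x. of_real (Re (deriv h x * b)) * D 1 (h x)
        + of_real (Re (- \<i> * (deriv h x * b))) * D \<i> (h x))"
      by (intro Ck_on_add Ck_on_mult Ck_on_of_real_Re \<open>open T\<close> hb D) (auto simp: Basis_complex_def)
  qed
qed

lemma smooth_on_subset: "smooth_on S f \<Longrightarrow> T \<subseteq> S \<Longrightarrow> smooth_on T f"
  unfolding smooth_on_def using Ck_on_subset by blast

lemma smooth_on_cong: "open S \<Longrightarrow> smooth_on S f \<Longrightarrow> (\<And>x. x \<in> S \<Longrightarrow> f x = g x) \<Longrightarrow> smooth_on S g"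
  unfolding smooth_on_def using Ck_on_cong by blast

lemma smooth_on_local:
  "(\<And>x. x \<in> S \<Longrightarrow> \<exists>W. open W \<and> x \<in> W \<and> smooth_on W f) \<Longrightarrow> smooth_on S f"
  unfolding smooth_on_def by (metis Ck_on_local)

lemma smooth_on_const [simp]: "smooth_on S (\<lambda>x. c)"
  by (simp add: smooth_on_def Ck_on_const)

lemma smooth_on_add: "open S \<Longrightarrow> smooth_on S f \<Longrightarrow> smooth_on S g \<Longrightarrow> smooth_on S (\<lambda>x. f x + g x)"
  by (simp add: smooth_on_def Ck_on_add)

lemma smooth_on_mult: "open S \<Longrightarrow> smooth_on S f \<Longrightarrow> smooth_on S g \<Longrightarrow> smooth_on S (\<lambda>x. f x * g x)"
  by (simp add: smooth_on_def Ck_on_mult)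

lemma smooth_on_minus: "open S \<Longrightarrow> smooth_on S f \<Longrightarrow> smooth_on S (\<lambda>x. - f x)"
  using smooth_on_mult[of S "\<lambda>_. - 1" f] by simp

lemma smooth_on_diff: "open S \<Longrightarrow> smooth_on S f \<Longrightarrow> smooth_on S g \<Longrightarrow> smooth_on S (\<lambda>x. f x - g x)"
  using smooth_on_add[of S f "\<lambda>x. - g x"] by (simp add: smooth_on_minus)

lemma smooth_on_cnj: "open S \<Longrightarrow> smooth_on S f \<Longrightarrow> smooth_on S (\<lambda>x. cnj (f x))"
  by (simp add: smooth_on_def Ck_on_cnj)

lemma smooth_on_inverse:
  "open S \<Longrightarrow> smooth_on S f \<Longrightarrow> (\<And>x. x \<in> S \<Longrightarrow> f x \<noteq> 0) \<Longrightarrow> smooth_on S (\<lambda>x. inverse (f x))"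
  by (simp add: smooth_on_def Ck_on_inverse)

lemma smooth_on_holomorphic: "open S \<Longrightarrow> f holomorphic_on S \<Longrightarrow> smooth_on S f"
  by (simp add: smooth_on_def Ck_on_holomorphic)

lemma smooth_on_compose_holomorphic:
  "smooth_on S f \<Longrightarrow> open S \<Longrightarrow> open T \<Longrightarrow> h holomorphic_on T \<Longrightarrow> h ` T \<subseteq> S \<Longrightarrow> smooth_on T (\<lambda>t. f (h t))"
  by (auto simp: smooth_on_def Ck_on_compose_holomorphic)

lemma smooth_on_has_derivative:
  "smooth_on S f \<Longrightarrow> open S \<Longrightarrow> x \<in> S \<Longrightarrow> (f has_derivative frechet_derivative f (at x)) (at x)"
  unfolding smooth_on_def by (rule Ck_on_SucE) auto

lemma smooth_on_continuous: "smooth_on S f \<Longrightarrow> continuous_on S f"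
  unfolding smooth_on_def using Ck_on.simps(1) by blast

lemma smooth_on_frechet_derivative:
  "smooth_on S f \<Longrightarrow> b \<in> Basis \<Longrightarrow> smooth_on S (\<lambda>x. frechet_derivative f (at x) b)"
  unfolding smooth_on_def using Ck_on.simps(2) by blast

lemma smooth_on_dzbar:
  assumes "open S" "smooth_on S f" shows "smooth_on S (dzbar f)"
proof -
  have "smooth_on S (\<lambda>x. (1/2) * (frechet_derivative f (at x) 1 + \<i> * frechet_derivative f (at x) \<i>))"
    by (intro smooth_on_mult smooth_on_add smooth_on_const smooth_on_frechet_derivative assms)
       (auto simp: Basis_complex_def)
  then show ?thesis by (simp add: dzbar_def[abs_def])
qed

section \<open>Rules for the Wirtinger derivative\<close>

lemma dzbar_eqI: "(f has_derivative F) (at w) \<Longrightarrow> dzbar f w = (F 1 + \<i> * F \<i>) / 2"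
  by (simp add: dzbar_def frechet_derivative_at[symmetric])

lemma dzbar_cong:
  assumes "open S" "x \<in> S" "f differentiable at x" "\<And>y. y \<in> S \<Longrightarrow> f y = g y"
  shows "dzbar f x = dzbar g x"
  using frechet_derivative_transform_within_open[OF assms(3,1,2,4)] by (simp add: dzbar_def)

lemma dzbar_add:
  "f differentiable at x \<Longrightarrow> g differentiable at x \<Longrightarrow> dzbar (\<lambda>t. f t + g t) x = dzbar f x + dzbar g x"
  by (subst dzbar_eqI[OF has_derivative_add])
     (auto simp: frechet_derivative_works[symmetric] dzbar_def algebra_simps add_divide_distrib)

lemma dzbar_mult:
  assumes "f differentiable at x" "g differentiable at x"
  shows "dzbar (\<lambda>t. f t * g t) x = dzbar f x * g x + f x * dzbar g x"
proof -
  have "((\<lambda>t. f t * g t) has_derivative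
    (\<lambda>h. f x * frechet_derivative g (at x) h + frechet_derivative f (at x) h * g x)) (at x)"
    using assms by (intro has_derivative_mult) (auto simp: frechet_derivative_works[symmetric])
  from dzbar_eqI[OF this] show ?thesis
    unfolding dzbar_def by (simp add: algebra_simps add_divide_distrib)
qed

text \<open>\<open>dzbar\<close> reads off the antilinear part of a real-linear map, and composition
  with multiplication by \<open>h'\<close> multiplies that part by \<open>cnj h'\<close>. This is
  the transformation law of the coefficient of a (0,1)-form.\<close>

lemma dzbar_compose_holomorphic:
  assumes "f differentiable at (h x)" "(h has_field_derivative h') (at x)"
  shows "dzbar (\<lambda>t. f (h t)) x = dzbar f (h x) * cnj h'"
proof -
  let ?F = "frechet_derivative f (at (h x))"
  have F: "(f has_derivative ?F) (at (h x))"
    using assms(1) frechet_derivative_works by blast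
  have lin: "linear ?F" using F has_derivative_linear by blast
  have "((\<lambda>t. f (h t)) has_derivative (\<lambda>b. ?F (h' * b))) (at x)"
    using has_derivative_compose[of h "(*) h'" x UNIV f ?F] F assms(2) by (simp add: has_field_derivative_def)
  from dzbar_eqI[OF this] show ?thesis
    unfolding real_linear_complex[OF lin, of "h' * _"]
    by (simp add: dzbar_def complex_eq_iff field_simps)
qed

lemma dzbar_holomorphic: "(f has_field_derivative f') (at x) \<Longrightarrow> dzbar f x = 0"
  by (subst dzbar_eqI) (auto simp: has_field_derivative_def algebra_simps)

text \<open>Cauchy-Riemann: a vanishing \<open>dzbar\<close> gives
  \<open>?F \<i> = \<i> * ?F 1\<close>, which makes the real derivative complex linear.\<close>

lemma holomorphic_on_dzbar_0:
  assumes "open S" "\<And>x. x \<in> S \<Longrightarrow> f differentiable at x" "\<And>x. x \<in> S \<Longrightarrow> dzbar f x = 0"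
  shows "f holomorphic_on S"
proof -
  have "f field_differentiable at x" if "x \<in> S" for x
  proof -
    let ?F = "frechet_derivative f (at x)"
    have F: "(f has_derivative ?F) (at x)"
      using assms(2)[OF that] frechet_derivative_works by blast
    have i: "?F \<i> = \<i> * ?F 1"
      using assms(3)[OF that] by (simp add: dzbar_def complex_eq_iff)
    have "?F h = ?F 1 * h" for h
      using real_linear_complex[OF has_derivative_linear[OF F], of h]
      by (simp add: i complex_eq_iff algebra_simps)
    then have "?F = (*) (?F 1)" by (rule ext)
    then have "(f has_field_derivative ?F 1) (at x)"
      using F by (simp only: has_field_derivative_def)
    then show ?thesis using field_differentiable_def by blast
  qed
  then show ?thesis
    by (simp add: holomorphic_on_def field_differentiable_at_within)
qed

section \<open>Bump functions and the Cauchy transform\<close>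

text \<open>The powers in the denominator make the span of the family closed under differentiation,
  so that one induction on \<open>k\<close>, for all \<open>n\<close> at once, gives
  smoothness.\<close>

definition flat_exp :: "nat \<Rightarrow> real \<Rightarrow> real" where
  "flat_exp n x = (if x > 0 then exp (- 1 / x) / x ^ n else 0)"

lemma flat_exp_tendsto_0: "(flat_exp n \<longlongrightarrow> 0) (at_right 0)"
proof -
  have "((\<lambda>x::real. exp (- 1 / x) / x ^ n) \<longlongrightarrow> 0) (at_right 0)"
    by real_asymp
  then show ?thesis
    by (rule Lim_transform_eventually) (auto simp: flat_exp_def eventually_at_filter)
qed

lemma flat_exp_deriv: "(flat_exp n has_real_derivative flat_exp (n + 2) x - n * flat_exp (n + 1) x) (at x)"
proof -
  consider "x > 0" | "x < 0" | "x = 0" by linarith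
  then show ?thesis
  proof cases
    case 1
    have "((\<lambda>x. exp (- 1 / x) / x ^ n) has_real_derivative
        flat_exp (n + 2) x - n * flat_exp (n + 1) x) (at x)"
      using 1 power_eq_if[of x "n - 1"]
      by (cases n) (auto intro!: derivative_eq_intros simp: flat_exp_def field_simps power2_eq_square split: if_splits)
    then show ?thesis
      by (rule has_field_derivative_transform_within_open[where S = "{0<..}"])
         (use 1 in \<open>auto simp: flat_exp_def\<close>)
  next
    case 2
    have "((\<lambda>x. 0) has_real_derivative flat_exp (n + 2) x - n * flat_exp (n + 1) x) (at x)"
      using 2 by (auto simp: flat_exp_def)
    then show ?thesis
      by (rule has_field_derivative_transform_within_open[where S = "{..<0}"])
         (use 2 in \<open>auto simp: flat_exp_def\<close>)
  next
    case 3
    \<comment> \<open>For positive \<open>y\<close> the difference quotient at 0 is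
      \<open>flat_exp (Suc n) y\<close>, another member of the family.\<close>
    have r: "((\<lambda>y. (flat_exp n y - flat_exp n 0) / (y - 0)) \<longlongrightarrow> 0) (at_right 0)"
      by (rule Lim_transform_eventually[OF flat_exp_tendsto_0[of "Suc n"]])
         (auto simp: flat_exp_def eventually_at_filter)
    have l: "((\<lambda>y. (flat_exp n y - flat_exp n 0) / (y - 0)) \<longlongrightarrow> 0) (at_left 0)"
      by (rule Lim_transform_eventually[OF tendsto_const])
         (auto simp: flat_exp_def eventually_at_filter)
    from filterlim_split_at[OF l r] show ?thesis
      unfolding 3 by (simp add: has_field_derivative_iff flat_exp_def)
  qed
qed

text \<open>The squared norm, unlike the norm, is smooth at the origin. The coefficients
  \<open>a\<close> and \<open>c\<close> cover both arguments that occur in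
  \<open>bump\<close>.\<close>

lemma Ck_on_flat_exp:
  "Ck_on k UNIV (\<lambda>t::complex. of_real (flat_exp n (a * (norm t)\<^sup>2 + c)))"
proof (induction k arbitrary: n)
  case 0
  have "isCont (flat_exp n) x" for x
    using flat_exp_deriv DERIV_isCont by blast
  then have "continuous_on UNIV (flat_exp n)"
    by (simp add: continuous_at_imp_continuous_on)
  then show ?case
    by (auto intro!: continuous_intros continuous_on_compose2[of UNIV "flat_exp n"])
next
  case (Suc k)
  let ?N = "\<lambda>t::complex. a * (norm t)\<^sup>2 + c"
  let ?e = "\<lambda>n t. complex_of_real (flat_exp n (?N t))"
  show ?case
  proof (rule Ck_on_SucI[OF open_UNIV])
    fix t :: complex
    have "(?N has_derivative (\<lambda>h. 2 * a * (t \<bullet> h))) (at t)"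
      unfolding power2_norm_eq_inner
      by (auto intro!: derivative_eq_intros simp: inner_commute algebra_simps)
    from has_derivative_compose[OF this flat_exp_deriv[of n "?N t", unfolded has_field_derivative_def]]
    have "((\<lambda>t. flat_exp n (?N t)) has_derivative
      (\<lambda>h. (flat_exp (n + 2) (?N t) - n * flat_exp (n + 1) (?N t)) * (2 * a * (t \<bullet> h)))) (at t)"
      by simp
    from bounded_linear.has_derivative[OF bounded_linear_of_real this]
    show "((\<lambda>t. ?e n t) has_derivative
      (\<lambda>h. (?e (n + 2) t + (- of_nat n) * ?e (n + 1) t) * (of_real (2 * a) * of_real (t \<bullet> h)))) (at t)"
      by simp
  next
    fix b :: complex
    have "(\<lambda>t. complex_of_real (t \<bullet> b)) = (\<lambda>t. of_real (Re (cnj b * t)))"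
      by (simp add: inner_complex_def mult.commute)
    then have "Ck_on k UNIV (\<lambda>t. complex_of_real (t \<bullet> b))"
      by (simp only:) (intro Ck_on_of_real_Re Ck_on_holomorphic open_UNIV holomorphic_intros)
    then show "Ck_on k UNIV (\<lambda>t. (?e (n + 2) t + (- of_nat n) * ?e (n + 1) t) * (of_real (2 * a) * of_real (t \<bullet> b)))"
      by (intro Ck_on_mult Ck_on_add Ck_on_const Suc open_UNIV)
  qed
qed

definition bump :: "complex \<Rightarrow> complex" where
  "bump t = of_real (flat_exp 0 (4 - (norm t)\<^sup>2) / (flat_exp 0 (4 - (norm t)\<^sup>2) + flat_exp 0 ((norm t)\<^sup>2 - 1)))"

lemma flat_exp_nonneg: "flat_exp n x \<ge> 0"
  by (simp add: flat_exp_def)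

text \<open>Every \<open>s\<close> satisfies \<open>s < 4\<close> or \<open>s > 1\<close>, and the
  corresponding summand is positive.\<close>

lemma bump_denominator: "flat_exp 0 (4 - s) + flat_exp 0 (s - 1) > 0"
  by (cases "s < 4") (auto simp: flat_exp_def add_pos_nonneg add_nonneg_pos)

lemma smooth_on_bump: "smooth_on UNIV bump"
proof -
  let ?e = "\<lambda>a c t::complex. complex_of_real (flat_exp 0 (a * (norm t)\<^sup>2 + c))"
  have "?e (-1) 4 t + ?e 1 (-1) t \<noteq> 0" for t
    using bump_denominator[of "(norm t)\<^sup>2"]
    by (metis add.commute diff_conv_add_uminus mult_1 mult_minus1 of_real_add of_real_eq_0_iff less_irrefl)
  then have "smooth_on UNIV (\<lambda>t. ?e (-1) 4 t * inverse (?e (-1) 4 t + ?e 1 (-1) t))"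
    by (intro smooth_on_mult smooth_on_inverse smooth_on_add open_UNIV)
       (auto simp only: smooth_on_def intro: Ck_on_flat_exp)
  then show ?thesis
    by (simp add: bump_def[abs_def] divide_inverse add.commute)
qed

lemma bump_eq_1: "norm t \<le> 1 \<Longrightarrow> bump t = 1"
  using bump_denominator[of "(norm t)\<^sup>2"] power_mono[of "norm t" 1 2]
  by (simp add: bump_def flat_exp_def)

lemma bump_eq_0: "norm t \<ge> 2 \<Longrightarrow> bump t = 0"
  using power_mono[of 2 "norm t" 2] by (simp add: bump_def flat_exp_def)

lemma norm_bump_le: "norm (bump t) \<le> 1"
  using bump_denominator[of "(norm t)\<^sup>2"]
  unfolding bump_def norm_of_real by (simp add: flat_exp_nonneg)

lemma bump_at:
  assumes "0 < e"
  obtains \<beta> :: "complex \<Rightarrow> complex" where "smooth_on UNIV \<beta>" "\<And>t. dist t c \<le> e \<Longrightarrow> \<beta> t = 1"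
    "\<And>t. dist t c \<ge> 2 * e \<Longrightarrow> \<beta> t = 0" "\<And>t. norm (\<beta> t) \<le> 1"
proof
  show "smooth_on UNIV (\<lambda>t. bump ((t - c) / of_real e))"
    by (rule smooth_on_compose_holomorphic[OF smooth_on_bump])
       (use assms in \<open>auto intro!: holomorphic_intros\<close>)
  show "bump ((t - c) / of_real e) = 1" if "dist t c \<le> e" for t
    using assms that by (intro bump_eq_1) (simp add: dist_norm norm_divide divide_simps)
  show "bump ((t - c) / of_real e) = 0" if "dist t c \<ge> 2 * e" for t
    using assms that by (intro bump_eq_0) (simp add: dist_norm norm_divide divide_simps)
qed (rule norm_bump_le)

text \<open>The Cauchy transform $\frac1\pi\int f(s)/(t-s)\,dA(s)$ in polar coordinates
  $s = t - r e^{i\theta}$, in which the kernel is bounded.\<close>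

definition cauchy_tr :: "real \<Rightarrow> (complex \<Rightarrow> complex) \<Rightarrow> complex \<Rightarrow> complex" where
  "cauchy_tr R f t = integral (cbox (0, 0) (R, 2 * pi))
     (\<lambda>p. f (t - of_real (fst p) * cis (snd p)) * cis (- snd p)) / of_real pi"

lemma continuous_on_polar:
  assumes "continuous_on UNIV f"
  shows "continuous_on S (\<lambda>p. f (t - of_real (fst p) * cis (snd p)) * cis (- snd p))"
  by (intro continuous_intros continuous_on_compose2[OF assms]) auto

lemma cauchy_tr_bound:
  assumes "continuous_on UNIV f" "\<And>t. norm (f t) \<le> B" "0 \<le> R"
  shows "norm (cauchy_tr R f t) \<le> 2 * B * R"
proof -
  have "B \<ge> 0" using assms(2)[of 0] norm_ge_zero order_trans by blast
  have "norm (integral (cbox (0, 0) (R, 2 * pi))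
     (\<lambda>p. f (t - of_real (fst p) * cis (snd p)) * cis (- snd p))) \<le> B * measure lborel (cbox (0::real, 0::real) (R, 2 * pi))"
    by (rule has_integral_bound[OF \<open>B \<ge> 0\<close> integrable_integral[OF integrable_continuous[OF continuous_on_polar[OF assms(1)]]]])
       (simp add: norm_mult assms)
  also have "\<dots> = B * (R * (2 * pi))"
    using assms(3) by (simp add: content_Pair)
  finally show ?thesis
    by (simp add: cauchy_tr_def norm_divide divide_simps mult_ac)
qed

lemma cauchy_tr_diff:
  assumes "continuous_on UNIV f" "continuous_on UNIV g"
  shows "cauchy_tr R (\<lambda>t. f t - g t) t = cauchy_tr R f t - cauchy_tr R g t"
  unfolding cauchy_tr_def left_diff_distrib diff_divide_distrib[symmetric]
  by (subst integral_diff) (auto intro!: integrable_continuous continuous_on_polar assms)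

lemma cauchy_tr_add:
  assumes "continuous_on UNIV f" "continuous_on UNIV g"
  shows "cauchy_tr R (\<lambda>t. f t + g t) t = cauchy_tr R f t + cauchy_tr R g t"
  unfolding cauchy_tr_def distrib_right add_divide_distrib[symmetric]
  by (subst integral_add) (auto intro!: integrable_continuous continuous_on_polar assms)

lemma cauchy_tr_cmult: "cauchy_tr R (\<lambda>t. c * f t) t = c * cauchy_tr R f t"
  unfolding cauchy_tr_def mult.assoc by simp

text \<open>The transform integrates over a disc of radius \<open>R\<close> about \<open>t\<close>.
  Since \<open>norm t + M \<le> R\<close>, this disc contains all points where \<open>f\<close> is
  nonzero, and enlarging it adds nothing.\<close>

lemma cauchy_tr_radius:
  assumes "continuous_on UNIV f" "\<And>t. norm t \<ge> M \<Longrightarrow> f t = 0" "norm t + M \<le> R" "R \<le> R'" 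
  shows "cauchy_tr R' f t = cauchy_tr R f t"
proof -
  let ?F = "\<lambda>p. f (t - of_real (fst p) * cis (snd p)) * cis (- snd p)"
  have "(?F has_integral integral (cbox (0,0) (R,2*pi)) ?F) (cbox (0,0) (R,2*pi))"
    by (intro integrable_integral integrable_continuous continuous_on_polar assms)
  moreover have "?F p = 0" if "p \<in> cbox (0,0) (R',2*pi) - cbox (0,0) (R,2*pi)" for p
  proof -
    have "fst p > R" "fst p \<ge> 0" using that by (auto simp: mem_box cbox_Pair_eq)
    then have "norm (of_real (fst p) * cis (snd p)) - norm t \<ge> M"
      using assms(3) by (simp add: norm_mult)
    then have "norm (t - of_real (fst p) * cis (snd p)) \<ge> M"
      using norm_triangle_ineq2[of "of_real (fst p) * cis (snd p)" t] by (simp add: norm_minus_commute)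
    then show ?thesis using assms(2) by simp
  qed
  moreover have "cbox (0,0) (R,2*pi) \<subseteq> cbox (0,0) (R',2*pi)"
    using assms(4) by (auto simp: cbox_Pair_eq)
  ultimately have "((\<lambda>p. if p \<in> cbox (0,0) (R,2*pi) then ?F p else 0) has_integral
      integral (cbox (0,0) (R,2*pi)) ?F) (cbox (0,0) (R',2*pi))"
    by (subst has_integral_restrict)
  then have "(?F has_integral integral (cbox (0,0) (R,2*pi)) ?F) (cbox (0,0) (R',2*pi))"
    by (rule has_integral_eq[rotated]) (use \<open>\<And>p. p \<in> _ \<Longrightarrow> ?F p = 0\<close> in auto)
  then show ?thesis
    by (simp add: cauchy_tr_def integral_unique)
qed

text \<open>In polar coordinates centered at \<open>t\<close> the variable \<open>t\<close> enters
  only through the argument of \<open>f\<close>, and the kernel is bounded. One may differentiate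
  under the integral sign, and all derivatives fall on \<open>f\<close>.\<close>

lemma cauchy_tr_has_derivative:
  assumes der: "\<And>x. (f has_derivative (\<lambda>h. of_real (Re h) * f1 x + of_real (Im h) * f2 x)) (at x)"
    and c: "continuous_on UNIV f1" "continuous_on UNIV f2"
  shows "(cauchy_tr R f has_derivative
    (\<lambda>h. of_real (Re h) * cauchy_tr R f1 t + of_real (Im h) * cauchy_tr R f2 t)) (at t)"
proof -
  have cf: "continuous_on UNIV f"
    using der has_derivative_continuous by (metis continuous_at_imp_continuous_on)
  let ?s = "\<lambda>t p. t - of_real (fst p) * cis (snd p) :: complex"
  \<comment> \<open>The Leibniz rule below takes the derivative as a continuous family of bounded
    linear maps, so it is assembled from \<open>Re\<close> and \<open>Im\<close> inside that
    type.\<close>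
  define R1 R2 where "R1 = Blinfun Re" and "R2 = Blinfun Im"
  have R1: "blinfun_apply R1 = Re" and R2: "blinfun_apply R2 = Im"
    by (simp_all add: R1_def R2_def bounded_linear_Blinfun_apply bounded_linear_Re bounded_linear_Im)
  define L where "L t p = (blinfun_scaleR_left (f1 (?s t p) * cis (- snd p)) o\<^sub>L R1) +
      (blinfun_scaleR_left (f2 (?s t p) * cis (- snd p)) o\<^sub>L R2)" for t p
  have L: "blinfun_apply (L t p) h = of_real (Re h) * (f1 (?s t p) * cis (- snd p)) + of_real (Im h) * (f2 (?s t p) * cis (- snd p))" for t p h
    by (simp add: L_def R1 R2 blinfun.add_left scaleR_conv_of_real)
  have cL: "continuous_on (UNIV \<times> cbox (0, 0) (R, 2 * pi)) (\<lambda>(t, p). L t p)"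
    unfolding L_def split_beta
    by (intro continuous_intros bounded_linear.continuous_on[OF bounded_linear_blinfun_scaleR_left]
        continuous_on_compose2[OF c(1)] continuous_on_compose2[OF c(2)]) auto
  have D: "((\<lambda>t. integral (cbox (0, 0) (R, 2 * pi)) (\<lambda>p. f (?s t p) * cis (- snd p)))
      has_derivative blinfun_apply (integral (cbox (0, 0) (R, 2 * pi)) (L t))) (at t within UNIV)"
  proof (rule leibniz_rule[OF _ _ cL])
    fix x :: complex and p :: "real \<times> real"
    have "((\<lambda>x. f (?s x p) * cis (- snd p)) has_derivative
       (\<lambda>h. (of_real (Re h) * f1 (?s x p) + of_real (Im h) * f2 (?s x p)) * cis (- snd p))) (at x)"
      by (rule has_derivative_mult_left, rule has_derivative_compose[of "\<lambda>x. ?s x p" "\<lambda>h. h" x UNIV f,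
           OF _ der]) (auto intro!: derivative_eq_intros)
    then show "((\<lambda>x. f (?s x p) * cis (- snd p)) has_derivative blinfun_apply (L x p)) (at x)"
      by (rule has_derivative_eq_rhs) (auto simp: L algebra_simps)
  qed (auto intro!: integrable_continuous continuous_on_polar cf)
  have *: "blinfun_apply (integral (cbox (0, 0) (R, 2 * pi)) (L t)) h / of_real pi =
      of_real (Re h) * cauchy_tr R f1 t + of_real (Im h) * cauchy_tr R f2 t" for h
  proof -
    have cL': "continuous_on (cbox (0, 0) (R, 2 * pi)) (L t)"
      unfolding L_def
      by (intro continuous_intros bounded_linear.continuous_on[OF bounded_linear_blinfun_scaleR_left]
        continuous_on_compose2[OF c(1)] continuous_on_compose2[OF c(2)]) auto
    have "blinfun_apply (integral (cbox (0, 0) (R, 2 * pi)) (L t)) h =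
      integral (cbox (0, 0) (R, 2 * pi)) (\<lambda>p. blinfun_apply (L t p) h)"
      using integral_linear[OF integrable_continuous[OF cL'] blinfun.bounded_linear_left[of h]]
      by (simp add: o_def)
    also have "\<dots> = of_real (Re h) * integral (cbox (0, 0) (R, 2 * pi)) (\<lambda>p. f1 (?s t p) * cis (- snd p))
      + of_real (Im h) * integral (cbox (0, 0) (R, 2 * pi)) (\<lambda>p. f2 (?s t p) * cis (- snd p))"
      unfolding L
      by (subst integral_add)
         (simp_all add: integrable_on_cmult_left integrable_continuous continuous_on_polar c)
    finally show ?thesis
      by (simp add: cauchy_tr_def add_divide_distrib)
  qed
  from bounded_linear.has_derivative[OF bounded_linear_divide[of "of_real pi"] D]
  show ?thesis
    unfolding * cauchy_tr_def[of R f, symmetric] by simp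
qed

lemma smooth_derivs:
  assumes "smooth_on UNIV f"
  shows "(f has_derivative (\<lambda>h. of_real (Re h) * frechet_derivative f (at x) 1
      + of_real (Im h) * frechet_derivative f (at x) \<i>)) (at x)"
proof -
  have d: "(f has_derivative frechet_derivative f (at x)) (at x)"
    by (rule smooth_on_has_derivative[OF assms]) auto
  show ?thesis
    by (rule has_derivative_eq_rhs[OF d]) (rule ext, rule real_linear_complex[OF has_derivative_linear[OF d]])
qed

lemma Ck_on_cauchy_tr:
  assumes "smooth_on UNIV f" shows "Ck_on k UNIV (cauchy_tr R f)"
  using assms
proof (induction k arbitrary: f)
  have d: "(cauchy_tr R f has_derivative (\<lambda>h. of_real (Re h) * cauchy_tr R (\<lambda>x. frechet_derivative f (at x) 1) t
     + of_real (Im h) * cauchy_tr R (\<lambda>x. frechet_derivative f (at x) \<i>) t)) (at t)"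
    if "smooth_on UNIV f" for f t
    using that
    by (intro cauchy_tr_has_derivative smooth_derivs smooth_on_continuous smooth_on_frechet_derivative)
       (auto simp: Basis_complex_def)
  { case 0
    then show ?case
      by (simp add: continuous_at_imp_continuous_on has_derivative_continuous[OF d[OF 0]]) }
  { case (Suc k)
    show ?case
    proof (rule Ck_on_SucI[OF open_UNIV d[OF Suc.prems]])
      fix b :: complex
      have "Ck_on k UNIV (cauchy_tr R (\<lambda>x. frechet_derivative f (at x) c))" if "c \<in> Basis" for c
        by (rule Suc.IH[OF smooth_on_frechet_derivative[OF Suc.prems that]])
      then show "Ck_on k UNIV (\<lambda>t. of_real (Re b) * cauchy_tr R (\<lambda>x. frechet_derivative f (at x) 1) t
          + of_real (Im b) * cauchy_tr R (\<lambda>x. frechet_derivative f (at x) \<i>) t)"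
        by (simp add: Ck_on_add Ck_on_mult Ck_on_const Basis_complex_def)
    qed }
qed

lemma smooth_on_cauchy_tr: "smooth_on UNIV f \<Longrightarrow> smooth_on UNIV (cauchy_tr R f)"
  by (metis Ck_on_cauchy_tr smooth_on_def)

text \<open>Positive radii suffice, because the radius 0 is negligible; in the application the
  angular integral is evaluated after dividing by \<open>r\<close>.\<close>

lemma integral_polar_0:
  assumes "continuous_on UNIV G" "0 \<le> R"
    and "\<And>r. 0 < r \<Longrightarrow> integral {0..2 * pi} (\<lambda>\<theta>. G (r, \<theta>)) = (0::complex)"
  shows "integral (cbox (0::real, 0::real) (R, 2 * pi)) G = 0"
proof -
  have "integral (cbox (0::real, 0::real) (R, 2 * pi)) G =
      integral (cbox 0 R) (\<lambda>r. integral (cbox 0 (2 * pi)) (\<lambda>\<theta>. G (r, \<theta>)))"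
    by (rule integral_prod_continuous) (rule continuous_on_subset[OF assms(1)], simp)
  also have "\<dots> = integral (cbox 0 R) (\<lambda>r. 0)"
    by (rule integral_spike[of "{0}"]) (use assms in \<open>auto simp: cbox_interval\<close>)
  finally show ?thesis by simp
qed

text \<open>In polar coordinates around \<open>t\<close>, $2\,\partial f/\partial\bar z\cdot e^{-i\theta}$ is
  $-\partial_r - \frac ir\partial_\theta$ applied to $f(t - re^{i\theta})$.\<close>

lemma dzbar_cauchy_tr:
  assumes f: "smooth_on UNIV f" and f0: "\<And>t. norm t \<ge> M \<Longrightarrow> f t = 0"
    and R: "norm t + M \<le> R" "0 \<le> R"
  shows "dzbar (cauchy_tr R f) t = f t"
proof -
  define f1 f2 where "f1 x = frechet_derivative f (at x) 1" and "f2 x = frechet_derivative f (at x) \<i>" for x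
  have c: "continuous_on UNIV f1" "continuous_on UNIV f2"
    unfolding f1_def f2_def using f
    by (auto intro!: smooth_on_continuous smooth_on_frechet_derivative simp: Basis_complex_def)
  have der: "(f has_derivative (\<lambda>h. of_real (Re h) * f1 x + of_real (Im h) * f2 x)) (at x)" for x
    unfolding f1_def f2_def by (rule smooth_derivs[OF f])
  let ?s = "\<lambda>r \<theta>. t - of_real r * cis \<theta> :: complex"
  \<comment> \<open>\<open>A + \<i> * B\<close> is \<open>f1 + \<i> * f2\<close> at the moving point
    times \<open>cis (- \<theta>)\<close>. Along that point \<open>- A\<close> is the radial
    derivative of \<open>f\<close> and \<open>- r * B\<close> the angular one. So \<open>A\<close>
    integrates over \<open>r\<close> to \<open>f t\<close>, and \<open>B\<close> over a full circle
    to 0.\<close>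
  define A where "A p = of_real (cos (snd p)) * f1 (?s (fst p) (snd p)) + of_real (sin (snd p)) * f2 (?s (fst p) (snd p))" for p
  define B where "B p = of_real (cos (snd p)) * f2 (?s (fst p) (snd p)) - of_real (sin (snd p)) * f1 (?s (fst p) (snd p))" for p
  have cA: "continuous_on UNIV A" and cB: "continuous_on UNIV B"
    unfolding A_def B_def
    by (intro continuous_intros continuous_on_compose2[OF c(1)] continuous_on_compose2[OF c(2)]; simp)+
  have B0: "integral {0..2 * pi} (\<lambda>\<theta>. B (r, \<theta>)) = 0" if "0 < r" for r
  proof -
    have "((\<lambda>\<theta>. f (?s r \<theta>)) has_vector_derivative - of_real r * B (r, \<theta>)) (at \<theta>)" for \<theta>
    proof -
      have "((\<lambda>\<theta>. ?s r \<theta>) has_derivative (\<lambda>h. h *\<^sub>R (of_real r * Complex (sin \<theta>) (- cos \<theta>)))) (at \<theta>)"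
        unfolding cis_conv_exp
        by (auto intro!: derivative_eq_intros simp: fun_eq_iff scaleR_conv_of_real complex_eq_iff exp_eq_polar[symmetric] cis_conv_exp[symmetric])
      from has_derivative_compose[OF this der] show ?thesis
        unfolding has_vector_derivative_def
        by (rule has_derivative_eq_rhs) (simp add: fun_eq_iff B_def scaleR_conv_of_real algebra_simps)
    qed
    then have "((\<lambda>\<theta>. - of_real r * B (r, \<theta>)) has_integral f (?s r (2 * pi)) - f (?s r 0)) {0..2 * pi}"
      by (intro fundamental_theorem_of_calculus) (auto intro: has_vector_derivative_at_within)
    from has_integral_mult_right[OF this, of "- inverse (of_real r)"] that
    have "((\<lambda>\<theta>. B (r, \<theta>)) has_integral 0) {0..2 * pi}"
      by (simp add: mult.assoc[symmetric])
    then show ?thesis by (rule integral_unique)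
  qed
  have A0: "integral (cbox 0 R) (\<lambda>r. A (r, \<theta>)) = f t" for \<theta>
  proof -
    have "((\<lambda>r. f (?s r \<theta>)) has_vector_derivative - A (r, \<theta>)) (at r)" for r
    proof -
      have "((\<lambda>r. ?s r \<theta>) has_derivative (\<lambda>h. h *\<^sub>R (- cis \<theta>))) (at r)"
        by (auto intro!: derivative_eq_intros simp: fun_eq_iff scaleR_conv_of_real)
      from has_derivative_compose[OF this der] show ?thesis
        unfolding has_vector_derivative_def
        by (rule has_derivative_eq_rhs) (simp add: fun_eq_iff A_def scaleR_conv_of_real algebra_simps)
    qed
    then have "((\<lambda>r. - A (r, \<theta>)) has_integral f (?s R \<theta>) - f (?s 0 \<theta>)) {0..R}"
      using R by (intro fundamental_theorem_of_calculus) (auto intro: has_vector_derivative_at_within)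
    moreover have "norm (?s R \<theta>) \<ge> M"
      using norm_triangle_ineq2[of "of_real R * cis \<theta>" t] R by (simp add: norm_mult norm_minus_commute)
    ultimately have "((\<lambda>r. A (r, \<theta>)) has_integral f t) {0..R}"
      using has_integral_neg_iff[of "\<lambda>r. A (r, \<theta>)"] f0 by fastforce
    then show ?thesis by (simp add: integral_unique cbox_interval)
  qed
  have "integral (cbox (0, 0) (R, 2 * pi)) A = integral (cbox 0 R) (\<lambda>r. integral (cbox 0 (2 * pi)) (\<lambda>\<theta>. A (r, \<theta>)))"
    by (rule integral_prod_continuous) (rule continuous_on_subset[OF cA], simp)
  also have "\<dots> = integral (cbox 0 (2 * pi)) (\<lambda>\<theta>. integral (cbox 0 R) (\<lambda>r. A (r, \<theta>)))"
    by (rule integral_swap_continuous) (use continuous_on_subset[OF cA] in \<open>simp add: split_beta\<close>)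
  also have "\<dots> = 2 * pi * f t"
    unfolding A0 by (simp add: scaleR_conv_of_real)
  finally have A: "integral (cbox (0, 0) (R, 2 * pi)) A = 2 * pi * f t" .
  have "cauchy_tr R (\<lambda>x. f1 x + \<i> * f2 x) t = integral (cbox (0, 0) (R, 2 * pi)) (\<lambda>p. A p + \<i> * B p) / of_real pi"
    unfolding cauchy_tr_def
    by (intro arg_cong2[where f = "(/)"] integral_cong refl)
       (simp add: A_def B_def cis_conv_exp[symmetric] complex_eq_iff cis.ctr algebra_simps)
  also have "\<dots> = 2 * f t"
    using A integral_polar_0[OF cB R(2) B0]
    by (subst integral_add) (auto intro!: integrable_continuous continuous_on_subset[OF cA] continuous_on_subset[OF cB] continuous_on_mult_left)
  finally have "cauchy_tr R (\<lambda>x. f1 x + \<i> * f2 x) t = 2 * f t" .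
  moreover have "cauchy_tr R (\<lambda>x. f1 x + \<i> * f2 x) t = cauchy_tr R f1 t + \<i> * cauchy_tr R f2 t"
    by (simp add: cauchy_tr_add cauchy_tr_cmult c continuous_on_mult_left)
  moreover have "dzbar (cauchy_tr R f) t = (cauchy_tr R f1 t + \<i> * cauchy_tr R f2 t) / 2"
    by (subst dzbar_eqI[OF cauchy_tr_has_derivative[OF der c]]) simp
  ultimately show ?thesis by simp
qed

section \<open>Solving the dbar equation in the plane\<close>

lemma smooth_imp_differentiable: "smooth_on S f \<Longrightarrow> open S \<Longrightarrow> x \<in> S \<Longrightarrow> f differentiable at x"
  using smooth_on_has_derivative differentiable_def by blast

lemma continuous_on_cball_bounded:
  fixes f :: "complex \<Rightarrow> complex"
  assumes "continuous_on (cball c r) f"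
  obtains K where "\<And>y. y \<in> cball c r \<Longrightarrow> norm (f y) \<le> K"
proof -
  have "bounded (f ` cball c r)"
    by (intro compact_imp_bounded compact_continuous_image assms compact_cball)
  then show ?thesis using that unfolding bounded_iff by blast
qed

lemma compact_support_bounded:
  assumes "continuous_on UNIV f" "\<And>t. norm t \<ge> M \<Longrightarrow> f t = 0"
  obtains B where "B \<ge> 0" "\<And>t::complex. norm (f t :: complex) \<le> B"
proof -
  obtain K where K: "\<And>y. y \<in> cball 0 M \<Longrightarrow> norm (f y) \<le> K"
    using continuous_on_cball_bounded[OF continuous_on_subset[OF assms(1)]] by blast
  have "norm (f t) \<le> \<bar>K\<bar>" for t
    using assms(2)[of t] K[of t] by (cases "norm t \<le> M") auto
  then show ?thesis using that[of "\<bar>K\<bar>"] by auto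
qed

text \<open>In the coordinate \<open>y = 1 / x\<close> the function \<open>y * u (1 / y)\<close> is
  bounded near 0 and extends holomorphically. Its first two Taylor coefficients are \<open>a\<close>
  and \<open>b\<close>; \<open>?g2\<close> is the Taylor remainder divided by \<open>y\<close>
  squared, and it is bounded on a smaller closed disc.\<close>

lemma linear_growth_at_infinity:
  fixes u :: "complex \<Rightarrow> complex"
  assumes hol: "u holomorphic_on {x. norm x > M}" and M: "M > 0"
    and bd: "\<And>x. norm (u x) \<le> C * (norm x + 1)"
  obtains a b K where "\<And>x. norm x \<ge> 2 * M + 1 \<Longrightarrow> norm (u x - a * x - b) * norm x \<le> K"
proof -
  let ?v = "\<lambda>y. y * u (1 / y)"
  let ?D = "ball (0::complex) (1 / M)"
  have "?v holomorphic_on ?D - {0}"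
  proof (intro holomorphic_intros)
    have "(u \<circ> (\<lambda>y. 1 / y)) holomorphic_on ?D - {0}"
      by (intro holomorphic_on_compose holomorphic_intros holomorphic_on_subset[OF hol])
         (use M in \<open>auto simp: norm_divide divide_simps mult.commute\<close>)
    then show "(\<lambda>y. u (1 / y)) holomorphic_on ?D - {0}" by (simp add: o_def)
  qed
  moreover have "\<forall>\<^sub>F y in at 0. norm (?v y) \<le> 2 * \<bar>C\<bar>"
  proof -
    have "norm (?v y) \<le> 2 * \<bar>C\<bar>" if "y \<noteq> 0" "norm y < 1" for y
    proof -
      have "norm (?v y) \<le> norm y * (C * (norm (1 / y) + 1))"
        using bd[of "1 / y"] by (simp add: norm_mult mult_left_mono)
      also have "\<dots> = C * (1 + norm y)" using that by (simp add: norm_divide field_simps)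
      also have "\<dots> \<le> \<bar>C\<bar> * 2" using that by (intro mult_mono) auto
      finally show ?thesis by simp
    qed
    then show ?thesis
      unfolding eventually_at by (intro exI[of _ 1]) (auto simp: dist_norm)
  qed
  ultimately obtain g where g: "g holomorphic_on ?D" "\<And>y. y \<in> ?D - {0} \<Longrightarrow> g y = ?v y"
    using holomorphic_on_extend_bounded[of ?v ?D 0] M by (auto simp: interior_open)
  let ?g1 = "\<lambda>y. if y = 0 then deriv g 0 else (g y - g 0) / (y - 0)"
  have h1: "?g1 holomorphic_on ?D" by (rule pole_lemma_open[OF g(1)]) auto
  let ?g2 = "\<lambda>y. if y = 0 then deriv ?g1 0 else (?g1 y - ?g1 0) / (y - 0)"
  have h2: "?g2 holomorphic_on ?D" by (rule pole_lemma_open[OF h1]) auto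
  let ?r = "1 / (2 * M + 1)"
  have "cball 0 ?r \<subseteq> ?D" using M by (simp add: cball_subset_ball_iff divide_simps)
  then obtain K where K: "\<And>y. y \<in> cball 0 ?r \<Longrightarrow> norm (?g2 y) \<le> K"
    using continuous_on_cball_bounded[OF continuous_on_subset[OF holomorphic_on_imp_continuous_on[OF h2]]]
    by blast
  show ?thesis
  proof (rule that[of "g 0" "deriv g 0" K])
    fix x :: complex assume x: "norm x \<ge> 2 * M + 1"
    then have "x \<noteq> 0" using M by auto
    have y: "1 / x \<in> cball 0 ?r" using x M by (simp add: norm_divide divide_simps)
    then have "g (1 / x) = u x / x" using g(2)[of "1 / x"] \<open>cball 0 ?r \<subseteq> ?D\<close> \<open>x \<noteq> 0\<close> by auto
    then have "?g2 (1 / x) = (u x - g 0 * x - deriv g 0) * x"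
      using \<open>x \<noteq> 0\<close> by (simp add: field_simps)
    then show "norm (u x - g 0 * x - deriv g 0) * norm x \<le> K"
      using K[OF y] by (simp add: norm_mult)
  qed
qed

text \<open>Integrating over a disc that reaches the whole support gives a solution
  \<open>u0\<close> with at most linear growth, and it is holomorphic off the support. Subtracting
  its linear part at infinity leaves \<open>dzbar\<close> unchanged and produces the decay
  1/|t|.\<close>

lemma compact_support_dbar:
  assumes f: "smooth_on UNIV f" and f0: "\<And>t. norm t \<ge> M \<Longrightarrow> f t = 0"
  obtains u K where "smooth_on UNIV u" "\<And>t. dzbar u t = f t" "\<And>t. norm (u t) * (1 + norm t) \<le> K"
proof -
  define N where "N = max M 1"
  have N: "N > 0" "M \<le> N" and f0': "\<And>t. norm t \<ge> N \<Longrightarrow> f t = 0"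
    by (auto simp: N_def f0)
  have cf: "continuous_on UNIV f" by (rule smooth_on_continuous[OF f])
  obtain B where B: "B \<ge> 0" "\<And>t. norm (f t) \<le> B"
    using compact_support_bounded[OF cf f0] by metis
  define u0 where "u0 t = cauchy_tr (norm t + N) f t" for t
  have u0: "u0 t = cauchy_tr (R + N) f t" if "norm t < R" for t R
    unfolding u0_def using that by (intro cauchy_tr_radius[OF cf f0', symmetric]) auto
  \<comment> \<open>The radius in \<open>u0\<close> varies with the point. Near \<open>x\<close> it
    can be frozen at \<open>norm x + 1 + N\<close> by \<open>cauchy_tr_radius\<close>, and the
    results for a fixed radius apply.\<close>
  have loc: "\<exists>W. open W \<and> x \<in> W \<and> smooth_on W u0 \<and> dzbar u0 x = f x" for x
  proof (intro exI conjI)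
    let ?R = "norm x + 1"
    have s: "smooth_on (ball 0 ?R) (cauchy_tr (?R + N) f)"
      by (rule smooth_on_subset[OF smooth_on_cauchy_tr[OF f]]) auto
    show "smooth_on (ball 0 ?R) u0"
      by (rule smooth_on_cong[OF _ s]) (auto intro: u0[symmetric])
    have "dzbar (cauchy_tr (?R + N) f) x = dzbar u0 x"
      by (rule dzbar_cong[of "ball 0 ?R"]) (auto intro!: u0[symmetric] smooth_imp_differentiable[OF s])
    moreover have "dzbar (cauchy_tr (?R + N) f) x = f x"
      by (rule dzbar_cauchy_tr[OF f f0']) (use N in auto)
    ultimately show "dzbar u0 x = f x" by simp
  qed auto
  have s0: "smooth_on UNIV u0" by (rule smooth_on_local) (use loc in blast)
  have d0: "dzbar u0 t = f t" for t using loc by blast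
  have hol: "u0 holomorphic_on {x. norm x > N}"
    by (rule holomorphic_on_dzbar_0)
       (auto intro!: open_Collect_less continuous_intros smooth_imp_differentiable[OF s0] simp: d0 f0')
  have bd: "norm (u0 x) \<le> (2 * B * (N + 1)) * (norm x + 1)" for x
  proof -
    have "norm (u0 x) \<le> 2 * B * (norm x + N)"
      unfolding u0_def by (rule cauchy_tr_bound[OF cf B(2)]) (use N in auto)
    also have "\<dots> \<le> 2 * B * ((N + 1) * (norm x + 1))"
      using B N by (intro mult_left_mono) (auto simp: algebra_simps)
    finally show ?thesis by simp
  qed
  obtain a b K where K: "\<And>x. norm x \<ge> 2 * N + 1 \<Longrightarrow> norm (u0 x - a * x - b) * norm x \<le> K"
    using linear_growth_at_infinity[OF hol N(1) bd] by metis
  define u where "u x = u0 x + ((- a) * x + (- b))" for x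
  have lin: "smooth_on UNIV (\<lambda>x. (- a) * x + (- b))"
    by (intro smooth_on_holomorphic holomorphic_intros open_UNIV)
  have su: "smooth_on UNIV u"
    unfolding u_def by (rule smooth_on_add[OF open_UNIV s0 lin])
  obtain K' where K': "\<And>y. y \<in> cball 0 (2 * N + 1) \<Longrightarrow> norm (u y) \<le> K'"
    using continuous_on_cball_bounded[OF continuous_on_subset[OF smooth_on_continuous[OF su]]] by blast
  show ?thesis
  proof (rule that[OF su])
    fix t
    have "dzbar (\<lambda>x. (- a) * x + (- b)) t = 0"
      by (rule dzbar_holomorphic[where f' = "- a"]) (auto intro!: derivative_eq_intros)
    then show "dzbar u t = f t"
      unfolding u_def[abs_def]
      by (subst dzbar_add) (auto intro!: smooth_imp_differentiable[OF s0] smooth_imp_differentiable[OF lin] simp: d0)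
    show "norm (u t) * (1 + norm t) \<le> \<bar>K'\<bar> * (2 * N + 2) + 2 * \<bar>K\<bar>"
    proof (cases "norm t \<le> 2 * N + 1")
      case True
      then have "norm (u t) * (1 + norm t) \<le> \<bar>K'\<bar> * (2 * N + 2)"
        using K'[of t] N by (intro mult_mono) auto
      then show ?thesis by simp
    next
      case False
      then have "norm (u t) * (1 + norm t) \<le> norm (u t) * (2 * norm t)"
        using N by (intro mult_left_mono) auto
      also have "\<dots> \<le> 2 * K" using K[of t] False by (simp add: u_def algebra_simps)
      finally show ?thesis using N by (smt (verit) mult_nonneg_nonneg abs_ge_zero)
    qed
  qed
qed

text \<open>The approximations \<open>g n\<close> of \<open>f\<close> are smooth, converge uniformly and agree with \<open>f\<close> off shrinking
  discs around \<open>c\<close>; hence off such a disc the transforms of \<open>f\<close> and \<open>g n\<close> differ by a uniform limit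
  of holomorphic functions.\<close>

lemma puncture_dbar:
  assumes cf: "continuous_on UNIV f" and f0: "\<And>t. norm t \<ge> M \<Longrightarrow> f t = 0"
    and sf: "smooth_on (- {c}) f" and fc: "f c = 0" and M: "M > 0"
  obtains u K where "smooth_on (ball 0 M - {c}) u"
    "\<And>t. t \<in> ball 0 M - {c} \<Longrightarrow> dzbar u t = f t" "\<And>t. norm (u t) \<le> K"
proof -
  \<comment> \<open>For \<open>norm t < M\<close> this is at least \<open>norm t + M\<close>, so one
    fixed radius serves the whole ball.\<close>
  define R where "R = 2 * M"
  obtain B where B: "B \<ge> 0" "\<And>t. norm (f t) \<le> B"
    using compact_support_bounded[OF cf f0] by metis
  have "\<exists>\<beta>. smooth_on UNIV \<beta> \<and> (\<forall>t. dist t c \<le> inverse (real (Suc n)) \<longrightarrow> \<beta> t = 1) \<and>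
      (\<forall>t. dist t c \<ge> 2 * inverse (real (Suc n)) \<longrightarrow> \<beta> t = 0) \<and> (\<forall>t. norm (\<beta> t) \<le> 1)" for n
    by (rule bump_at[of "inverse (real (Suc n))" c]) auto
  then obtain \<beta> where \<beta>: "\<And>n. smooth_on UNIV (\<beta> n)"
      "\<And>n t. dist t c \<le> inverse (real (Suc n)) \<Longrightarrow> \<beta> n t = 1"
      "\<And>n t. dist t c \<ge> 2 * inverse (real (Suc n)) \<Longrightarrow> \<beta> n t = 0" "\<And>n t. norm (\<beta> n t) \<le> 1"
    by metis
  define g where "g n t = f t * (1 - \<beta> n t)" for n t
  have g0: "g n t = 0" if "norm t \<ge> M" for n t using f0[OF that] by (simp add: g_def)
  have g: "g n t = f t" if "dist t c \<ge> 2 * inverse (real (Suc n))" for n t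
    using \<beta>(3)[OF that] by (simp add: g_def)
  have sg: "smooth_on UNIV (g n)" for n
  proof (rule smooth_on_local)
    fix x
    show "\<exists>W. open W \<and> x \<in> W \<and> smooth_on W (g n)"
    proof (cases "x = c")
      case True
      have "smooth_on (ball c (inverse (real (Suc n)))) (g n)"
        by (rule smooth_on_cong[OF _ smooth_on_const[of _ 0]]) (simp_all add: g_def \<beta>(2) dist_commute)
      then show ?thesis using True by (intro exI[of _ "ball c (inverse (real (Suc n)))"]) auto
    next
      case False
      have "smooth_on (- {c}) (g n)"
        unfolding g_def[abs_def]
        by (intro smooth_on_mult smooth_on_diff sf smooth_on_const smooth_on_subset[OF \<beta>(1)] open_delete) auto
      then show ?thesis using False by (intro exI[of _ "- {c}"]) (auto simp: open_Compl)
    qed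
  qed
  have cg: "continuous_on UNIV (g n)" for n by (rule smooth_on_continuous[OF sg])
  let ?T = "cauchy_tr R"
  have dT: "dzbar (?T (g n)) t = g n t" if "norm t < M" for n t
    by (rule dzbar_cauchy_tr[OF sg g0]) (use that M in \<open>auto simp: R_def\<close>)
  have unif: "uniform_limit S (\<lambda>m. ?T (g m)) (?T f) sequentially" for S
  proof (rule uniform_limitI)
    fix e :: real assume "e > 0"
    \<comment> \<open>Chosen so that the bound \<open>2 * e' * R\<close> from
      \<open>cauchy_tr_bound\<close> is smaller than \<open>e\<close>.\<close>
    define e' where "e' = e / (4 * R + 1)"
    have e': "e' > 0" using \<open>e > 0\<close> M by (simp add: e'_def R_def)
    have "isCont f c" using cf by (simp add: continuous_on_eq_continuous_at)
    then obtain d where d: "d > 0" "\<And>t. dist t c < d \<Longrightarrow> norm (f t) < e'"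
      using e' fc unfolding continuous_at_eps_delta by (metis dist_0_norm dist_commute)
    have "\<forall>\<^sub>F n in sequentially. 2 * inverse (real (Suc n)) < d"
      using d by real_asymp
    then show "\<forall>\<^sub>F n in sequentially. \<forall>x\<in>S. dist (?T (g n) x) (?T f x) < e"
    proof eventually_elim
      case (elim n)
      have "norm (f t - g n t) \<le> e'" for t
      proof (cases "dist t c < d")
        case True
        have "norm (f t - g n t) = norm (f t) * norm (\<beta> n t)" by (simp add: g_def norm_mult[symmetric] algebra_simps)
        also have "\<dots> \<le> e' * 1" using d(2)[OF True] \<beta>(4)[of n t] e' by (intro mult_mono) auto
        finally show ?thesis by simp
      next
        case False
        then show ?thesis using g[of n t] elim e' by simp
      qed
      then have "norm (?T (\<lambda>t. f t - g n t) x) \<le> 2 * e' * R" for x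
        using M by (intro cauchy_tr_bound continuous_on_diff cf cg) (simp_all add: R_def)
      moreover have "2 * e' * R < e"
      proof -
        have "(4 * R + 1) * e' = e" using M by (simp add: e'_def R_def)
        moreover have "0 < e' * R" "0 < e'" using e' M by (auto simp: R_def)
        ultimately show ?thesis by (simp add: algebra_simps)
      qed
      ultimately show ?case
        by (auto simp: cauchy_tr_diff[OF cf cg] dist_norm norm_minus_commute[of "?T f _"] intro: le_less_trans)
    qed
  qed
  have loc: "\<exists>W. open W \<and> x \<in> W \<and> smooth_on W (?T f) \<and> dzbar (?T f) x = f x"
    if x: "x \<in> ball 0 M - {c}" for x
  proof -
    obtain n where n: "inverse (real (Suc n)) < dist x c / 2"
      using reals_Archimedean[of "dist x c / 2"] x by auto
    define W where "W = ball 0 M \<inter> {t. dist t c > 2 * inverse (real (Suc n))}"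
    have W: "open W" "x \<in> W"
      using x n by (auto simp: W_def intro!: open_Int open_Collect_less continuous_intros)
    have gm: "g m t = f t" if "t \<in> W" "m \<ge> n" for m t
    proof (rule g)
      have "inverse (real (Suc m)) \<le> inverse (real (Suc n))" using that by (simp add: divide_simps)
      moreover have "2 * inverse (real (Suc n)) < dist t c" using that(1) unfolding W_def by blast
      ultimately show "2 * inverse (real (Suc m)) \<le> dist t c" by linarith
    qed
    have sT: "smooth_on W (?T (g m))" for m
      by (rule smooth_on_subset[OF smooth_on_cauchy_tr[OF sg]]) auto
    have "(\<lambda>t. ?T f t - ?T (g n) t) holomorphic_on W"
    proof (rule holomorphic_uniform_sequence[OF W(1), where f = "\<lambda>m t. ?T (g (m + n)) t - ?T (g n) t"])
      fix m
      show "(\<lambda>t. ?T (g (m + n)) t - ?T (g n) t) holomorphic_on W"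
      proof (rule holomorphic_on_dzbar_0[OF W(1)])
        fix t assume t: "t \<in> W"
        note dif = smooth_imp_differentiable[OF sT W(1) t]
        show "(\<lambda>t. ?T (g (m + n)) t - ?T (g n) t) differentiable at t"
          by (intro differentiable_diff dif)
        have "?T (\<lambda>x. g (m + n) x - g n x) = (\<lambda>t. ?T (g (m + n)) t - ?T (g n) t)"
          by (simp add: fun_eq_iff cauchy_tr_diff[OF cg cg])
        moreover have "dzbar (?T (\<lambda>x. g (m + n) x - g n x)) t = g (m + n) t - g n t"
          by (rule dzbar_cauchy_tr[where M = M])
             (use t M in \<open>auto intro!: smooth_on_diff sg simp: g0 R_def W_def\<close>)
        ultimately show "dzbar (\<lambda>t. ?T (g (m + n)) t - ?T (g n) t) t = 0"
          by (simp add: gm[OF t])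
      qed
    next
      fix x assume "x \<in> W"
      then obtain d where "d > 0" "cball x d \<subseteq> W" using W(1) open_contains_cball by blast
      moreover have "uniform_limit (cball x d) (\<lambda>m. ?T (g (m + n))) (?T f) sequentially"
        using filterlim_compose[OF unif[of "cball x d"] filterlim_add_const_nat_at_top[of n]]
        by (simp add: o_def)
      ultimately show "\<exists>d>0. cball x d \<subseteq> W \<and> uniform_limit (cball x d)
          (\<lambda>m t. ?T (g (m + n)) t - ?T (g n) t) (\<lambda>t. ?T f t - ?T (g n) t) sequentially"
        by (intro exI[of _ d] conjI uniform_limit_intros) auto
    qed
    then have hd: "(\<lambda>t. ?T f t - ?T (g n) t) holomorphic_on W" .
    then have sd: "smooth_on W (\<lambda>t. ?T f t - ?T (g n) t)"
      by (rule smooth_on_holomorphic[OF W(1)])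
    have "smooth_on W (\<lambda>t. (?T f t - ?T (g n) t) + ?T (g n) t)"
      by (intro smooth_on_add W sd sT)
    then have "smooth_on W (?T f)" by simp
    moreover have "dzbar (?T f) x = f x"
    proof -
      have 0: "dzbar (\<lambda>t. ?T f t - ?T (g n) t) x = 0"
        by (rule dzbar_holomorphic[OF holomorphic_derivI[OF hd W]])
      have 1: "dzbar (?T (g n)) x = f x"
        using dT[of x n] gm[OF W(2), of n] x by simp
      show ?thesis
        using dzbar_add[OF smooth_imp_differentiable[OF sd W] smooth_imp_differentiable[OF sT W], of n] 0 1
        by simp
    qed
    ultimately show ?thesis using W by blast
  qed
  show ?thesis
  proof (rule that[of "?T f" "2 * B * R"])
    show "smooth_on (ball 0 M - {c}) (?T f)" by (rule smooth_on_local) (use loc in blast)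
    show "dzbar (?T f) t = f t" if "t \<in> ball 0 M - {c}" for t using loc[OF that] by blast
    show "norm (?T f t) \<le> 2 * B * R" for t by (rule cauchy_tr_bound[OF cf B(2)]) (use M in \<open>simp add: R_def\<close>)
  qed
qed

section \<open>Functions and forms on a Riemann surface\<close>

text \<open>A condition at one point, with an unnamed neighbourhood, spares carrying open domains
  through products, sums and compositions. It is required in every chart around the point;
  \<open>holo_atI\<close> and \<open>smooth_atI\<close> show that one chart suffices.\<close>

definition holo_at :: "'a::topological_space chart set \<Rightarrow> ('a \<Rightarrow> complex) \<Rightarrow> 'a \<Rightarrow> bool" where
  "holo_at A g x \<longleftrightarrow> (\<forall>(U, z)\<in>A. x \<in> U \<longrightarrow>
     (\<exists>W. open W \<and> z x \<in> W \<and> W \<subseteq> z ` U \<and> (g \<circ> inv_into U z) holomorphic_on W))"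

definition smooth_at :: "'a::topological_space chart set \<Rightarrow> ('a \<Rightarrow> complex) \<Rightarrow> 'a \<Rightarrow> bool" where
  "smooth_at A g x \<longleftrightarrow> (\<forall>(U, z)\<in>A. x \<in> U \<longrightarrow>
     (\<exists>W. open W \<and> z x \<in> W \<and> W \<subseteq> z ` U \<and> smooth_on W (g \<circ> inv_into U z)))"

definition dbar_form :: "('a \<Rightarrow> complex) \<Rightarrow> 'a form" where
  "dbar_form g c x = dzbar (g \<circ> inv_into (fst c) (snd c)) (snd c x)"

locale riemann_surface =
  fixes A :: "'a::t2_space chart set"
  assumes atlas: "complex_atlas A"
begin

lemma chart_at: obtains U z where "(U, z) \<in> A" "x \<in> U"
proof -
  have "x \<in> (\<Union>(U, z)\<in>A. U)" using atlas by (simp add: complex_atlas_def)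
  then show ?thesis using that by auto
qed

lemma chart:
  assumes "(U, z) \<in> A"
  shows chart_open: "open U" and chart_open_image: "open (z ` U)"
    and chart_homeo: "homeomorphism U (z ` U) z (inv_into U z)"
  using atlas assms by (auto simp: complex_atlas_def)

lemma chart_inj: "(U, z) \<in> A \<Longrightarrow> inj_on z U"
  by (rule inj_on_inverseI[of U "inv_into U z"]) (rule homeomorphism_apply1[OF chart_homeo])

lemma inv_chart [simp]: "(U, z) \<in> A \<Longrightarrow> x \<in> U \<Longrightarrow> inv_into U z (z x) = x"
  by (rule inv_into_f_f[OF chart_inj])

lemma chart_image_open:
  assumes "(U, z) \<in> A" "open V" shows "open (z ` (U \<inter> V))"
proof -
  have "openin (top_of_set (z ` U)) (z ` (U \<inter> V))"
    using homeomorphism_imp_open_map[OF chart_homeo[OF assms(1)]] assms(2) by blast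
  then show ?thesis using chart_open_image[OF assms(1)] openin_open_trans by blast
qed

lemma chart_preimage_open:
  assumes "(U, z) \<in> A" "open W" shows "open (U \<inter> z -` W)"
  using continuous_on_open_vimage[OF chart_open[OF assms(1)], of z]
    homeomorphism_cont1[OF chart_homeo[OF assms(1)]] assms(2) by (simp add: Int_commute)

lemma inv_chart_image_open:
  assumes "(U, z) \<in> A" "open W" "W \<subseteq> z ` U" shows "open (inv_into U z ` W)"
proof -
  have "inv_into U z ` W = U \<inter> z -` W"
  proof
    show "inv_into U z ` W \<subseteq> U \<inter> z -` W"
      using assms(3) by (auto simp: f_inv_into_f inv_into_into subset_iff)
    show "U \<inter> z -` W \<subseteq> inv_into U z ` W"
      using inv_chart[OF assms(1)] by (force intro: rev_image_eqI)
  qed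
  then show ?thesis using chart_preimage_open[OF assms(1,2)] by simp
qed

lemma transition_holomorphic:
  "(U, z) \<in> A \<Longrightarrow> (V, w) \<in> A \<Longrightarrow> (w \<circ> inv_into U z) holomorphic_on z ` (U \<inter> V)"
  using atlas by (auto simp: complex_atlas_def)

lemma transition:
  assumes c: "(U, z) \<in> A" "x \<in> U" and c': "(V, w) \<in> A" "x \<in> V" and W: "open W" "z x \<in> W" "W \<subseteq> z ` U"
  obtains W' where "open W'" "w x \<in> W'" "W' \<subseteq> w ` V" "(z \<circ> inv_into V w) holomorphic_on W'"
    "(z \<circ> inv_into V w) ` W' \<subseteq> W" "\<And>t. t \<in> W' \<Longrightarrow> inv_into U z ((z \<circ> inv_into V w) t) = inv_into V w t"
proof (rule that[of "w ` (V \<inter> (U \<inter> z -` W))"])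
  show "open (w ` (V \<inter> (U \<inter> z -` W)))"
    by (intro chart_image_open c' chart_preimage_open c W)
  show "(z \<circ> inv_into V w) holomorphic_on w ` (V \<inter> (U \<inter> z -` W))"
    by (rule holomorphic_on_subset[OF transition_holomorphic[OF c'(1) c(1)]]) auto
qed (use c c' W in auto)

lemma smooth_atI:
  assumes c: "(U, z) \<in> A" "x \<in> U" and W: "open W" "z x \<in> W" "W \<subseteq> z ` U"
    and g: "smooth_on W (g \<circ> inv_into U z)"
  shows "smooth_at A g x"
  unfolding smooth_at_def
proof (clarify)
  fix V w assume c': "(V, w) \<in> A" "x \<in> V"
  obtain W' where W': "open W'" "w x \<in> W'" "W' \<subseteq> w ` V" "(z \<circ> inv_into V w) holomorphic_on W'"
    "(z \<circ> inv_into V w) ` W' \<subseteq> W" "\<And>t. t \<in> W' \<Longrightarrow> inv_into U z ((z \<circ> inv_into V w) t) = inv_into V w t"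
    by (rule transition[OF c c' W]) blast
  have "smooth_on W' (\<lambda>t. (g \<circ> inv_into U z) ((z \<circ> inv_into V w) t))"
    by (rule smooth_on_compose_holomorphic[OF g W(1) W'(1,4,5)])
  then have "smooth_on W' (g \<circ> inv_into V w)"
    by (rule smooth_on_cong[OF W'(1)]) (simp add: W'(6)[unfolded o_def])
  then show "\<exists>W. open W \<and> w x \<in> W \<and> W \<subseteq> w ` V \<and> smooth_on W (g \<circ> inv_into V w)"
    using W' by blast
qed

lemma smooth_atE:
  assumes "smooth_at A g x" "(U, z) \<in> A" "x \<in> U"
  obtains W where "open W" "z x \<in> W" "W \<subseteq> z ` U" "smooth_on W (g \<circ> inv_into U z)"
  using assms unfolding smooth_at_def by fast

lemma holo_atI:
  assumes c: "(U, z) \<in> A" "x \<in> U" and W: "open W" "z x \<in> W" "W \<subseteq> z ` U"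
    and g: "(g \<circ> inv_into U z) holomorphic_on W"
  shows "holo_at A g x"
  unfolding holo_at_def
proof (clarify)
  fix V w assume c': "(V, w) \<in> A" "x \<in> V"
  obtain W' where W': "open W'" "w x \<in> W'" "W' \<subseteq> w ` V" "(z \<circ> inv_into V w) holomorphic_on W'"
    "(z \<circ> inv_into V w) ` W' \<subseteq> W" "\<And>t. t \<in> W' \<Longrightarrow> inv_into U z ((z \<circ> inv_into V w) t) = inv_into V w t"
    by (rule transition[OF c c' W]) blast
  have "((g \<circ> inv_into U z) \<circ> (z \<circ> inv_into V w)) holomorphic_on W'"
    by (rule holomorphic_on_compose_gen[OF W'(4) g W'(5)])
  then have "(g \<circ> inv_into V w) holomorphic_on W'"
    by (rule holomorphic_transform) (simp add: W'(6)[unfolded o_def])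
  then show "\<exists>W. open W \<and> w x \<in> W \<and> W \<subseteq> w ` V \<and> (g \<circ> inv_into V w) holomorphic_on W"
    using W' by blast
qed

lemma holo_atE:
  assumes "holo_at A g x" "(U, z) \<in> A" "x \<in> U"
  obtains W where "open W" "z x \<in> W" "W \<subseteq> z ` U" "(g \<circ> inv_into U z) holomorphic_on W"
  using assms unfolding holo_at_def by fast

lemma holo_at_chart: "(U, z) \<in> A \<Longrightarrow> x \<in> U \<Longrightarrow> holo_at A z x"
proof (rule holo_atI)
  assume c: "(U, z) \<in> A" "x \<in> U"
  show "(U, z) \<in> A" "x \<in> U" "open (z ` U)" "z x \<in> z ` U" "z ` U \<subseteq> z ` U"
    using c chart_open_image by auto
  show "(z \<circ> inv_into U z) holomorphic_on z ` U"
    by (rule holomorphic_transform[OF holomorphic_on_ident]) (auto simp: f_inv_into_f)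
qed

lemma smooth_at_differentiable:
  assumes "smooth_at A g x" "(U, z) \<in> A" "x \<in> U"
  shows "(g \<circ> inv_into U z) differentiable (at (z x))"
proof -
  obtain W where "open W" "z x \<in> W" "W \<subseteq> z ` U" "smooth_on W (g \<circ> inv_into U z)"
    by (rule smooth_atE[OF assms])
  then show ?thesis using smooth_imp_differentiable by blast
qed

lemma holo_at_differentiable:
  assumes "holo_at A g x" "(U, z) \<in> A" "x \<in> U"
  shows "((g \<circ> inv_into U z) has_field_derivative deriv (g \<circ> inv_into U z) (z x)) (at (z x))"
proof -
  obtain W where W: "open W" "z x \<in> W" "W \<subseteq> z ` U" "(g \<circ> inv_into U z) holomorphic_on W"
    by (rule holo_atE[OF assms])
  show ?thesis by (rule holomorphic_derivI[OF W(4,1,2)])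
qed

lemma smooth_at_compose:
  assumes \<xi>: "holo_at A \<xi> x" and F: "open S" "\<xi> x \<in> S" "smooth_on S F"
  shows "smooth_at A (\<lambda>y. F (\<xi> y)) x"
proof -
  obtain U z where c: "(U, z) \<in> A" "x \<in> U" by (rule chart_at)
  obtain W where W: "open W" "z x \<in> W" "W \<subseteq> z ` U" "(\<xi> \<circ> inv_into U z) holomorphic_on W"
    by (rule holo_atE[OF \<xi> c])
  let ?W = "W \<inter> (\<xi> \<circ> inv_into U z) -` S"
  have oW: "open ?W"
    using continuous_on_open_vimage[OF W(1)] holomorphic_on_imp_continuous_on[OF W(4)] F(1)
    by (metis Int_commute)
  show ?thesis
  proof (rule smooth_atI[OF c oW])
    have "smooth_on ?W (\<lambda>t. F ((\<xi> \<circ> inv_into U z) t))"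
      by (rule smooth_on_compose_holomorphic[OF F(3,1) oW holomorphic_on_subset[OF W(4)]]) auto
    then show "smooth_on ?W ((\<lambda>y. F (\<xi> y)) \<circ> inv_into U z)" by (simp add: o_def)
  qed (use W F c in auto)
qed

lemma dbar_form_compose:
  assumes \<xi>: "holo_at A \<xi> x" and F: "F differentiable (at (\<xi> x))" and c: "(U, z) \<in> A" "x \<in> U"
  shows "dbar_form (\<lambda>y. F (\<xi> y)) (U, z) x = dzbar F (\<xi> x) * cnj (deriv (\<xi> \<circ> inv_into U z) (z x))"
  using dzbar_compose_holomorphic[OF _ holo_at_differentiable[OF \<xi> c], of F] F c
  by (simp add: dbar_form_def o_def)

lemma holo_at_imp_smooth_at: "holo_at A \<xi> x \<Longrightarrow> smooth_at A \<xi> x"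
  using smooth_at_compose[of \<xi> x UNIV "\<lambda>t. t"]
  by (simp add: smooth_on_holomorphic)

lemma dbar_form_holo_at: "holo_at A \<xi> x \<Longrightarrow> (U, z) \<in> A \<Longrightarrow> x \<in> U \<Longrightarrow> dbar_form \<xi> (U, z) x = 0"
  unfolding dbar_form_def fst_conv snd_conv by (rule dzbar_holomorphic[OF holo_at_differentiable])

lemma dbar_form_transition:
  assumes g: "smooth_at A g x" and c: "(U, z) \<in> A" "x \<in> U" and c': "(V, w) \<in> A" "x \<in> V"
  shows "dbar_form g (V, w) x = dbar_form g (U, z) x * cnj (deriv (z \<circ> inv_into V w) (w x))"
proof -
  obtain W' where W': "open W'" "w x \<in> W'" "W' \<subseteq> w ` V" "(z \<circ> inv_into V w) holomorphic_on W'"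
    "(z \<circ> inv_into V w) ` W' \<subseteq> z ` U" "\<And>t. t \<in> W' \<Longrightarrow> inv_into U z ((z \<circ> inv_into V w) t) = inv_into V w t"
    by (rule transition[OF c c' chart_open_image[OF c(1)]]) (use c in blast)+
  let ?G = "g \<circ> inv_into U z" and ?h = "z \<circ> inv_into V w"
  have hx: "?h (w x) = z x" using c' by simp
  have 1: "dzbar (\<lambda>t. ?G (?h t)) (w x) = dzbar ?G (?h (w x)) * cnj (deriv ?h (w x))"
    by (rule dzbar_compose_holomorphic[OF _ holomorphic_derivI[OF W'(4,1,2)]])
       (simp only: hx smooth_at_differentiable[OF g c])
  have "dzbar (g \<circ> inv_into V w) (w x) = dzbar (\<lambda>t. ?G (?h t)) (w x)"
    by (rule dzbar_cong[OF W'(1,2) smooth_at_differentiable[OF g c']]) (simp add: W'(6)[unfolded o_def])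
  then show ?thesis using 1 hx by (simp add: dbar_form_def)
qed

lemma chart_nhd:
  assumes c: "(U, z) \<in> A" "x \<in> U" and V: "open V" "x \<in> V"
  shows "open (z ` (U \<inter> V))" "z x \<in> z ` (U \<inter> V)" "z ` (U \<inter> V) \<subseteq> z ` U"
    "\<And>t. t \<in> z ` (U \<inter> V) \<Longrightarrow> inv_into U z t \<in> V"
  using chart_image_open[OF c(1) V(1)] c V by auto

lemma smooth_at_cong:
  assumes g: "smooth_at A g x" and V: "open V" "x \<in> V" "\<And>y. y \<in> V \<Longrightarrow> g y = h y"
  shows "smooth_at A h x"
proof -
  obtain U z where c: "(U, z) \<in> A" "x \<in> U" by (rule chart_at)
  obtain W where W: "open W" "z x \<in> W" "W \<subseteq> z ` U" "smooth_on W (g \<circ> inv_into U z)"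
    by (rule smooth_atE[OF g c])
  note n = chart_nhd[OF c V(1,2)]
  have "smooth_on (W \<inter> z ` (U \<inter> V)) (h \<circ> inv_into U z)"
    by (rule smooth_on_cong[OF _ smooth_on_subset[OF W(4)]]) (use W n V in auto)
  then show ?thesis
    by (rule smooth_atI[OF c, rotated -1]) (use W n in auto)
qed

lemma dbar_form_cong:
  assumes g: "smooth_at A g x" and V: "open V" "x \<in> V" "\<And>y. y \<in> V \<Longrightarrow> g y = h y"
    and c: "(U, z) \<in> A" "x \<in> U"
  shows "dbar_form g (U, z) x = dbar_form h (U, z) x"
  unfolding dbar_form_def fst_conv snd_conv
  by (rule dzbar_cong[OF chart_nhd(1,2)[OF c V(1,2)] smooth_at_differentiable[OF g c]])
     (use V chart_nhd(4)[OF c V(1,2)] in auto)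

lemma smooth_at_const [simp]: "smooth_at A (\<lambda>_. k) x"
proof -
  obtain U z where c: "(U, z) \<in> A" "x \<in> U" by (rule chart_at)
  show ?thesis
    by (rule smooth_atI[OF c chart_open_image[OF c(1)]]) (use c in \<open>auto simp: o_def\<close>)
qed

lemma smooth_at_binop:
  assumes "smooth_at A g x" "smooth_at A h x"
    and op: "\<And>(S::complex set) G H. open S \<Longrightarrow> smooth_on S G \<Longrightarrow> smooth_on S H \<Longrightarrow> smooth_on S (\<lambda>t. f (G t) (H t))"
  shows "smooth_at A (\<lambda>y. f (g y) (h y)) x"
proof -
  obtain U z where c: "(U, z) \<in> A" "x \<in> U" by (rule chart_at)
  obtain W where W: "open W" "z x \<in> W" "W \<subseteq> z ` U" "smooth_on W (g \<circ> inv_into U z)"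
    by (rule smooth_atE[OF assms(1) c])
  obtain W' where W': "open W'" "z x \<in> W'" "W' \<subseteq> z ` U" "smooth_on W' (h \<circ> inv_into U z)"
    by (rule smooth_atE[OF assms(2) c])
  have "smooth_on (W \<inter> W') (\<lambda>t. f ((g \<circ> inv_into U z) t) ((h \<circ> inv_into U z) t))"
    by (rule op[OF open_Int[OF W(1) W'(1)] smooth_on_subset[OF W(4) Int_lower1[of W W']] smooth_on_subset[OF W'(4) Int_lower2[of W W']]])
  then have "smooth_on (W \<inter> W') ((\<lambda>y. f (g y) (h y)) \<circ> inv_into U z)"
    by (simp add: o_def)
  then show ?thesis
    by (rule smooth_atI[OF c, rotated -1]) (use W W' in auto)
qed

lemma smooth_at_add: "smooth_at A g x \<Longrightarrow> smooth_at A h x \<Longrightarrow> smooth_at A (\<lambda>y. g y + h y) x"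
  by (rule smooth_at_binop) (auto intro: smooth_on_add)

lemma smooth_at_mult: "smooth_at A g x \<Longrightarrow> smooth_at A h x \<Longrightarrow> smooth_at A (\<lambda>y. g y * h y) x"
  by (rule smooth_at_binop) (auto intro: smooth_on_mult)

lemma smooth_at_sum: "(\<And>i. i \<in> I \<Longrightarrow> smooth_at A (g i) x) \<Longrightarrow> smooth_at A (\<lambda>y. \<Sum>i\<in>I. g i y) x"
  by (induction I rule: infinite_finite_induct) (auto intro: smooth_at_add)

lemma dbar_form_const: "dbar_form (\<lambda>_. k) c x = 0"
  by (simp add: dbar_form_def o_def dzbar_def)

lemma dbar_form_add:
  assumes "smooth_at A g x" "smooth_at A h x" and c: "(U, z) \<in> A" "x \<in> U"
  shows "dbar_form (\<lambda>y. g y + h y) (U, z) x = dbar_form g (U, z) x + dbar_form h (U, z) x"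
  using dzbar_add[OF smooth_at_differentiable[OF assms(1) c] smooth_at_differentiable[OF assms(2) c]]
  by (simp add: dbar_form_def o_def)

lemma dbar_form_mult:
  assumes "smooth_at A g x" "smooth_at A h x" and c: "(U, z) \<in> A" "x \<in> U"
  shows "dbar_form (\<lambda>y. g y * h y) (U, z) x = dbar_form g (U, z) x * h x + g x * dbar_form h (U, z) x"
  using dzbar_mult[OF smooth_at_differentiable[OF assms(1) c] smooth_at_differentiable[OF assms(2) c]] c
  by (simp add: dbar_form_def o_def)

lemma dbar_form_sum:
  assumes "\<And>i. i \<in> I \<Longrightarrow> smooth_at A (g i) x" and c: "(U, z) \<in> A" "x \<in> U"
  shows "dbar_form (\<lambda>y. \<Sum>i\<in>I. g i y) (U, z) x = (\<Sum>i\<in>I. dbar_form (g i) (U, z) x)"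
  using assms(1)
  by (induction I rule: infinite_finite_induct)
     (auto simp: dbar_form_const dbar_form_add[OF _ smooth_at_sum c])

lemma smooth_at_isCont:
  assumes "smooth_at A g x" shows "isCont g x"
proof -
  obtain U z where c: "(U, z) \<in> A" "x \<in> U" by (rule chart_at)
  have 1: "isCont z x"
    using homeomorphism_cont1[OF chart_homeo[OF c(1)]] chart_open[OF c(1)] c(2)
    by (simp add: continuous_on_eq_continuous_at)
  have 2: "isCont (g \<circ> inv_into U z) (z x)"
    using smooth_at_differentiable[OF assms c] differentiable_imp_continuous_within by blast
  have "isCont (\<lambda>y. (g \<circ> inv_into U z) (z y)) x"
    by (rule isCont_o2[OF 1 2])
  moreover have "\<forall>\<^sub>F y in nhds x. (g \<circ> inv_into U z) (z y) = g y"
    using eventually_nhds_in_open[OF chart_open[OF c(1)] c(2)] by eventually_elim (simp add: c)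
  ultimately show ?thesis using isCont_cong by fastforce
qed

lemma smooth_functionI:
  assumes "\<And>x. x \<in> S \<Longrightarrow> smooth_at A g x"
  shows "smooth_function A S g"
  unfolding smooth_function_def
proof clarify
  fix U z assume c: "(U, z) \<in> A"
  show "smooth_on (z ` (S \<inter> U)) (g \<circ> inv_into U z)"
  proof (rule smooth_on_local)
    fix t assume "t \<in> z ` (S \<inter> U)"
    then obtain x where "x \<in> S" "x \<in> U" "t = z x" by auto
    then show "\<exists>W. open W \<and> t \<in> W \<and> smooth_on W (g \<circ> inv_into U z)"
      using smooth_atE[OF assms c, of x] by metis
  qed
qed

section \<open>Smooth forms and cutoff functions on the surface\<close>

lemma smooth_formD:
  assumes "smooth_form01 A S \<phi>" "(U, z) \<in> A"
  shows "smooth_on (z ` (S \<inter> U)) (\<phi> (U, z) \<circ> inv_into U z)"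
    and "(V, w) \<in> A \<Longrightarrow> x \<in> S \<Longrightarrow> x \<in> U \<Longrightarrow> x \<in> V \<Longrightarrow>
      \<phi> (U, z) x = \<phi> (V, w) x * cnj (deriv (w \<circ> inv_into U z) (z x))"
  using assms unfolding smooth_form01_def by fast+

lemma smooth_form_diff_dbar:
  assumes S: "open S" and \<phi>: "smooth_form01 A S \<phi>" and g: "\<And>x. x \<in> S \<Longrightarrow> smooth_at A g x"
  shows "smooth_form01 A S (\<lambda>c x. \<phi> c x - dbar_form g c x)"
  unfolding smooth_form01_def
proof (intro conjI ballI, clarify)
  fix U z V w x assume c: "(U, z) \<in> A" "(V, w) \<in> A" and x: "x \<in> S" "x \<in> U" "x \<in> V"
  show "\<phi> (U, z) x - dbar_form g (U, z) x =
      (\<phi> (V, w) x - dbar_form g (V, w) x) * cnj (deriv (w \<circ> inv_into U z) (z x))"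
    using smooth_formD(2)[OF \<phi> c x] dbar_form_transition[OF g[OF x(1)] c(2) x(3) c(1) x(2)]
    by (simp add: left_diff_distrib)
next
  fix c assume "c \<in> A"
  then obtain U z where c: "c = (U, z)" "(U, z) \<in> A" by (cases c) auto
  have o: "open (z ` (S \<inter> U))" using chart_image_open[OF c(2) S] by (simp add: Int_commute)
  have "smooth_on (z ` (S \<inter> U)) (g \<circ> inv_into U z)"
    using smooth_functionI[of S g] g c(2) unfolding smooth_function_def by fast
  from smooth_on_diff[OF o smooth_formD(1)[OF \<phi> c(2)] smooth_on_dzbar[OF o this]]
  have "smooth_on (z ` (S \<inter> U)) ((\<lambda>x. \<phi> (U, z) x - dbar_form g (U, z) x) \<circ> inv_into U z)"
    by (rule smooth_on_cong[OF o]) (use c in \<open>auto simp: dbar_form_def\<close>)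
  then show "case c of (U, z) \<Rightarrow> smooth_on (z ` (S \<inter> U)) ((\<lambda>x. \<phi> (U, z) x - dbar_form g (U, z) x) \<circ> inv_into U z)"
    by (simp add: c)
qed

lemma smooth_form_mult:
  assumes S: "open S" and \<phi>: "smooth_form01 A S \<phi>" and g: "\<And>x. x \<in> S \<Longrightarrow> smooth_at A g x"
  shows "smooth_form01 A S (\<lambda>c x. g x * \<phi> c x)"
  unfolding smooth_form01_def
proof (intro conjI ballI, clarify)
  fix U z V w x assume c: "(U, z) \<in> A" "(V, w) \<in> A" and x: "x \<in> S" "x \<in> U" "x \<in> V"
  show "g x * \<phi> (U, z) x = (g x * \<phi> (V, w) x) * cnj (deriv (w \<circ> inv_into U z) (z x))"
    using smooth_formD(2)[OF \<phi> c x] by simp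
next
  fix c assume "c \<in> A"
  then obtain U z where c: "c = (U, z)" "(U, z) \<in> A" by (cases c) auto
  have o: "open (z ` (S \<inter> U))" using chart_image_open[OF c(2) S] by (simp add: Int_commute)
  have "smooth_on (z ` (S \<inter> U)) (g \<circ> inv_into U z)"
    using smooth_functionI[of S g] g c(2) unfolding smooth_function_def by fast
  from smooth_on_mult[OF o this smooth_formD(1)[OF \<phi> c(2)]]
  show "case c of (U, z) \<Rightarrow> smooth_on (z ` (S \<inter> U)) ((\<lambda>x. g x * \<phi> (U, z) x) \<circ> inv_into U z)"
    by (simp add: c o_def)
qed

text \<open>A planar bump is transplanted by a chart and extended by 0. The extension is smooth
  because \<open>K\<close>, the image of a closed disc, is compact and hence closed in the Hausdorff
  surface.\<close>

lemma surface_bump: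
  assumes "open V" "b \<in> V"
  obtains \<eta> V' K where "\<And>x. smooth_at A \<eta> x" "open V'" "b \<in> V'" "V' \<subseteq> V" "closed K" "K \<subseteq> V"
    "\<And>x. x \<in> V' \<Longrightarrow> \<eta> x = 1" "\<And>x. x \<notin> K \<Longrightarrow> \<eta> x = 0" "\<And>x. norm (\<eta> x) \<le> 1"
proof -
  obtain U z where c: "(U, z) \<in> A" "b \<in> U" by (rule chart_at)
  note n = chart_nhd[OF c assms]
  obtain e0 where "e0 > 0" and e0: "cball (z b) e0 \<subseteq> z ` (U \<inter> V)"
    using n(1,2) open_contains_cball by blast
  define e where "e = e0 / 2"
  have e: "e > 0" "cball (z b) (2 * e) \<subseteq> z ` (U \<inter> V)" using \<open>e0 > 0\<close> e0 by (auto simp: e_def)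
  obtain \<beta> where \<beta>: "smooth_on UNIV \<beta>" "\<And>t. dist t (z b) \<le> e \<Longrightarrow> \<beta> t = 1"
    "\<And>t. dist t (z b) \<ge> 2 * e \<Longrightarrow> \<beta> t = 0" "\<And>t. norm (\<beta> t) \<le> 1"
    by (rule bump_at[OF e(1), of "z b"]) blast
  define \<eta> where "\<eta> x = (if x \<in> U then \<beta> (z x) else 0)" for x
  define K where "K = inv_into U z ` cball (z b) (2 * e)"
  have sub: "cball (z b) (2 * e) \<subseteq> z ` U" using e(2) by blast
  have "compact K" unfolding K_def
    by (intro compact_continuous_image compact_cball
        continuous_on_subset[OF homeomorphism_cont2[OF chart_homeo[OF c(1)]] sub])
  then have K: "closed K" by (rule compact_imp_closed)
  have K0: "\<eta> x = 0" if "x \<notin> K" for x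
  proof (cases "x \<in> U")
    case True
    then have "z x \<notin> cball (z b) (2 * e)" using that c(1) unfolding K_def by (metis image_eqI inv_chart)
    then show ?thesis using \<beta>(3)[of "z x"] by (simp add: \<eta>_def dist_commute)
  qed (simp add: \<eta>_def)
  show ?thesis
  proof (rule that[of \<eta> "U \<inter> z -` ball (z b) e" K])
    show "smooth_at A \<eta> x" for x
    proof (cases "x \<in> U")
      case True
      have "smooth_at A (\<lambda>y. \<beta> (z y)) x"
        by (rule smooth_at_compose[OF holo_at_chart[OF c(1) True] open_UNIV _ \<beta>(1)]) simp
      then show ?thesis
        by (rule smooth_at_cong[OF _ chart_open[OF c(1)] True]) (simp add: \<eta>_def)
    next
      case False
      then have "x \<notin> K" using sub c(1) unfolding K_def by (auto simp: inv_into_into)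
      then show ?thesis
        by (intro smooth_at_cong[OF smooth_at_const[of 0], of "- K"]) (use K K0 in auto)
    qed
    show "open (U \<inter> z -` ball (z b) e)" by (rule chart_preimage_open[OF c(1)]) simp
    show "K \<subseteq> V" using e(2) n(4) unfolding K_def by blast
    show "U \<inter> z -` ball (z b) e \<subseteq> V"
    proof
      fix x assume x: "x \<in> U \<inter> z -` ball (z b) e"
      then have "z x \<in> cball (z b) (2 * e)" using e(1) by auto
      then have "z x \<in> z ` (U \<inter> V)" using e(2) by blast
      then have "inv_into U z (z x) \<in> V" by (rule n(4))
      then show "x \<in> V" using c x by simp
    qed
    show "\<eta> x = 1" if "x \<in> U \<inter> z -` ball (z b) e" for x
      using that \<beta>(2)[of "z x"] by (auto simp: \<eta>_def dist_commute)
    show "norm (\<eta> x) \<le> 1" for x by (simp add: \<eta>_def \<beta>(4))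
  qed (use K K0 c e in auto)
qed

end

section \<open>Homogeneous coordinates and polynomials\<close>

lemma hcoords_cases:
  obtains \<zeta> where "\<zeta> \<noteq> 0" "hcoords p = {c *s \<zeta> | c. c \<noteq> 0}"
  using hcoords[of p] by auto

lemma hcoords_eq:
  assumes "\<zeta> \<in> hcoords p" shows "hcoords p = {c *s \<zeta> | c. c \<noteq> 0}"
proof -
  obtain \<eta> where \<eta>: "\<eta> \<noteq> 0" "hcoords p = {c *s \<eta> | c. c \<noteq> 0}" by (rule hcoords_cases)
  with assms obtain a where a: "a \<noteq> 0" "\<zeta> = a *s \<eta>" by auto
  show ?thesis
  proof
    show "hcoords p \<subseteq> {c *s \<zeta> | c. c \<noteq> 0}"
    proof
      fix x assume "x \<in> hcoords p"
      then obtain c where c: "c \<noteq> 0" "x = c *s \<eta>" using \<eta>(2) by auto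
      then have "x = (c / a) *s \<zeta>" "c / a \<noteq> 0" using a by (simp_all add: vector_smult_assoc)
      then show "x \<in> {c *s \<zeta> | c. c \<noteq> 0}" by blast
    qed
    show "{c *s \<zeta> | c. c \<noteq> 0} \<subseteq> hcoords p"
    proof
      fix x assume "x \<in> {c *s \<zeta> | c. c \<noteq> 0}"
      then obtain c where c: "c \<noteq> 0" "x = c *s \<zeta>" by blast
      then have "x = (c * a) *s \<eta>" "c * a \<noteq> 0" using a by (simp_all add: vector_smult_assoc)
      then show "x \<in> hcoords p" using \<eta>(2) by blast
    qed
  qed
qed

lemma hcoords_nonzero: "\<zeta> \<in> hcoords p \<Longrightarrow> \<zeta> \<noteq> 0"
  by (rule hcoords_cases[of p]) auto

lemma hcoords_scale: "\<zeta> \<in> hcoords p \<Longrightarrow> c \<noteq> 0 \<Longrightarrow> c *s \<zeta> \<in> hcoords p"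
  using hcoords_eq by blast

lemma hcoords_proportional:
  assumes "\<zeta> \<in> hcoords p" "\<eta> \<in> hcoords p" obtains c where "c \<noteq> 0" "\<eta> = c *s \<zeta>"
  using assms hcoords_eq by blast

lemma hcoords_disjoint: "\<zeta> \<in> hcoords p \<Longrightarrow> \<zeta> \<in> hcoords q \<Longrightarrow> p = q"
  using hcoords_eq[of \<zeta> p] hcoords_eq[of \<zeta> q] hcoords_inject[of p q] by simp

lemma hcoords_nonempty: obtains \<zeta> where "\<zeta> \<in> hcoords p"
proof -
  obtain \<zeta> where \<zeta>: "\<zeta> \<noteq> 0" "hcoords p = {c *s \<zeta> | c. c \<noteq> 0}" by (rule hcoords_cases)
  have "\<zeta> \<in> hcoords p" unfolding \<zeta>(2) by (rule CollectI, rule exI[of _ 1]) simp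
  then show ?thesis by (rule that)
qed

lemma hcoords_exists: "\<zeta> \<noteq> 0 \<Longrightarrow> \<exists>p. \<zeta> \<in> hcoords p"
proof -
  assume "\<zeta> \<noteq> 0"
  then have "hcoords (Abs_cp2 {c *s \<zeta> | c. c \<noteq> 0}) = {c *s \<zeta> | c. c \<noteq> 0}"
    by (intro Abs_cp2_inverse) auto
  moreover have "\<exists>c. \<zeta> = c *s \<zeta> \<and> c \<noteq> 0" by (rule exI[of _ 1]) simp
  ultimately show ?thesis by auto
qed

lemma affine_chart_domain_iff: "\<zeta> \<in> hcoords p \<Longrightarrow> p \<in> affine_chart_domain i \<longleftrightarrow> \<zeta> $ i \<noteq> 0"
  by (auto simp: affine_chart_domain_def hcoords_eq)

lemma line_at_infinity_iff: "\<zeta> \<in> hcoords p \<Longrightarrow> p \<in> line_at_infinity \<longleftrightarrow> \<zeta> $ 0 = 0"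
  by (force simp: line_at_infinity_def hcoords_eq)

lemma affine_coords_eqI:
  fixes \<zeta> :: "complex^3"
  assumes "\<zeta> \<in> hcoords p" "\<zeta> $ i = 1" shows "affine_coords i p = \<zeta>"
  unfolding affine_coords_def
  by (rule the_equality) (use assms in \<open>auto simp: hcoords_eq[OF assms(1)]\<close>)

lemma affine_coords:
  assumes "p \<in> affine_chart_domain i"
  shows affine_coords_hcoords: "affine_coords i p \<in> hcoords p"
    and affine_coords_nth: "affine_coords i p $ i = 1"
proof -
  obtain \<zeta> where \<zeta>: "\<zeta> \<in> hcoords p" by (rule hcoords_nonempty)
  then have "\<zeta> $ i \<noteq> 0" using assms affine_chart_domain_iff by blast
  then have "(1 / \<zeta> $ i) *s \<zeta> \<in> hcoords p" "((1 / \<zeta> $ i) *s \<zeta>) $ i = 1"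
    using hcoords_scale[OF \<zeta>] by auto
  then show "affine_coords i p \<in> hcoords p" "affine_coords i p $ i = 1"
    using affine_coords_eqI by metis+
qed

lemma affine_chart_domain_cover: "\<exists>i. p \<in> affine_chart_domain i"
proof -
  obtain \<zeta> where \<zeta>: "\<zeta> \<in> hcoords p" by (rule hcoords_nonempty)
  then obtain i where "\<zeta> $ i \<noteq> 0" using hcoords_nonzero by (metis vec_eq_iff zero_index)
  then show ?thesis using \<zeta> affine_chart_domain_iff by blast
qed

lemma affine_coords_change:
  assumes "p \<in> affine_chart_domain i" "p \<in> affine_chart_domain k"
  shows "affine_coords k p $ j = affine_coords i p $ j / affine_coords i p $ k"
proof -
  note h = affine_coords_hcoords[OF assms(1)]
  have nz: "affine_coords i p $ k \<noteq> 0" using affine_chart_domain_iff[OF h] assms(2) by blast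
  have "affine_coords k p = (1 / affine_coords i p $ k) *s affine_coords i p"
    by (rule affine_coords_eqI) (use hcoords_scale[OF h] nz in auto)
  then show ?thesis by simp
qed

text \<open>An inductive predicate, so that existence of a polynomial gradient, symmetry of second
  derivatives and the holomorphic chain rule are all proved by following the construction of the
  polynomial.\<close>

inductive polyfun :: "(complex^3 \<Rightarrow> complex) \<Rightarrow> bool" where
  const: "polyfun (\<lambda>_. c)"
| coord: "polyfun (\<lambda>\<zeta>::complex^3. \<zeta> $ i)"
| add: "polyfun f \<Longrightarrow> polyfun g \<Longrightarrow> polyfun (\<lambda>\<zeta>. f \<zeta> + g \<zeta>)"
| mult: "polyfun f \<Longrightarrow> polyfun g \<Longrightarrow> polyfun (\<lambda>\<zeta>. f \<zeta> * g \<zeta>)"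

lemma polyfun_sum: "(\<And>i. i \<in> I \<Longrightarrow> polyfun (f i)) \<Longrightarrow> polyfun (\<lambda>\<zeta>. \<Sum>i\<in>I. f i \<zeta>)"
  by (induction I rule: infinite_finite_induct) (auto intro: polyfun.intros)

lemma polyfun_power: "polyfun f \<Longrightarrow> polyfun (\<lambda>\<zeta>. f \<zeta> ^ n)"
  by (induction n) (auto intro: polyfun.intros)

definition pd :: "3 \<Rightarrow> (complex^3 \<Rightarrow> complex) \<Rightarrow> complex^3 \<Rightarrow> complex" where
  "pd i f \<zeta> = frechet_derivative f (at \<zeta>) (axis i 1)"

lemma pd_eqI:
  assumes "(f has_derivative (\<lambda>v::complex^3. \<Sum>i\<in>UNIV. v $ i * G i)) (at \<zeta>)"
  shows "pd i f \<zeta> = G i"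
proof -
  have "pd i f \<zeta> = (\<Sum>j\<in>UNIV. (axis i 1 :: complex^3) $ j * G j)"
    by (simp add: pd_def frechet_derivative_at[OF assms, symmetric])
  also have "\<dots> = (\<Sum>j\<in>UNIV. if j = i then G j else 0)"
    by (rule sum.cong) (auto simp: axis_def)
  finally show ?thesis by simp
qed

lemma polyfun_has_gradient:
  assumes "polyfun f"
  shows "\<exists>G. (\<forall>i. polyfun (G i)) \<and> (\<forall>\<zeta>. (f has_derivative (\<lambda>v::complex^3. \<Sum>i\<in>UNIV. v $ i * G i \<zeta>)) (at \<zeta>))"
  using assms
proof induction
  case (const c)
  show ?case by (rule exI[of _ "\<lambda>i \<zeta>. 0"]) (auto intro: polyfun.const)
next
  case (coord k)
  have "(\<Sum>i\<in>UNIV. v $ i * (if i = k then 1 else 0)) = v $ k" for v :: "complex^3"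
    by (simp add: if_distrib cong: if_cong)
  then show ?case
    by (intro exI[of _ "\<lambda>i \<zeta>. if i = k then 1 else 0"])
       (auto intro: polyfun.const bounded_linear_imp_has_derivative bounded_linear_vec_nth)
next
  case (add f g)
  then obtain F G where FG: "\<And>i. polyfun (F i)" "\<And>i. polyfun (G i)"
    "\<And>\<zeta>. (f has_derivative (\<lambda>v::complex^3. \<Sum>i\<in>UNIV. v $ i * F i \<zeta>)) (at \<zeta>)"
    "\<And>\<zeta>. (g has_derivative (\<lambda>v::complex^3. \<Sum>i\<in>UNIV. v $ i * G i \<zeta>)) (at \<zeta>)" by blast
  show ?case
    by (intro exI[of _ "\<lambda>i \<zeta>. F i \<zeta> + G i \<zeta>"] conjI allI polyfun.add FG
        has_derivative_eq_rhs[OF has_derivative_add[OF FG(3,4)]])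
       (simp add: fun_eq_iff sum.distrib distrib_left)
next
  case (mult f g)
  then obtain F G where FG: "\<And>i. polyfun (F i)" "\<And>i. polyfun (G i)"
    "\<And>\<zeta>. (f has_derivative (\<lambda>v::complex^3. \<Sum>i\<in>UNIV. v $ i * F i \<zeta>)) (at \<zeta>)"
    "\<And>\<zeta>. (g has_derivative (\<lambda>v::complex^3. \<Sum>i\<in>UNIV. v $ i * G i \<zeta>)) (at \<zeta>)" by blast
  show ?case
    by (intro exI[of _ "\<lambda>i \<zeta>. f \<zeta> * G i \<zeta> + F i \<zeta> * g \<zeta>"] conjI allI polyfun.add polyfun.mult FG mult.hyps
        has_derivative_eq_rhs[OF has_derivative_mult[OF FG(3,4)]])
       (simp add: fun_eq_iff sum.distrib distrib_left sum_distrib_left sum_distrib_right mult_ac)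
qed

lemma polyfun_has_derivative:
  assumes "polyfun f" shows "(f has_derivative (\<lambda>v::complex^3. \<Sum>i\<in>UNIV. v $ i * pd i f \<zeta>)) (at \<zeta>)"
proof -
  obtain G where G: "\<And>\<zeta>. (f has_derivative (\<lambda>v::complex^3. \<Sum>i\<in>UNIV. v $ i * G i \<zeta>)) (at \<zeta>)"
    using polyfun_has_gradient[OF assms] by blast
  show ?thesis using G[of \<zeta>] pd_eqI[OF G] by simp
qed

lemma polyfun_frechet_derivative:
  "polyfun f \<Longrightarrow> frechet_derivative f (at \<zeta>) (v::complex^3) = (\<Sum>i\<in>UNIV. v $ i * pd i f \<zeta>)"
  by (simp add: frechet_derivative_at[OF polyfun_has_derivative, symmetric])

lemma polyfun_pd: assumes "polyfun f" shows "polyfun (pd i f)"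
proof -
  obtain G where G: "\<And>i. polyfun (G i)" "\<And>\<zeta>. (f has_derivative (\<lambda>v::complex^3. \<Sum>i\<in>UNIV. v $ i * G i \<zeta>)) (at \<zeta>)"
    using polyfun_has_gradient[OF assms] by blast
  have "pd i f = G i" by (rule ext, rule pd_eqI[OF G(2)])
  then show ?thesis using G by simp
qed

lemma pd_const: "pd i (\<lambda>_. c) = (\<lambda>_. 0)"
  by (rule ext, rule pd_eqI[where G = "\<lambda>_. 0"]) simp

lemma pd_coord: "pd i (\<lambda>\<zeta>::complex^3. \<zeta> $ k) = (\<lambda>_. if i = k then 1 else 0)"
  by (rule ext, rule pd_eqI[where G = "\<lambda>i. if i = k then 1 else 0"])
     (simp add: if_distrib bounded_linear_imp_has_derivative bounded_linear_vec_nth cong: if_cong)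

lemma pd_add: "polyfun f \<Longrightarrow> polyfun g \<Longrightarrow> pd i (\<lambda>\<zeta>. f \<zeta> + g \<zeta>) = (\<lambda>\<zeta>. pd i f \<zeta> + pd i g \<zeta>)"
  by (rule ext, rule pd_eqI, rule has_derivative_eq_rhs[OF has_derivative_add[OF polyfun_has_derivative polyfun_has_derivative]])
     (simp_all add: fun_eq_iff sum.distrib distrib_left)

lemma pd_mult: "polyfun f \<Longrightarrow> polyfun g \<Longrightarrow> pd i (\<lambda>\<zeta>. f \<zeta> * g \<zeta>) = (\<lambda>\<zeta>. f \<zeta> * pd i g \<zeta> + pd i f \<zeta> * g \<zeta>)"
  by (rule ext, rule pd_eqI, rule has_derivative_eq_rhs[OF has_derivative_mult[OF polyfun_has_derivative polyfun_has_derivative]])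
     (simp_all add: fun_eq_iff sum.distrib distrib_left sum_distrib_left sum_distrib_right mult_ac)

text \<open>Symmetry of second derivatives is here an algebraic identity, preserved by sums and
  products through \<open>pd_add\<close> and \<open>pd_mult\<close>.\<close>

lemma pd_commute: "polyfun f \<Longrightarrow> pd i (pd j f) = pd j (pd i f)"
  by (induction rule: polyfun.induct)
     (auto simp: pd_const pd_coord pd_add pd_mult polyfun_pd polyfun.intros fun_eq_iff algebra_simps)

lemma hessian_polyfun:
  fixes u v :: "complex^3"
  assumes "polyfun f"
  shows "hessian f \<zeta> u v = (\<Sum>k\<in>UNIV. v $ k * (\<Sum>i\<in>UNIV. u $ i * pd i (pd k f) \<zeta>))"
proof -
  let ?g = "\<lambda>\<eta>. \<Sum>i\<in>UNIV. u $ i * pd i f \<eta>"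
  have g: "polyfun ?g" by (intro polyfun_sum polyfun.mult polyfun.const polyfun_pd assms)
  have "pd k ?g \<zeta> = (\<Sum>i\<in>UNIV. u $ i * pd k (pd i f) \<zeta>)" for k
    unfolding sum_3
    by (simp add: pd_add pd_mult pd_const polyfun.intros polyfun_pd assms)
  then show ?thesis
    unfolding hessian_def polyfun_frechet_derivative[OF assms]
    by (simp add: polyfun_frechet_derivative[OF g] pd_commute[OF assms])
qed

lemma polyfun_compose:
  fixes Z :: "complex \<Rightarrow> complex^3"
  assumes "polyfun f" and Z: "\<And>j. ((\<lambda>t. Z t $ j) has_field_derivative D j) (at t)"
  shows "((\<lambda>t. f (Z t)) has_field_derivative (\<Sum>j\<in>UNIV. D j * pd j f (Z t))) (at t)"
  using assms(1)
proof induction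
  case (const c) then show ?case by (simp add: pd_const)
next
  case (coord i) then show ?case using Z[of i] by (simp add: pd_coord if_distrib cong: if_cong)
next
  case (add f g)
  then show ?case
    by (auto intro!: derivative_eq_intros simp: pd_add sum.distrib distrib_left)
next
  case (mult f g)
  then show ?case
    by (auto intro!: derivative_eq_intros simp: pd_mult sum.distrib distrib_left sum_distrib_left sum_distrib_right mult_ac)
qed

lemma polyfun_compose_holomorphic:
  fixes Z :: "complex \<Rightarrow> complex^3"
  assumes "polyfun f" "\<And>j. (\<lambda>t. Z t $ j) holomorphic_on S" "open S"
  shows "(\<lambda>t. f (Z t)) holomorphic_on S"
  unfolding holomorphic_on_open[OF assms(3)]
  using polyfun_compose[OF assms(1) holomorphic_derivI[OF assms(2,3)]] by blast

section \<open>Coordinate vectors and homogeneous polynomials\<close>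

definition vec3 :: "complex \<Rightarrow> complex \<Rightarrow> complex \<Rightarrow> complex^3" where
  "vec3 a b e = (\<chi> i. if i = 0 then a else if i = 1 then b else e)"

lemma vec3_nth [simp]: "vec3 a b e $ 0 = a" "vec3 a b e $ 1 = b" "vec3 a b e $ 2 = e"
  by (simp_all add: vec3_def)

lemma index3_eq_0: "(3::3) = 0"
  by simp

lemma forall_index3: "(\<forall>i::3. Q i) \<longleftrightarrow> Q 0 \<and> Q 1 \<and> Q 2"
  unfolding forall_3 index3_eq_0 by blast

lemma vec3_eqI:
  fixes a b :: "complex^3"
  shows "a $ 0 = b $ 0 \<Longrightarrow> a $ 1 = b $ 1 \<Longrightarrow> a $ 2 = b $ 2 \<Longrightarrow> a = b"
  by (simp add: vec_eq_iff forall_index3)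

lemma sum_index3: "(\<Sum>i\<in>UNIV. f (i::3)) = f 0 + f 1 + f 2"
  unfolding sum_3 index3_eq_0 by (simp add: add_ac)

locale homogeneous_polynomial =
  fixes d :: nat and P :: "complex^3 \<Rightarrow> complex"
  assumes hom: "hom_poly d P"
begin

lemma polyfun_P: "polyfun P"
proof -
  from hom obtain a where "\<And>\<zeta>::complex^3. P \<zeta> = (\<Sum>j\<le>d. \<Sum>k\<le>d - j. a j k * (\<zeta> $ 0) ^ (d - j - k) * (\<zeta> $ 1) ^ j * (\<zeta> $ 2) ^ k)"
    unfolding hom_poly_def by blast
  then have "P = (\<lambda>\<zeta>::complex^3. \<Sum>j\<le>d. \<Sum>k\<le>d - j. a j k * (\<zeta> $ 0) ^ (d - j - k) * (\<zeta> $ 1) ^ j * (\<zeta> $ 2) ^ k)" by blast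
  then show ?thesis
    by (simp only:) (intro polyfun_sum polyfun.mult polyfun_power polyfun.const polyfun.coord)
qed

lemma P_scale: "P (c *s \<zeta>) = c ^ d * P \<zeta>"
proof -
  from hom obtain a where P: "\<And>\<zeta>::complex^3. P \<zeta> = (\<Sum>j\<le>d. \<Sum>k\<le>d - j. a j k * (\<zeta> $ 0) ^ (d - j - k) * (\<zeta> $ 1) ^ j * (\<zeta> $ 2) ^ k)"
    unfolding hom_poly_def by blast
  have "a j k * ((c *s \<zeta>) $ 0) ^ (d - j - k) * ((c *s \<zeta>) $ 1) ^ j * ((c *s \<zeta>) $ 2) ^ k =
      c ^ d * (a j k * (\<zeta> $ 0) ^ (d - j - k) * (\<zeta> $ 1) ^ j * (\<zeta> $ 2) ^ k)"
    if "j \<le> d" "k \<le> d - j" for j k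
  proof -
    have e: "c ^ d = c ^ (d - j - k) * c ^ j * c ^ k"
      using that by (simp add: power_add[symmetric])
    show ?thesis unfolding e by (simp add: power_mult_distrib mult_ac)
  qed
  then show ?thesis
    unfolding P sum_distrib_left by (intro sum.cong refl) auto
qed

text \<open>Both sides differentiate \<open>P (c *s \<zeta>) = c ^ d * P \<zeta>\<close>. The factor
  \<open>c\<close> stays on the left, so that the exponent \<open>d - 1\<close>, wrong for
  \<open>d = 0\<close>, does not appear.\<close>

lemma pd_P_scale: "c \<noteq> 0 \<Longrightarrow> c * pd i P (c *s \<zeta>) = c ^ d * pd i P \<zeta>"
proof -
  assume c: "c \<noteq> 0"
  have "((\<lambda>\<eta>. P (c *s \<eta>)) has_derivative (\<lambda>v::complex^3. \<Sum>i\<in>UNIV. (c *s v) $ i * pd i P (c *s \<zeta>))) (at \<zeta>)"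
  proof (rule has_derivative_compose[OF _ polyfun_has_derivative[OF polyfun_P]])
    have "linear (\<lambda>\<eta>::complex^3. c *s \<eta>)"
      by (rule linearI) (simp_all add: vec_eq_iff algebra_simps)
    then show "((\<lambda>\<eta>. c *s \<eta>) has_derivative (\<lambda>\<eta>. c *s \<eta>)) (at \<zeta>)"
      by (intro bounded_linear_imp_has_derivative) (simp add: linear_linear)
  qed
  then have 1: "pd i (\<lambda>\<eta>. P (c *s \<eta>)) \<zeta> = c * pd i P (c *s \<zeta>)"
    by (intro pd_eqI) (simp add: mult_ac)
  have "pd i (\<lambda>\<eta>. c ^ d * P \<eta>) \<zeta> = c ^ d * pd i P \<zeta>"
    by (simp add: pd_mult polyfun.const polyfun_P pd_const)
  then show ?thesis using 1 by (simp add: P_scale)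
qed

lemma curve_iff: "\<zeta> \<in> hcoords p \<Longrightarrow> p \<in> curve P \<longleftrightarrow> P \<zeta> = 0"
  by (auto simp: curve_def hcoords_eq P_scale intro!: exI[of _ 1])

lemma singular_iff: 
  assumes "\<zeta> \<in> hcoords p" "p \<in> curve P"
  shows "p \<in> singular_points P \<longleftrightarrow> (\<forall>i. pd i P \<zeta> = 0)"
proof
  assume "p \<in> singular_points P"
  then show "\<forall>i. pd i P \<zeta> = 0" using assms by (auto simp: singular_points_def pd_def)
next
  assume 0: "\<forall>i. pd i P \<zeta> = 0"
  have "pd i P \<eta> = 0" if \<eta>: "\<eta> \<in> hcoords p" for \<eta> i
  proof -
    obtain c where "c \<noteq> 0" "\<eta> = c *s \<zeta>" using hcoords_proportional[OF assms(1) \<eta>] by blast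
    then show ?thesis using pd_P_scale[of c i \<zeta>] 0 by simp
  qed
  then show "p \<in> singular_points P"
    using assms by (simp add: singular_points_def polyfun_frechet_derivative[OF polyfun_P])
qed

text \<open>The affine equation in the coordinates \<open>W\<close> along the lines through the point
  $(0:1:c)$ and \<open>x\<close> on the space of these lines.\<close>

lemma affine_equation:
  obtains q :: "nat \<Rightarrow> complex poly" where
    "\<And>x W. P (vec3 1 W (x + c * W)) = (\<Sum>j\<le>d. poly (q j) x * W ^ j)"
proof -
  from hom obtain a where P: "\<And>\<zeta>::complex^3. P \<zeta> = (\<Sum>j\<le>d. \<Sum>k\<le>d - j. a j k * (\<zeta> $ 0) ^ (d - j - k) * (\<zeta> $ 1) ^ j * (\<zeta> $ 2) ^ k)"
    unfolding hom_poly_def by blast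
  \<comment> \<open>The outer variable is \<open>W\<close> and the inner one is \<open>x\<close>, so
    \<open>[:[:0, 1:], [:c:]:]\<close> stands for \<open>x + c * W\<close>. Each monomial has degree
    at most \<open>j + k\<close> in \<open>W\<close>.\<close>
  define Q :: "complex poly poly" where
    "Q = (\<Sum>j\<le>d. \<Sum>k\<le>d - j. [:[:a j k:]:] * [:0, 1:] ^ j * [:[:0, 1:], [:c:]:] ^ k)"
  have "degree Q \<le> d"
    unfolding Q_def
  proof (intro degree_sum_le finite_atMost)
    fix j k assume "j \<in> {..d}" "k \<in> {..d - j}"
    then have jk: "j + k \<le> d" by auto
    have "degree ([:[:a j k:]:] * [:0, 1:] ^ j * [:[:0, 1:], [:c:]:] ^ k) \<le> (0 + 1 * j) + 1 * k"
      by (intro order_trans[OF degree_mult_le] add_mono order_trans[OF degree_power_le] mult_right_mono) auto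
    then show "degree ([:[:a j k:]:] * [:0, 1:] ^ j * [:[:0, 1:], [:c:]:] ^ k) \<le> d" using jk by simp
  qed
  show ?thesis
  proof (rule that[of "coeff Q"])
    fix x W
    have "P (vec3 1 W (x + c * W)) = poly (poly Q [:W:]) x"
      unfolding P Q_def by (simp add: poly_sum poly_power ac_simps)
    also have "poly Q [:W:] = (\<Sum>j\<le>d. coeff Q j * [:W:] ^ j)"
      unfolding poly_altdef
      by (rule sum.mono_neutral_left) (use \<open>degree Q \<le> d\<close> in \<open>auto simp: coeff_eq_0\<close>)
    also have "poly \<dots> x = (\<Sum>j\<le>d. poly (coeff Q j) x * W ^ j)"
      by (simp add: poly_sum poly_power)
    finally show "P (vec3 1 W (x + c * W)) = (\<Sum>j\<le>d. poly (coeff Q j) x * W ^ j)" .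
  qed
qed

end

section \<open>The curve in local coordinates\<close>

context homogeneous_polynomial begin

text \<open>The points (0:1:c) are pairwise distinct and lie at infinity. If all of them were on the
  curve, its intersection with the line at infinity would be infinite.\<close>

lemma center_exists:
  assumes "finite (curve P \<inter> line_at_infinity)"
  obtains c where "P (vec3 0 1 c) \<noteq> 0"
proof (rule ccontr)
  assume "\<not> thesis"
  then have 0: "P (vec3 0 1 c) = 0" for c using that by blast
  have "vec3 0 1 c \<noteq> 0" for c by (metis vec3_nth(2) zero_index zero_neq_one)
  define f where "f c = (SOME p. vec3 0 1 c \<in> hcoords p)" for c
  have f: "vec3 0 1 c \<in> hcoords (f c)" for c
    unfolding f_def by (rule someI_ex[OF hcoords_exists]) fact
  have "inj f"
  proof (rule injI)
    fix c c' assume "f c = f c'"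
    then obtain k where "vec3 0 1 c' = k *s vec3 0 1 c"
      using hcoords_proportional[OF f[of c], of "vec3 0 1 c'"] f[of c'] by metis
    then show "c = c'" by (metis vec3_nth(2,3) vector_smult_component mult_cancel_right1 mult_1 mult.right_neutral)
  qed
  moreover have "range f \<subseteq> curve P \<inter> line_at_infinity"
    using 0 f curve_iff[OF f] line_at_infinity_iff[OF f] by auto
  ultimately show False
    using assms infinite_UNIV_char_0 by (metis finite_imageD finite_subset)
qed

text \<open>\<open>W\<close> parametrizes a line through the centre of projection. Infinitely many
  zeros force \<open>P\<close> to vanish on this whole line except possibly at the centre; in the
  coordinate \<open>s = 1 / W\<close> the centre is \<open>s = 0\<close>, and continuity makes
  \<open>P\<close> vanish there too.\<close>

lemma center_line:
  assumes "P (vec3 0 1 c) \<noteq> 0" and W: "infinite {W. P (vec3 1 W (x + c * W)) = 0}"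
  shows False
proof -
  obtain q where q: "\<And>x W. P (vec3 1 W (x + c * W)) = (\<Sum>j\<le>d. poly (q j) x * W ^ j)"
    using affine_equation[of c] by metis
  define p where "p = (\<Sum>j\<le>d. monom (poly (q j) x) j)"
  have p: "poly p W = P (vec3 1 W (x + c * W))" for W
    by (simp add: p_def q poly_sum poly_monom)
  then have "p = 0" using W poly_roots_finite[of p] by auto
  then have 0: "P (vec3 1 W (x + c * W)) = 0" for W using p[of W] by simp
  let ?g = "\<lambda>s. P (vec3 s 1 (x * s + c))"
  have "?g s = 0" if "s \<noteq> 0" for s
  proof -
    have "vec3 s 1 (x * s + c) = s *s vec3 1 (1 / s) (x + c * (1 / s))"
      by (rule vec3_eqI) (use that in \<open>auto simp: field_simps\<close>)
    then show ?thesis using 0[of "1 / s"] by (simp only: P_scale mult_zero_right)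
  qed
  then have "(?g \<longlongrightarrow> 0) (at 0)"
    by (intro tendsto_eventually) (auto simp: eventually_at_filter)
  moreover have "\<forall>j. (\<lambda>s. vec3 s 1 (x * s + c) $ j) holomorphic_on UNIV"
    unfolding forall_index3 by (auto intro!: holomorphic_intros)
  then have "?g holomorphic_on UNIV"
    using polyfun_compose_holomorphic[OF polyfun_P _ open_UNIV, of "\<lambda>s. vec3 s 1 (x * s + c)"] by blast
  then have "isCont ?g 0"
    using holomorphic_on_imp_continuous_on continuous_on_eq_continuous_at open_UNIV by blast
  then have "(?g \<longlongrightarrow> ?g 0) (at 0)" by (simp add: isCont_def)
  ultimately have "?g 0 = 0" using tendsto_unique trivial_limit_at by blast
  then show False using assms by simp
qed

end

locale plane_curve = riemann_surface A + homogeneous_polynomial d P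
  for A :: "'a::t2_space chart set" and d :: nat and P :: "complex^3 \<Rightarrow> complex" +
  fixes \<rho> :: "'a \<Rightarrow> cp2" and c :: complex
  assumes cpt: "compact (UNIV :: 'a set)" and imm: "holomorphic_immersion A \<rho>"
    and range_\<rho>: "range \<rho> = curve P" and nodal: "singular_points P \<subseteq> nodes P"
    and inj_\<rho>: "inj_on \<rho> {x. \<rho> x \<notin> nodes P}"
    and fin: "finite (curve P \<inter> line_at_infinity)" and center: "P (vec3 0 1 c) \<noteq> 0"
begin

section \<open>The immersion in affine coordinates\<close>

definition patch :: "3 \<Rightarrow> 'a set" where "patch i = \<rho> -` affine_chart_domain i"

definition rep :: "3 \<Rightarrow> 'a \<Rightarrow> complex^3" where "rep i y = affine_coords i (\<rho> y)"

definition xcoord :: "'a \<Rightarrow> complex" where "xcoord y = rep 0 y $ 2 - c * rep 0 y $ 1"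

definition wcoord :: "'a \<Rightarrow> complex" where "wcoord y = rep 0 y $ 1"

lemma patch_open: "open (patch i)"
  using imm by (auto simp: holomorphic_immersion_def patch_def)

lemma patch_cover: obtains i where "y \<in> patch i"
  using affine_chart_domain_cover[of "\<rho> y"] that by (auto simp: patch_def)

lemma rep_hcoords: "y \<in> patch i \<Longrightarrow> rep i y \<in> hcoords (\<rho> y)"
  and rep_nth: "y \<in> patch i \<Longrightarrow> rep i y $ i = 1"
  by (auto simp: patch_def rep_def affine_coords_hcoords affine_coords_nth)

lemma patch_iff: "y \<in> patch i \<Longrightarrow> y \<in> patch k \<longleftrightarrow> rep i y $ k \<noteq> 0"
  using affine_chart_domain_iff[OF rep_hcoords] by (simp add: patch_def)

lemma rep_change: "y \<in> patch i \<Longrightarrow> y \<in> patch k \<Longrightarrow> rep k y $ j = rep i y $ j / rep i y $ k"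
  unfolding rep_def patch_def by (rule affine_coords_change) auto

lemma \<rho>_curve: "\<rho> y \<in> curve P"
  using range_\<rho> by blast

lemma P_rep: "y \<in> patch i \<Longrightarrow> P (rep i y) = 0"
  using curve_iff[OF rep_hcoords] \<rho>_curve by simp

lemma rep_holo:
  assumes "(U, z) \<in> A"
  shows "(\<lambda>t. rep i (inv_into U z t) $ j) holomorphic_on z ` (U \<inter> patch i)"
  using imm assms unfolding holomorphic_immersion_def patch_def rep_def affine_rep_def
  by (auto simp: o_def)

lemma rep_immersive:
  assumes "(U, z) \<in> A" "y \<in> U" "y \<in> patch i"
  shows "\<exists>j. deriv (\<lambda>t. rep i (inv_into U z t) $ j) (z y) \<noteq> 0"
proof -
  have "affine_rep_deriv \<rho> (U, z) i (z y) \<noteq> 0"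
    using imm assms unfolding holomorphic_immersion_def patch_def by fast
  then show ?thesis
    by (auto simp: affine_rep_deriv_def affine_rep_def rep_def o_def vec_eq_iff)
qed

lemma rep_holo_at: "y \<in> patch i \<Longrightarrow> holo_at A (\<lambda>y. rep i y $ j) y"
proof -
  assume y: "y \<in> patch i"
  obtain U z where u: "(U, z) \<in> A" "y \<in> U" by (rule chart_at)
  show ?thesis
    by (rule holo_atI[OF u chart_nhd(1-3)[OF u patch_open y]]) (use rep_holo[OF u(1)] in \<open>simp add: o_def\<close>)
qed

section \<open>The exceptional points are discrete\<close>

lemma inv_chart_image:
  assumes "(U, z) \<in> A" "t \<in> z ` (U \<inter> V)"
  shows "inv_into U z t \<in> U" "inv_into U z t \<in> V" "z (inv_into U z t) = t"
  using assms by auto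

lemma chart_disc:
  assumes "(U, z) \<in> A" "y \<in> U" "open V" "y \<in> V"
  obtains R where "R > 0" "ball (z y) R \<subseteq> z ` (U \<inter> V)"
  using chart_nhd(1,2)[OF assms] that open_contains_ball by blast

lemma isolated_zero:
  assumes u: "(U, z) \<in> A" "y \<in> U" and R: "R > 0" "ball (z y) R \<subseteq> z ` U"
    and f: "f holomorphic_on ball (z y) R" "\<exists>t\<in>ball (z y) R. f t \<noteq> 0"
  obtains r where "0 < r" "r \<le> R" "\<And>t. t \<in> ball (z y) r - {z y} \<Longrightarrow> f t \<noteq> 0"
proof (cases "f (z y) = 0")
  case True
  obtain \<beta> where "\<beta> \<in> ball (z y) R" "f \<beta> \<noteq> 0" using f(2) by blast
  then obtain r where "0 < r" "ball (z y) r \<subseteq> ball (z y) R" "\<And>t. t \<in> ball (z y) r - {z y} \<Longrightarrow> f t \<noteq> 0"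
    using isolated_zeros[OF f(1) open_ball connected_ball _ True] R(1) by (metis centre_in_ball)
  then show ?thesis using that[of "min r R"] R(1) by auto
next
  case False
  have "isCont f (z y)"
    using holomorphic_on_imp_continuous_on[OF f(1)] R(1) by (simp add: continuous_on_eq_continuous_at)
  then obtain r where "r > 0" "\<And>t. dist (z y) t < r \<Longrightarrow> f t \<noteq> 0"
    using continuous_at_avoid[of "z y" f 0] False by blast
  then show ?thesis using that[of "min r R"] R(1) by auto
qed

lemma nhd_of_disc:
  assumes u: "(U, z) \<in> A" "y \<in> U" and R: "R > 0" "ball (z y) R \<subseteq> z ` U" and r: "0 < r" "r \<le> R"
  shows "open (inv_into U z ` ball (z y) r)" "y \<in> inv_into U z ` ball (z y) r"
    "\<And>x. x \<in> inv_into U z ` ball (z y) r - {y} \<Longrightarrow> x \<in> U \<and> z x \<in> ball (z y) r - {z y} \<and> inv_into U z (z x) = x"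
proof -
  have sub: "ball (z y) r \<subseteq> z ` U" using R r by force
  show "open (inv_into U z ` ball (z y) r)"
    by (rule inv_chart_image_open[OF u(1) open_ball sub])
  show "y \<in> inv_into U z ` ball (z y) r"
    by (rule image_eqI[of _ _ "z y"]) (use u r in auto)
  fix x assume "x \<in> inv_into U z ` ball (z y) r - {y}"
  then obtain t where "t \<in> ball (z y) r" "x = inv_into U z t" "x \<noteq> y" by blast
  then show "x \<in> U \<and> z x \<in> ball (z y) r - {z y} \<and> inv_into U z (z x) = x"
    using sub u by (auto simp: f_inv_into_f inv_into_into subset_iff)
qed

text \<open>A continuous function with finitely many values on a disc is constant. If this held for
  every coordinate, the derivative of the immersion would vanish.\<close>

lemma rep_not_finite:
  assumes u: "(U, z) \<in> A" "y \<in> U" and R: "R > 0" "ball (z y) R \<subseteq> z ` (U \<inter> patch i)"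
  shows "\<exists>j. infinite ((\<lambda>t. rep i (inv_into U z t) $ j) ` ball (z y) R)"
proof (rule ccontr)
  assume "\<not> ?thesis"
  then have fin: "finite ((\<lambda>t. rep i (inv_into U z t) $ j) ` ball (z y) R)" for j by blast
  have "z y \<in> z ` (U \<inter> patch i)" using R by auto
  then have y: "y \<in> patch i" using u chart_inj[OF u(1)] by (auto dest: inj_onD)
  have "deriv (\<lambda>t. rep i (inv_into U z t) $ j) (z y) = 0" for j
  proof -
    let ?f = "\<lambda>t. rep i (inv_into U z t) $ j"
    have hol: "?f holomorphic_on ball (z y) R"
      by (rule holomorphic_on_subset[OF rep_holo[OF u(1)] R(2)])
    have "?f constant_on ball (z y) R"
      by (rule continuous_finite_range_constant[OF connected_ball holomorphic_on_imp_continuous_on[OF hol] fin])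
    then obtain k where k: "\<And>t. t \<in> ball (z y) R \<Longrightarrow> ?f t = k" by (auto simp: constant_on_def)
    have "z y \<in> ball (z y) R" using R by simp
    from has_field_derivative_transform_within_open[where f = "\<lambda>_. k", OF DERIV_const open_ball this]
    have "(?f has_field_derivative 0) (at (z y))" using k by simp
    then show ?thesis by (rule DERIV_imp_deriv)
  qed
  then show False using rep_immersive[OF u y] by blast
qed

text \<open>A disc on which the coordinate 0 vanishes would be mapped into the finite set of points
  at infinity, contrary to \<open>rep_not_finite\<close>. So this holomorphic coordinate has
  isolated zeros.\<close>

lemma infinity_isolated:
  assumes u: "(U, z) \<in> A" "y \<in> U" and R: "R > 0" "ball (z y) R \<subseteq> z ` (U \<inter> patch i)"
  obtains r where "0 < r" "r \<le> R" "\<And>t. t \<in> ball (z y) r - {z y} \<Longrightarrow> rep i (inv_into U z t) $ 0 \<noteq> 0"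
proof -
  let ?f = "\<lambda>t. rep i (inv_into U z t) $ 0"
  have ex: "\<exists>t\<in>ball (z y) R. ?f t \<noteq> 0"
  proof (rule ccontr)
    assume "\<not> ?thesis"
    then have 0: "\<And>t. t \<in> ball (z y) R \<Longrightarrow> ?f t = 0" by blast
    have "rep i (inv_into U z t) \<in> affine_coords i ` (curve P \<inter> line_at_infinity)" if "t \<in> ball (z y) R" for t
    proof -
      have "inv_into U z t \<in> patch i"
        by (rule inv_chart_image(2)[OF u(1)]) (use that R(2) in blast)
      then have "\<rho> (inv_into U z t) \<in> curve P \<inter> line_at_infinity"
        using line_at_infinity_iff[OF rep_hcoords] 0[OF that] \<rho>_curve by simp
      then show ?thesis unfolding rep_def by blast
    qed
    then have "(\<lambda>t. rep i (inv_into U z t) $ j) ` ball (z y) R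
        \<subseteq> (\<lambda>v. v $ j) ` affine_coords i ` (curve P \<inter> line_at_infinity)" for j
      by blast
    then have "finite ((\<lambda>t. rep i (inv_into U z t) $ j) ` ball (z y) R)" for j
      using fin by (meson finite_imageI finite_subset)
    then show False using rep_not_finite[OF u R] by blast
  qed
  have hol: "?f holomorphic_on ball (z y) R"
    by (rule holomorphic_on_subset[OF rep_holo[OF u(1)] R(2)])
  have sub: "ball (z y) R \<subseteq> z ` U" using R(2) by blast
  obtain r where r: "0 < r" "r \<le> R" "\<And>t. t \<in> ball (z y) r - {z y} \<Longrightarrow> ?f t \<noteq> 0"
    by (rule isolated_zero[OF u R(1) sub hol ex]) blast
  show ?thesis by (rule that[OF r])
qed

text \<open>If nodes accumulate, the gradient of \<open>P\<close> vanishes along a disc, whose tangent vector is then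
  in the kernel of the Hessian.\<close>

lemma nodes_isolated:
  assumes u: "(U, z) \<in> A" "y \<in> U" and R: "R > 0" "ball (z y) R \<subseteq> z ` (U \<inter> patch i)"
  obtains r where "0 < r" "r \<le> R" "\<And>t. t \<in> ball (z y) r - {z y} \<Longrightarrow> \<rho> (inv_into U z t) \<notin> nodes P"
proof -
  let ?Z = "\<lambda>t. rep i (inv_into U z t)"
  let ?f = "\<lambda>k t. pd k P (?Z t)"
  have in_patch: "inv_into U z t \<in> patch i" if "t \<in> ball (z y) R" for t
    by (rule inv_chart_image(2)[OF u(1)]) (use that R(2) in blast)
  have holZ: "(\<lambda>t. ?Z t $ j) holomorphic_on ball (z y) R" for j
    by (rule holomorphic_on_subset[OF rep_holo[OF u(1)] R(2)])
  have hol: "?f k holomorphic_on ball (z y) R" for k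
    by (rule polyfun_compose_holomorphic[OF polyfun_pd[OF polyfun_P] holZ open_ball])
  have sing: "\<rho> (inv_into U z t) \<in> singular_points P \<longleftrightarrow> (\<forall>k. ?f k t = 0)" if "t \<in> ball (z y) R" for t
    using singular_iff[OF rep_hcoords[OF in_patch[OF that]] \<rho>_curve] .
  have "\<exists>k. \<exists>t\<in>ball (z y) R. ?f k t \<noteq> 0"
  proof (rule ccontr)
    assume "\<not> ?thesis"
    then have 0: "\<And>k t. t \<in> ball (z y) R \<Longrightarrow> ?f k t = 0" by blast
    have zy: "z y \<in> ball (z y) R" using R by simp
    have yd: "y \<in> patch i" using in_patch[OF zy] u by simp
    define D where "D = (\<chi> j. deriv (\<lambda>t. ?Z t $ j) (z y))"
    have dZ: "((\<lambda>t. ?Z t $ j) has_field_derivative D $ j) (at (z y))" for j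
      unfolding D_def using holomorphic_derivI[OF holZ open_ball zy] by simp
    have "(\<Sum>j\<in>UNIV. D $ j * pd j (pd k P) (rep i y)) = 0" for k
    proof -
      have "(?f k has_field_derivative (\<Sum>j\<in>UNIV. D $ j * pd j (pd k P) (?Z (z y)))) (at (z y))"
        by (rule polyfun_compose[OF polyfun_pd[OF polyfun_P] dZ])
      moreover have "(?f k has_field_derivative 0) (at (z y))"
        by (rule has_field_derivative_transform_within_open[where f = "\<lambda>_. 0", OF DERIV_const open_ball zy]) (simp add: 0)
      ultimately show ?thesis using DERIV_unique u by fastforce
    qed
    then have "hessian P (rep i y) D v = 0" for v
      by (simp add: hessian_polyfun[OF polyfun_P])
    moreover have "\<rho> y \<in> nodes P" using sing[OF zy] 0[OF zy] nodal u by auto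
    ultimately obtain k where k: "D = k *s rep i y"
      using rep_hcoords[OF yd] unfolding nodes_def by blast
    \<comment> \<open>The normalized coordinate \<open>i\<close> is constantly 1, so
      \<open>D $ i = 0\<close>. As \<open>rep i y $ i = 1\<close>, a multiple of
      \<open>rep i y\<close> with this property is zero, against the immersion property.\<close>
    have "((\<lambda>t. ?Z t $ i) has_field_derivative 0) (at (z y))"
      by (rule has_field_derivative_transform_within_open[where f = "\<lambda>_. 1", OF DERIV_const open_ball zy])
         (simp add: rep_nth in_patch)
    then have "D $ i = 0" using dZ DERIV_unique by blast
    then have "D = 0" using k rep_nth[OF yd] by simp
    then show False using rep_immersive[OF u yd] by (simp add: D_def vec_eq_iff)
  qed
  then obtain k where k: "\<exists>t\<in>ball (z y) R. ?f k t \<noteq> 0" by blast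
  have sub: "ball (z y) R \<subseteq> z ` U" using R(2) by blast
  obtain r where r: "0 < r" "r \<le> R" "\<And>t. t \<in> ball (z y) r - {z y} \<Longrightarrow> ?f k t \<noteq> 0"
    by (rule isolated_zero[OF u R(1) sub hol k]) blast
  have "\<rho> (inv_into U z t) \<notin> nodes P" if "t \<in> ball (z y) r - {z y}" for t
  proof -
    have "t \<in> ball (z y) R" using that r(2) by auto
    then show ?thesis using sing[of t] r(3)[OF that] by (auto simp: nodes_def)
  qed
  then show ?thesis by (rule that[OF r(1,2)])
qed


lemma rep0: "y \<in> patch 0 \<Longrightarrow> rep 0 y = vec3 1 (wcoord y) (xcoord y + c * wcoord y)"
  by (rule vec3_eqI) (simp_all add: rep_nth wcoord_def xcoord_def)

lemma xcoord_rep: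
  assumes "y \<in> patch 0" "y \<in> patch i"
  shows "xcoord y = (rep i y $ 2 - c * rep i y $ 1) / rep i y $ 0" "wcoord y = rep i y $ 1 / rep i y $ 0"
  using rep_change[OF assms(2,1)] by (simp_all add: xcoord_def wcoord_def diff_divide_distrib)

lemma holo_at_combine:
  assumes "holo_at A f y" "holo_at A g y"
  shows "holo_at A (\<lambda>x. a * f x + b * g x) y"
proof -
  obtain U z where u: "(U, z) \<in> A" "y \<in> U" by (rule chart_at)
  obtain W where W: "open W" "z y \<in> W" "W \<subseteq> z ` U" "(f \<circ> inv_into U z) holomorphic_on W"
    by (rule holo_atE[OF assms(1) u])
  obtain W' where W': "open W'" "z y \<in> W'" "W' \<subseteq> z ` U" "(g \<circ> inv_into U z) holomorphic_on W'"
    by (rule holo_atE[OF assms(2) u])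
  have "(\<lambda>t. a * (f \<circ> inv_into U z) t + b * (g \<circ> inv_into U z) t) holomorphic_on (W \<inter> W')"
    by (intro holomorphic_intros holomorphic_on_subset[OF W(4)] holomorphic_on_subset[OF W'(4)]) auto
  then have "((\<lambda>x. a * f x + b * g x) \<circ> inv_into U z) holomorphic_on (W \<inter> W')"
    by (simp add: o_def)
  then show ?thesis
    by (rule holo_atI[OF u, rotated -1]) (use W W' in auto)
qed

lemma xcoord_holo_at: "y \<in> patch 0 \<Longrightarrow> holo_at A xcoord y"
  using holo_at_combine[OF rep_holo_at rep_holo_at, of y 0 0 1 2 "- c" 1] by (simp add: xcoord_def[abs_def])

text \<open>Where \<open>xcoord\<close> is constant, the image lies on one line through the centre.
  By \<open>center_line\<close> this line meets the affine curve in finitely many points, while an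
  immersed disc takes infinitely many values.\<close>

lemma xcoord_not_locally_constant:
  assumes V: "open V" "y \<in> V" "V \<subseteq> patch 0"
  shows "\<exists>x\<in>V. xcoord x \<noteq> k"
proof (rule ccontr)
  assume "\<not> ?thesis"
  then have k: "\<And>x. x \<in> V \<Longrightarrow> xcoord x = k" by blast
  obtain U z where u: "(U, z) \<in> A" "y \<in> U" by (rule chart_at)
  obtain R where R: "R > 0" "ball (z y) R \<subseteq> z ` (U \<inter> V)"
    using chart_disc[OF u V(1,2)] by metis
  then have R': "ball (z y) R \<subseteq> z ` (U \<inter> patch 0)" using V(3) by blast
  have inV: "inv_into U z t \<in> V" if "t \<in> ball (z y) R" for t
    by (rule inv_chart_image(2)[OF u(1)]) (use that R(2) in blast)
  have rep_t: "rep 0 (inv_into U z t) = vec3 1 (wcoord (inv_into U z t)) (k + c * wcoord (inv_into U z t))"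
    if "t \<in> ball (z y) R" for t
    using rep0[of "inv_into U z t"] inV[OF that] V(3) k by auto
  let ?S = "(\<lambda>t. wcoord (inv_into U z t)) ` ball (z y) R"
  have "infinite ?S"
  proof
    assume fin: "finite ?S"
    have "finite ((\<lambda>t. rep 0 (inv_into U z t) $ j) ` ball (z y) R)" for j
    proof -
      have "(\<lambda>t. rep 0 (inv_into U z t) $ j) ` ball (z y) R = (\<lambda>w. vec3 1 w (k + c * w) $ j) ` ?S"
        unfolding image_image by (rule image_cong[OF refl]) (simp add: rep_t)
      then show ?thesis using fin by simp
    qed
    then show False using rep_not_finite[OF u R(1) R'] by blast
  qed
  moreover have "?S \<subseteq> {W. P (vec3 1 W (k + c * W)) = 0}"
  proof clarify
    fix t assume t: "t \<in> ball (z y) R"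
    then have "inv_into U z t \<in> patch 0" using inV V(3) by blast
    from P_rep[OF this] show "P (vec3 1 (wcoord (inv_into U z t)) (k + c * wcoord (inv_into U z t))) = 0"
      by (simp add: rep_t[OF t])
  qed
  ultimately show False using center_line[OF center] finite_subset by blast
qed

text \<open>Near such a point \<open>xcoord\<close> is a local coordinate, and the curve is
  nonsingular at its image, since all singular points are nodes.\<close>

definition good :: "'a \<Rightarrow> bool" where
  "good y \<longleftrightarrow> y \<in> patch 0 \<and> \<rho> y \<notin> nodes P \<and> (\<exists>(U, z)\<in>A. y \<in> U \<and> deriv (xcoord \<circ> inv_into U z) (z y) \<noteq> 0)"

text \<open>\<open>y\<close> may lie at infinity, where \<open>xcoord\<close> has no value. Hence
  \<open>xcoord\<close> is written as the quotient of \<open>L\<close> by the coordinate 0, and the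
  argument uses the numerator \<open>N\<close> of its derivative, which is holomorphic on the whole
  disc and not identically zero.\<close>

lemma good_nhd: "\<exists>V. open V \<and> y \<in> V \<and> (\<forall>x\<in>V - {y}. good x)"
proof -
  obtain i where i: "y \<in> patch i" by (rule patch_cover)
  obtain U z where u: "(U, z) \<in> A" "y \<in> U" by (rule chart_at)
  obtain R where R: "R > 0" "ball (z y) R \<subseteq> z ` (U \<inter> patch i)"
    using chart_disc[OF u patch_open i] by metis
  have sub: "ball (z y) R \<subseteq> z ` U" using R(2) by blast
  have in_patch: "inv_into U z t \<in> patch i" if "t \<in> ball (z y) R" for t
    by (rule inv_chart_image(2)[OF u(1)]) (use that R(2) in blast)
  let ?Z = "\<lambda>j t. rep i (inv_into U z t) $ j"
  define L where "L t = ?Z 2 t - c * ?Z 1 t" for t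
  define N where "N t = deriv L t * ?Z 0 t - L t * deriv (?Z 0) t" for t
  have holZ: "?Z j holomorphic_on ball (z y) R" for j
    by (rule holomorphic_on_subset[OF rep_holo[OF u(1)] R(2)])
  have holL: "L holomorphic_on ball (z y) R"
    unfolding L_def by (intro holomorphic_intros holZ)
  have holN: "N holomorphic_on ball (z y) R"
    unfolding N_def by (intro holomorphic_intros holZ holL holomorphic_deriv open_ball)
  obtain r1 where r1: "0 < r1" "r1 \<le> R" "\<And>t. t \<in> ball (z y) r1 - {z y} \<Longrightarrow> ?Z 0 t \<noteq> 0"
    by (rule infinity_isolated[OF u R]) blast
  obtain r2 where r2: "0 < r2" "r2 \<le> R" "\<And>t. t \<in> ball (z y) r2 - {z y} \<Longrightarrow> \<rho> (inv_into U z t) \<notin> nodes P"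
    by (rule nodes_isolated[OF u R]) blast
  have xft: "(xcoord \<circ> inv_into U z) t = L t / ?Z 0 t" if "t \<in> ball (z y) R" "?Z 0 t \<noteq> 0" for t
    using xcoord_rep(1)[of "inv_into U z t" i] in_patch[OF that(1)] that(2) patch_iff[of "inv_into U z t" i 0]
    by (simp add: L_def)
  have der: "((\<lambda>t. L t / ?Z 0 t) has_field_derivative N t / (?Z 0 t)\<^sup>2) (at t)"
    if "t \<in> ball (z y) R" "?Z 0 t \<noteq> 0" for t
    unfolding N_def power2_eq_square
    by (rule DERIV_divide[OF holomorphic_derivI[OF holL open_ball that(1)]
          holomorphic_derivI[OF holZ open_ball that(1)] that(2)])
  have exN: "\<exists>t\<in>ball (z y) R. N t \<noteq> 0"
  proof (rule ccontr)
    assume "\<not> ?thesis"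
    then have 0: "\<And>t. t \<in> ball (z y) R \<Longrightarrow> N t = 0" by blast
    \<comment> \<open>A disc inside the punctured disc, where the quotient is defined. Radius
      \<open>r1 / 4\<close> about a point at distance \<open>r1 / 2\<close> from \<open>z y\<close>
      avoids both the centre and the boundary.\<close>
    define t0 where "t0 = z y + of_real (r1 / 2)"
    let ?B = "ball t0 (r1 / 4)"
    have B: "t \<in> ball (z y) r1 - {z y}" if "t \<in> ?B" for t
    proof -
      have "dist t0 t < r1 / 4" using that by simp
      moreover have "dist (z y) t0 = r1 / 2" using r1(1) by (simp add: t0_def dist_norm)
      ultimately have "dist (z y) t < r1" "t \<noteq> z y"
        using dist_triangle[of "z y" t t0] r1(1) by (auto simp: dist_commute)
      then show ?thesis by simp
    qed
    have B': "t \<in> ball (z y) R" "?Z 0 t \<noteq> 0" if "t \<in> ?B" for t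
      using B[OF that] r1 by auto
    have "\<exists>k. \<forall>t\<in>?B. L t / ?Z 0 t = k"
    proof (rule has_field_derivative_zero_constant[OF convex_ball])
      fix t assume t: "t \<in> ?B"
      have "((\<lambda>t. L t / ?Z 0 t) has_field_derivative 0) (at t)"
        using der[OF B'[OF t]] 0[OF B'(1)[OF t]] by simp
      then show "((\<lambda>t. L t / ?Z 0 t) has_field_derivative 0) (at t within ?B)"
        by (rule has_field_derivative_at_within)
    qed
    then obtain k where k: "\<And>t. t \<in> ?B \<Longrightarrow> L t / ?Z 0 t = k" by blast
    let ?V = "inv_into U z ` ?B"
    have "open ?V" by (rule inv_chart_image_open[OF u(1)]) (use B' sub in auto)
    moreover have "inv_into U z t0 \<in> ?V" using r1(1) by auto
    moreover have "?V \<subseteq> patch 0" using B' in_patch patch_iff by blast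
    ultimately have "\<exists>x\<in>?V. xcoord x \<noteq> k" by (rule xcoord_not_locally_constant)
    then obtain t where t: "t \<in> ?B" "xcoord (inv_into U z t) \<noteq> k" by blast
    then show False using xft[OF B'[OF t(1)]] k[OF t(1)] by simp
  qed
  obtain r3 where r3: "0 < r3" "r3 \<le> R" "\<And>t. t \<in> ball (z y) r3 - {z y} \<Longrightarrow> N t \<noteq> 0"
    by (rule isolated_zero[OF u R(1) sub holN exN]) blast
  define r where "r = min r1 (min r2 r3)"
  have r: "0 < r" "r \<le> R" using r1 r2 r3 by (auto simp: r_def)
  note n = nhd_of_disc[OF u R(1) sub r]
  show ?thesis
  proof (intro exI conjI ballI)
    fix x assume "x \<in> inv_into U z ` ball (z y) r - {y}"
    from n(3)[OF this] have x: "x \<in> U" "z x \<in> ball (z y) r - {z y}" "inv_into U z (z x) = x" by auto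
    then have zx: "z x \<in> ball (z y) r1 - {z y}" "z x \<in> ball (z y) r2 - {z y}" "z x \<in> ball (z y) r3 - {z y}"
      "z x \<in> ball (z y) R" using r by (auto simp: r_def)
    have Z0: "?Z 0 (z x) \<noteq> 0" using r1(3)[OF zx(1)] .
    have "isCont (?Z 0) (z x)"
      using holomorphic_derivI[OF holZ open_ball zx(4)] DERIV_isCont by blast
    then obtain e where e: "e > 0" "\<And>t. dist (z x) t < e \<Longrightarrow> ?Z 0 t \<noteq> 0"
      using continuous_at_avoid[of "z x" "?Z 0" 0] Z0 by blast
    have "(xcoord \<circ> inv_into U z has_field_derivative N (z x) / (?Z 0 (z x))\<^sup>2) (at (z x))"
      by (rule has_field_derivative_transform_within_open[OF der[OF zx(4) Z0], of "ball (z x) e \<inter> ball (z y) R"])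
         (use e zx(4) xft in auto)
    then have "deriv (xcoord \<circ> inv_into U z) (z x) \<noteq> 0"
      using DERIV_imp_deriv r3(3)[OF zx(3)] Z0 by fastforce
    moreover have "x \<in> patch 0" using patch_iff[OF in_patch[OF zx(4)], of 0] Z0 x(3) by simp
    ultimately show "good x" using r2(3)[OF zx(2)] u x unfolding good_def by auto
  qed (use n in auto)
qed

section \<open>Compactness and the growth condition\<close>

lemma finite_subcover:
  fixes N :: "'a \<Rightarrow> 'a set"
  assumes "\<And>y. open (N y)" "\<And>y. y \<in> N y"
  obtains F where "finite F" "UNIV \<subseteq> (\<Union>y\<in>F. N y)"
proof -
  have "UNIV \<subseteq> (\<Union>y\<in>UNIV. N y)" using assms(2) by auto
  from compactE_image[OF cpt _ this] assms(1) obtain F where "finite F" "UNIV \<subseteq> (\<Union>y\<in>F. N y)"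
    by metis
  then show ?thesis by (rule that)
qed

lemma finite_bad: "finite {y. \<not> good y}"
proof -
  obtain V where V: "\<And>y. open (V y)" "\<And>y. y \<in> V y" "\<And>y x. x \<in> V y \<Longrightarrow> x \<noteq> y \<Longrightarrow> good x"
    using good_nhd by (metis Diff_iff singletonD)
  obtain F where F: "finite F" "UNIV \<subseteq> (\<Union>y\<in>F. V y)"
    by (rule finite_subcover[OF V(1,2)])
  then have "{y. \<not> good y} \<subseteq> F" using V(3) by blast
  then show ?thesis using F(1) by (rule finite_subset)
qed

text \<open>The estimate of the theorem near one point of the compact surface. The point may lie at
  infinity, where the estimate concerns only the affine points close to it.\<close>

definition growth_bounded :: "int \<Rightarrow> ('a \<Rightarrow> complex) \<Rightarrow> 'a \<Rightarrow> bool" where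
  "growth_bounded l g y \<longleftrightarrow> (\<exists>V C. open V \<and> y \<in> V \<and> (\<forall>x\<in>V \<inter> patch 0. \<forall>\<zeta>\<in>hcoords (\<rho> x).
     norm \<zeta> = 1 \<longrightarrow> norm (g x) \<le> C * norm (\<zeta> $ 0) powi (- l)))"

lemma norm_vector_smult: "norm (k *s v) = norm k * norm (v :: complex^3)"
  by (simp add: norm_vec_def L2_set_def norm_mult power_mult_distrib sum_distrib_left[symmetric] real_sqrt_mult)

lemma isCont_nhd:
  assumes "isCont f y" "open S" "f y \<in> S"
  obtains V where "open V" "y \<in> V" "\<And>x. x \<in> V \<Longrightarrow> f x \<in> S"
  using assms(1)[unfolded continuous_at_open, rule_format, of S] assms(2,3) that by auto

lemma isCont_rep: "y \<in> patch i \<Longrightarrow> isCont (rep i) y"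
  unfolding isCont_def
  by (rule vec_tendstoI, rule smooth_at_isCont[OF holo_at_imp_smooth_at[OF rep_holo_at], unfolded isCont_def])

text \<open>Passing from normalized coordinates to \<open>rep i\<close> divides
  \<open>\<zeta> $ 0\<close> by a factor of modulus \<open>1 / norm (rep i x)\<close>. The power
  \<open>norm (rep i x) powi l\<close> is continuous and positive at \<open>y\<close>, hence at
  least half its value nearby, so only the constant changes.\<close>

lemma growth_boundedI:
  assumes y: "y \<in> patch i" and V: "open V" "y \<in> V"
    and g: "\<And>x. x \<in> V \<Longrightarrow> x \<in> patch 0 \<Longrightarrow> x \<in> patch i \<Longrightarrow> norm (g x) * norm (rep i x $ 0) powi l \<le> C"
  shows "growth_bounded l g y"
proof -
  let ?h = "\<lambda>x. norm (rep i x) powi l"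
  have nz: "rep i x \<noteq> 0" if "x \<in> patch i" for x using hcoords_nonzero[OF rep_hcoords[OF that]] .
  have h0: "?h y > 0" using nz[OF y] by simp
  have ch: "isCont ?h y"
    by (intro continuous_intros isCont_rep[OF y]) (use nz[OF y] in auto)
  have "?h y \<in> {?h y / 2<..}" using h0 by simp
  from isCont_nhd[OF ch open_greaterThan this]
  obtain V' where V': "open V'" "y \<in> V'" "\<And>x. x \<in> V' \<Longrightarrow> ?h x \<in> {?h y / 2<..}"
    by blast
  show ?thesis unfolding growth_bounded_def
  proof (intro exI conjI ballI impI)
    show "open (V \<inter> V' \<inter> patch i)" using V V' patch_open by blast
    show "y \<in> V \<inter> V' \<inter> patch i" using V V' y by blast
    fix x \<zeta> assume x: "x \<in> (V \<inter> V' \<inter> patch i) \<inter> patch 0" and \<zeta>: "\<zeta> \<in> hcoords (\<rho> x)" "norm \<zeta> = 1"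
    obtain k where k: "k \<noteq> 0" "\<zeta> = k *s rep i x"
      using hcoords_proportional[OF rep_hcoords \<zeta>(1), of i] x by blast
    have n1: "norm k * norm (rep i x) = 1"
      using \<zeta>(2) k(2) norm_vector_smult by metis
    then have nk: "norm k = inverse (norm (rep i x))"
      using nz[of x] x by (simp add: field_simps)
    have r0: "norm (rep i x $ 0) > 0" using x patch_iff[of x i 0] by auto
    have w: "norm (\<zeta> $ 0) powi (- l) = ?h x * inverse (norm (rep i x $ 0) powi l)"
      by (simp add: k(2) norm_mult nk power_int_mult_distrib power_int_minus power_int_inverse)
    have 1: "1 \<le> ?h x * (2 / ?h y)" using V'(3)[of x] x h0 by (simp add: field_simps)
    have "norm (g x) = norm (g x) * norm (rep i x $ 0) powi l * inverse (norm (rep i x $ 0) powi l)"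
      using r0 by simp
    also have "\<dots> \<le> \<bar>C\<bar> * inverse (norm (rep i x $ 0) powi l)"
      using g[of x] x r0 by (intro mult_right_mono) auto
    also have "\<dots> \<le> \<bar>C\<bar> * inverse (norm (rep i x $ 0) powi l) * (?h x * (2 / ?h y))"
      using mult_left_mono[OF 1, of "\<bar>C\<bar> * inverse (norm (rep i x $ 0) powi l)"] by simp
    also have "\<dots> = (\<bar>C\<bar> * (2 / ?h y)) * norm (\<zeta> $ 0) powi (- l)"
      unfolding w by (simp add: mult_ac)
    finally show "norm (g x) \<le> (\<bar>C\<bar> * (2 / ?h y)) * norm (\<zeta> $ 0) powi (- l)" .
  qed
qed

lemma growth_bounded_isCont:
  assumes "y \<in> patch 0" "isCont g y" shows "growth_bounded l g y"
proof -
  have "g y \<in> ball 0 (norm (g y) + 1)" by simp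
  from isCont_nhd[OF assms(2) open_ball this]
  obtain V where V: "open V" "y \<in> V" "\<And>x. x \<in> V \<Longrightarrow> g x \<in> ball 0 (norm (g y) + 1)"
    by blast
  show ?thesis
    by (rule growth_boundedI[OF assms(1) V(1,2), where C = "norm (g y) + 1"]) (use V(3) in \<open>auto simp: rep_nth less_imp_le\<close>)
qed

lemma growth_bounded_zero: assumes "open V" "y \<in> V" "\<And>x. x \<in> V \<Longrightarrow> g x = 0" shows "growth_bounded l g y"
  unfolding growth_bounded_def by (intro exI[of _ V] exI[of _ 0]) (use assms in auto)

lemma growth_bounded_le: assumes "growth_bounded l g y" "\<And>x. norm (h x) \<le> norm (g x)" shows "growth_bounded l h y"
  using assms unfolding growth_bounded_def by (meson order_trans)

lemma growth_bounded_add: assumes "growth_bounded l g y" "growth_bounded l h y" shows "growth_bounded l (\<lambda>x. g x + h x) y"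
proof -
  obtain V C where V: "open V" "y \<in> V"
    "\<And>x \<zeta>. x \<in> V \<Longrightarrow> x \<in> patch 0 \<Longrightarrow> \<zeta> \<in> hcoords (\<rho> x) \<Longrightarrow> norm \<zeta> = 1 \<Longrightarrow> norm (g x) \<le> C * norm (\<zeta> $ 0) powi (- l)"
    using assms(1) unfolding growth_bounded_def by (metis IntI)
  obtain V' C' where V': "open V'" "y \<in> V'"
    "\<And>x \<zeta>. x \<in> V' \<Longrightarrow> x \<in> patch 0 \<Longrightarrow> \<zeta> \<in> hcoords (\<rho> x) \<Longrightarrow> norm \<zeta> = 1 \<Longrightarrow> norm (h x) \<le> C' * norm (\<zeta> $ 0) powi (- l)"
    using assms(2) unfolding growth_bounded_def by (metis IntI)
  show ?thesis unfolding growth_bounded_def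
  proof (intro exI conjI ballI impI)
    fix x \<zeta> assume x: "x \<in> (V \<inter> V') \<inter> patch 0" and \<zeta>: "\<zeta> \<in> hcoords (\<rho> x)" "norm \<zeta> = 1"
    show "norm (g x + h x) \<le> (C + C') * norm (\<zeta> $ 0) powi (- l)"
      using V(3)[OF _ _ \<zeta>] V'(3)[OF _ _ \<zeta>] x norm_triangle_ineq[of "g x" "h x"]
      by (simp add: distrib_right)
  qed (use V V' in auto)
qed

lemma growth_bounded_sum: "(\<And>i. i \<in> I \<Longrightarrow> growth_bounded l (g i) y) \<Longrightarrow> growth_bounded l (\<lambda>x. \<Sum>i\<in>I. g i x) y"
  by (induction I rule: infinite_finite_induct) (auto intro: growth_bounded_add growth_bounded_zero[of UNIV])

definition solvable :: "int \<Rightarrow> 'a form \<Rightarrow> bool" where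
  "solvable l \<phi> \<longleftrightarrow> (\<exists>g. (\<forall>x\<in>patch 0. smooth_at A g x) \<and> (\<forall>y. growth_bounded l g y) \<and>
     (\<forall>U z x. (U, z) \<in> A \<longrightarrow> x \<in> U \<longrightarrow> x \<in> patch 0 \<longrightarrow> dbar_form g (U, z) x = \<phi> (U, z) x))"

lemma solvable_add:
  assumes "solvable l \<phi>" "solvable l \<psi>" "\<And>U z x. (U, z) \<in> A \<Longrightarrow> x \<in> U \<Longrightarrow> x \<in> patch 0 \<Longrightarrow> \<theta> (U, z) x = \<phi> (U, z) x + \<psi> (U, z) x"
  shows "solvable l \<theta>"
proof -
  obtain g where g: "\<And>x. x \<in> patch 0 \<Longrightarrow> smooth_at A g x" "\<And>y. growth_bounded l g y"
    "\<And>U z x. (U, z) \<in> A \<Longrightarrow> x \<in> U \<Longrightarrow> x \<in> patch 0 \<Longrightarrow> dbar_form g (U, z) x = \<phi> (U, z) x"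
    using assms(1) unfolding solvable_def by metis
  obtain h where h: "\<And>x. x \<in> patch 0 \<Longrightarrow> smooth_at A h x" "\<And>y. growth_bounded l h y"
    "\<And>U z x. (U, z) \<in> A \<Longrightarrow> x \<in> U \<Longrightarrow> x \<in> patch 0 \<Longrightarrow> dbar_form h (U, z) x = \<psi> (U, z) x"
    using assms(2) unfolding solvable_def by metis
  show ?thesis unfolding solvable_def
  proof (intro exI[of _ "\<lambda>x. g x + h x"] conjI ballI allI impI)
    show "dbar_form (\<lambda>x. g x + h x) (U, z) x = \<theta> (U, z) x"
      if "(U, z) \<in> A" "x \<in> U" "x \<in> patch 0" for U z x
      using that by (simp add: dbar_form_add[OF g(1) h(1)] g(3) h(3) assms(3))
  qed (simp_all add: smooth_at_add growth_bounded_add g h)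
qed

section \<open>The interpolation kernel\<close>


definition eqc :: "nat \<Rightarrow> complex poly" where
  "eqc = (SOME q. \<forall>x W. P (vec3 1 W (x + c * W)) = (\<Sum>j\<le>d. poly (q j) x * W ^ j))"

lemma eqc: "P (vec3 1 W (x + c * W)) = (\<Sum>j\<le>d. poly (eqc j) x * W ^ j)"
proof -
  have "\<exists>q. \<forall>x W. P (vec3 1 W (x + c * W)) = (\<Sum>j\<le>d. poly (q j) x * W ^ j)"
    using affine_equation[of c] by metis
  from someI_ex[OF this] show ?thesis unfolding eqc_def by blast
qed

text \<open>The coefficient c_k of the overview; \<open>ker\<close> is Q there and the
  \<open>eqc j\<close> are the coefficients of p in powers of \<open>W\<close>. It collects the
  terms of \<open>W ^ k\<close> in the expansion of (W^j - w^j)/(W - w) as the sum of w^(j-1-k) W^k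
  over k < j.\<close>

definition ker_coeff :: "nat \<Rightarrow> complex \<Rightarrow> complex \<Rightarrow> complex" where
  "ker_coeff k x w = (\<Sum>j\<le>d. if k < j then poly (eqc j) x * w ^ (j - Suc k) else 0)"

definition ker :: "complex \<Rightarrow> complex \<Rightarrow> complex \<Rightarrow> complex" where
  "ker x w W = (\<Sum>k<d. ker_coeff k x w * W ^ k)"

lemma ker_mult: "(W - w) * ker x w W = P (vec3 1 W (x + c * W)) - P (vec3 1 w (x + c * w))"
proof -
  have 1: "(\<Sum>k<d. (if k < j then poly (eqc j) x * w ^ (j - Suc k) else 0) * W ^ k) =
      poly (eqc j) x * (\<Sum>k<j. w ^ (j - Suc k) * W ^ k)" if "j \<le> d" for j
  proof -
    have "(\<Sum>k<d. (if k < j then poly (eqc j) x * w ^ (j - Suc k) else 0) * W ^ k) =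
        (\<Sum>k<j. (if k < j then poly (eqc j) x * w ^ (j - Suc k) else 0) * W ^ k)"
      by (rule sum.mono_neutral_right) (use that in auto)
    also have "\<dots> = (\<Sum>k<j. poly (eqc j) x * (w ^ (j - Suc k) * W ^ k))"
      by (rule sum.cong) auto
    finally show ?thesis by (simp add: sum_distrib_left)
  qed
  have "ker x w W = (\<Sum>j\<le>d. \<Sum>k<d. (if k < j then poly (eqc j) x * w ^ (j - Suc k) else 0) * W ^ k)"
    unfolding ker_def ker_coeff_def sum_distrib_right by (rule sum.swap)
  also have "\<dots> = (\<Sum>j\<le>d. poly (eqc j) x * (\<Sum>k<j. w ^ (j - Suc k) * W ^ k))"
    by (rule sum.cong[OF refl]) (use 1 in auto)
  finally have "(W - w) * ker x w W = (\<Sum>j\<le>d. poly (eqc j) x * ((W - w) * (\<Sum>k<j. w ^ (j - Suc k) * W ^ k)))"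
    by (simp add: sum_distrib_left mult_ac)
  also have "\<dots> = (\<Sum>j\<le>d. poly (eqc j) x * (W ^ j - w ^ j))"
    by (simp add: power_diff_sumr2)
  finally show ?thesis by (simp add: eqc sum_subtractf right_diff_distrib)
qed

text \<open>By \<open>ker_mult\<close> the difference quotient equals \<open>ker x w W\<close> for
  \<open>W\<close> different from \<open>w\<close>, and \<open>ker\<close> is continuous in
  \<open>W\<close>.\<close>

lemma ker_diag: "((\<lambda>W. P (vec3 1 W (x + c * W))) has_field_derivative ker x w w) (at w)"
proof -
  have "isCont (ker x w) w" unfolding ker_def by (intro continuous_intros)
  then have "(ker x w \<longlongrightarrow> ker x w w) (at w)" by (simp add: isCont_def)
  then have "((\<lambda>W. (P (vec3 1 W (x + c * W)) - P (vec3 1 w (x + c * w))) / (W - w)) \<longlongrightarrow> ker x w w) (at w)"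
    by (rule Lim_transform_eventually)
       (simp add: eventually_at_filter ker_mult[symmetric])
  then show ?thesis by (simp add: has_field_derivative_iff)
qed

text \<open>Otherwise the gradient of \<open>P\<close> vanishes on the direction $(0,1,c)$ of the projection, on the
  tangent vector, which is transversal to it, and on \<open>rep 0 y\<close> itself by Euler's identity; so \<open>y\<close>
  lies over a singular point.\<close>

lemma ker_diag_nonzero:
  assumes "good y" shows "ker (xcoord y) (wcoord y) (wcoord y) \<noteq> 0"
proof
  assume 0: "ker (xcoord y) (wcoord y) (wcoord y) = 0"
  let ?\<zeta> = "rep 0 y"
  from assms obtain U z where y: "y \<in> patch 0" "\<rho> y \<notin> nodes P" and u: "(U, z) \<in> A" "y \<in> U"
    and dx: "deriv (xcoord \<circ> inv_into U z) (z y) \<noteq> 0" unfolding good_def by auto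
  have "\<forall>j. ((\<lambda>W. vec3 1 W (xcoord y + c * W) $ j) has_field_derivative vec3 0 1 c $ j) (at (wcoord y))"
    unfolding forall_index3 by (auto intro!: derivative_eq_intros)
  then have "((\<lambda>W. P (vec3 1 W (xcoord y + c * W))) has_field_derivative (\<Sum>j\<in>UNIV. vec3 0 1 c $ j * pd j P ?\<zeta>)) (at (wcoord y))"
    using polyfun_compose[OF polyfun_P, of "\<lambda>W. vec3 1 W (xcoord y + c * W)" "\<lambda>j. vec3 0 1 c $ j" "wcoord y"]
    by (simp add: rep0[OF y(1)])
  then have W: "pd 1 P ?\<zeta> + c * pd 2 P ?\<zeta> = 0"
    using DERIV_unique[OF ker_diag[of "xcoord y" "wcoord y"]] 0 by (fastforce simp: sum_index3)
  let ?Z = "\<lambda>j t. rep 0 (inv_into U z t) $ j"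
  note n = chart_nhd[OF u patch_open y(1)]
  define D where "D j = deriv (?Z j) (z y)" for j
  have dZ: "(?Z j has_field_derivative D j) (at (z y))" for j
    unfolding D_def by (rule holomorphic_derivI[OF rep_holo[OF u(1)] n(1,2)])
  have "(?Z 0 has_field_derivative 0) (at (z y))"
    by (rule has_field_derivative_transform_within_open[where f = "\<lambda>_. 1", OF DERIV_const n(1,2)])
       (use n(4) in \<open>simp add: rep_nth\<close>)
  then have D0: "D 0 = 0" using dZ DERIV_unique by blast
  have "((\<lambda>t. P (rep 0 (inv_into U z t))) has_field_derivative (\<Sum>j\<in>UNIV. D j * pd j P ?\<zeta>)) (at (z y))"
    using polyfun_compose[OF polyfun_P, of "\<lambda>t. rep 0 (inv_into U z t)" D "z y"] dZ u by simp
  moreover have "((\<lambda>t. P (rep 0 (inv_into U z t))) has_field_derivative 0) (at (z y))"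
    by (rule has_field_derivative_transform_within_open[where f = "\<lambda>_. 0", OF DERIV_const n(1,2)])
       (use n(4) in \<open>simp add: P_rep\<close>)
  ultimately have "D 1 * pd 1 P ?\<zeta> + D 2 * pd 2 P ?\<zeta> = 0"
    using DERIV_unique D0 by (fastforce simp: sum_index3)
  moreover have "D 2 - c * D 1 = deriv (xcoord \<circ> inv_into U z) (z y)"
  proof -
    have "((\<lambda>t. ?Z 2 t - c * ?Z 1 t) has_field_derivative D 2 - c * D 1) (at (z y))"
      by (intro DERIV_diff DERIV_cmult dZ)
    then show ?thesis by (simp add: DERIV_imp_deriv o_def xcoord_def)
  qed
  \<comment> \<open>By \<open>W\<close>, \<open>pd 1 P\<close> equals \<open>- c * pd 2 P\<close>
    here; substituting this into the tangent equation leaves one product, whose first factor is the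
    nonzero derivative of \<open>xcoord\<close>.\<close>
  ultimately have "(D 2 - c * D 1) * pd 2 P ?\<zeta> = 0 \<and> D 2 - c * D 1 \<noteq> 0"
    using W dx by (simp add: algebra_simps eq_neg_iff_add_eq_0[symmetric])
  then have 2: "pd 2 P ?\<zeta> = 0" using no_zero_divisors by blast
  then have 1: "pd 1 P ?\<zeta> = 0" using W by simp
  have "((\<lambda>s. P (s *s ?\<zeta>)) has_field_derivative (\<Sum>j\<in>UNIV. ?\<zeta> $ j * pd j P ?\<zeta>)) (at 1)"
  proof -
    have "((\<lambda>s. (s *s ?\<zeta>) $ j) has_field_derivative ?\<zeta> $ j) (at 1)" for j
      by (auto intro!: derivative_eq_intros)
    from polyfun_compose[OF polyfun_P this] show ?thesis by simp
  qed
  moreover have "((\<lambda>s. P (s *s ?\<zeta>)) has_field_derivative 0) (at 1)"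
    by (simp add: P_scale P_rep[OF y(1)])
  ultimately have "(\<Sum>j\<in>UNIV. ?\<zeta> $ j * pd j P ?\<zeta>) = 0" by (rule DERIV_unique)
  then have "pd 0 P ?\<zeta> = 0" using 1 2 rep_nth[OF y(1)] by (simp add: sum_index3)
  then have "\<rho> y \<in> singular_points P"
    using 1 2 singular_iff[OF rep_hcoords[OF y(1)] \<rho>_curve] by (simp add: forall_index3)
  then show False using nodal y(2) by blast
qed

text \<open>With \<open>r = norm (rep i x $ 0)\<close>, near \<open>y\<close> one has
  \<open>norm (xcoord x) > \<delta> / r\<close> and \<open>norm (wcoord x) < M / r\<close>; the
  first holds because \<open>?L y = 0\<close> would make \<open>\<rho> y\<close> the centre, which
  is off the curve. Each term is thus at most a constant times \<open>r * (1 / r) ^ (d - 1)\<close>.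
  For integers the hypothesis means \<open>l \<ge> d - 2\<close>, and \<open>r < 1\<close> then
  gives the bound.\<close>

lemma growth_bounded_kernel:
  assumes l: "l > int d - 3" and y: "y \<notin> patch 0"
    and u: "\<And>k s. norm (u k s) * (1 + norm s) \<le> K k"
  shows "growth_bounded l (\<lambda>x. \<Sum>k<d. u k (xcoord x) * wcoord x ^ k) y"
proof -
  obtain i where i: "y \<in> patch i" by (rule patch_cover)
  let ?L = "\<lambda>x. rep i x $ 2 - c * rep i x $ 1"
  have r0: "rep i y $ 0 = 0" using patch_iff[OF i, of 0] y by blast
  have Ly: "?L y \<noteq> 0"
  proof
    assume "?L y = 0"
    then have e: "rep i y = rep i y $ 1 *s vec3 0 1 c" by (intro vec3_eqI) (auto simp: r0 mult.commute)
    then have "P (rep i y $ 1 *s vec3 0 1 c) = 0" using P_rep[OF i] by simp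
    then have "rep i y $ 1 = 0" using center by (auto simp: P_scale)
    then have "rep i y = 0" using e by simp
    then show False using hcoords_nonzero[OF rep_hcoords[OF i]] by blast
  qed
  define \<delta> where "\<delta> = norm (?L y) / 2"
  define M where "M = norm (rep i y $ 1) + 1"
  have \<delta>: "\<delta> > 0" and M: "M \<ge> 1" using Ly by (auto simp: \<delta>_def M_def)
  have cont: "isCont (\<lambda>x. rep i x $ j) y" for j
    by (rule smooth_at_isCont[OF holo_at_imp_smooth_at[OF rep_holo_at[OF i]]])
  have c1: "isCont (\<lambda>x. norm (?L x)) y" and c2: "isCont (\<lambda>x. norm (rep i x $ 1)) y"
    and c3: "isCont (\<lambda>x. norm (rep i x $ 0)) y"
    by (intro continuous_intros cont)+
  have y1: "norm (?L y) \<in> {\<delta><..}" and y2: "norm (rep i y $ 1) \<in> {..<M}" and y3: "norm (rep i y $ 0) \<in> {..<1}"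
    using Ly by (auto simp: \<delta>_def M_def r0)
  from isCont_nhd[OF c1 open_greaterThan y1]
  obtain V1 where V1: "open V1" "y \<in> V1" "\<And>x. x \<in> V1 \<Longrightarrow> norm (?L x) \<in> {\<delta><..}"
    by blast
  from isCont_nhd[OF c2 open_lessThan y2]
  obtain V2 where V2: "open V2" "y \<in> V2" "\<And>x. x \<in> V2 \<Longrightarrow> norm (rep i x $ 1) \<in> {..<M}"
    by blast
  from isCont_nhd[OF c3 open_lessThan y3]
  obtain V3 where V3: "open V3" "y \<in> V3" "\<And>x. x \<in> V3 \<Longrightarrow> norm (rep i x $ 0) \<in> {..<1}"
    by blast
  have K: "K k \<ge> 0" for k
    by (rule order_trans[OF _ u[of k 0]]) simp
  show ?thesis
  proof (rule growth_boundedI[OF i, of "V1 \<inter> V2 \<inter> V3" _ _ "\<Sum>k<d. K k / \<delta> * M ^ (d - 1)"])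
    fix x assume x: "x \<in> V1 \<inter> V2 \<inter> V3" "x \<in> patch 0" "x \<in> patch i"
    define r where "r = norm (rep i x $ 0)"
    have r: "0 < r" "r < 1" using patch_iff[OF x(3), of 0] x V3(3) by (auto simp: r_def)
    have xr: "norm (xcoord x) > \<delta> / r"
      using V1(3)[of x] x r by (simp add: xcoord_rep(1)[OF x(2,3)] norm_divide r_def[symmetric] divide_strict_right_mono)
    have wr: "norm (wcoord x) < M / r"
      using V2(3)[of x] x r by (simp add: xcoord_rep(2)[OF x(2,3)] norm_divide r_def[symmetric] divide_strict_right_mono)
    have "norm (u k (xcoord x) * wcoord x ^ k) * r powi l \<le> K k / \<delta> * M ^ (d - 1)" if k: "k < d" for k
    proof -
      have "norm (u k (xcoord x)) * (\<delta> / r) \<le> norm (u k (xcoord x)) * (1 + norm (xcoord x))"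
        using xr by (intro mult_left_mono) auto
      also have "\<dots> \<le> K k" by (rule u)
      finally have 1: "norm (u k (xcoord x)) \<le> K k / \<delta> * r" using \<delta> r by (simp add: field_simps)
      have "norm (wcoord x) ^ k \<le> (M / r) ^ k" using wr by (intro power_mono) auto
      also have "\<dots> \<le> (M / r) ^ (d - 1)" using M r k by (intro power_increasing) (auto simp: divide_simps)
      finally have 2: "norm (wcoord x) ^ k \<le> (M / r) ^ (d - 1)" .
      have 3: "r powi l \<le> r powi (int d - 2)" using l r by (intro power_int_decreasing) auto
      have 4: "r * r powi (int d - 2) = r ^ (d - 1)"
      proof -
        have "r * r powi (int d - 2) = r powi (int d - 2 + 1)"
          using r by (subst power_int_add_1') auto
        \<comment> \<open>\<open>k < d\<close> forces \<open>d\<close> to be positive, so the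
          natural subtraction is exact.\<close>
        also have "int d - 2 + 1 = int (d - 1)" using k by simp
        finally show ?thesis by simp
      qed
      have "norm (u k (xcoord x) * wcoord x ^ k) * r powi l \<le> (K k / \<delta> * r) * (M / r) ^ (d - 1) * r powi (int d - 2)"
        unfolding norm_mult norm_power using 1 2 3 K[of k] \<delta> r M by (intro mult_mono) auto
      also have "\<dots> = K k / \<delta> * M ^ (d - 1) * (r * r powi (int d - 2)) / r ^ (d - 1)"
        by (simp add: power_divide mult_ac)
      also have "\<dots> = K k / \<delta> * M ^ (d - 1)" using r by (simp add: 4)
      finally show ?thesis .
    qed
    then have "(\<Sum>k<d. norm (u k (xcoord x) * wcoord x ^ k) * r powi l) \<le> (\<Sum>k<d. K k / \<delta> * M ^ (d - 1))"
      by (intro sum_mono) auto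
    moreover have "norm (\<Sum>k<d. u k (xcoord x) * wcoord x ^ k) * r powi l \<le> (\<Sum>k<d. norm (u k (xcoord x) * wcoord x ^ k) * r powi l)"
      unfolding sum_distrib_right[symmetric] using r by (intro mult_right_mono norm_sum) auto
    ultimately show "norm (\<Sum>k<d. u k (xcoord x) * wcoord x ^ k) * norm (rep i x $ 0) powi l \<le> (\<Sum>k<d. K k / \<delta> * M ^ (d - 1))"
      by (simp add: r_def)
  qed (use V1 V2 V3 in auto)
qed

section \<open>Solution for forms supported near a good point\<close>

lemma good_disc:
  assumes "good a"
  obtains U z r g where "(U, z) \<in> A" "a \<in> U" "r > 0" "ball (z a) r \<subseteq> z ` (U \<inter> patch 0)"
    "\<And>t. t \<in> ball (z a) r \<Longrightarrow> good (inv_into U z t)"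
    "inj_on (xcoord \<circ> inv_into U z) (ball (z a) r)"
    "open ((xcoord \<circ> inv_into U z) ` ball (z a) r)" "g holomorphic_on (xcoord \<circ> inv_into U z) ` ball (z a) r"
    "\<And>t. t \<in> ball (z a) r \<Longrightarrow> g ((xcoord \<circ> inv_into U z) t) = t"
    "\<And>t. t \<in> ball (z a) r \<Longrightarrow> deriv (xcoord \<circ> inv_into U z) t * deriv g ((xcoord \<circ> inv_into U z) t) = 1"
proof -
  from assms obtain U z where a: "a \<in> patch 0" and u: "(U, z) \<in> A" "a \<in> U"
    and dx: "deriv (xcoord \<circ> inv_into U z) (z a) \<noteq> 0" unfolding good_def by auto
  obtain V where V: "open V" "a \<in> V" "\<And>x. x \<in> V - {a} \<Longrightarrow> good x"
    using good_nhd[of a] by auto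
  have "open (V \<inter> patch 0)" "a \<in> V \<inter> patch 0" using V patch_open a by auto
  note n = chart_nhd[OF u this]
  let ?f = "xcoord \<circ> inv_into U z"
  have hol: "?f holomorphic_on z ` (U \<inter> patch 0)"
    unfolding o_def xcoord_def by (intro holomorphic_intros rep_holo u)
  have hol': "?f holomorphic_on z ` (U \<inter> (V \<inter> patch 0))"
    by (rule holomorphic_on_subset[OF hol]) blast
  obtain r where r: "r > 0" "ball (z a) r \<subseteq> z ` (U \<inter> (V \<inter> patch 0))" "inj_on ?f (ball (z a) r)"
    using has_complex_derivative_locally_injective[OF hol' n(2,1) dx] by blast
  have holb: "?f holomorphic_on ball (z a) r" by (rule holomorphic_on_subset[OF hol' r(2)])
  obtain g where g: "g holomorphic_on ?f ` ball (z a) r"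
    "\<And>t. t \<in> ball (z a) r \<Longrightarrow> deriv ?f t * deriv g (?f t) = 1"
    "\<And>t. t \<in> ball (z a) r \<Longrightarrow> g (?f t) = t"
    using holomorphic_has_inverse[OF holb open_ball r(3)] by blast
  show ?thesis
  proof (rule that[OF u r(1) _ _ r(3) open_mapping_thm3[OF holb open_ball r(3)] g(1) g(3,2)])
    show "ball (z a) r \<subseteq> z ` (U \<inter> patch 0)" using r(2) by blast
    show "good (inv_into U z t)" if "t \<in> ball (z a) r" for t
    proof -
      have "inv_into U z t \<in> V" using n(4)[of t] that r(2) by blast
      then show ?thesis using V(3) assms by (cases "inv_into U z t = a") auto
    qed
  qed
qed

text \<open>\<open>V\<close> is chosen before the form and the cutoff, because the induction over a
  finite cover changes the form at every step while the cover stays fixed.\<close>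

lemma good_solvable:
  assumes a: "good a" and l: "l > int d - 3"
  obtains V where "open V" "a \<in> V"
    "\<And>\<phi> \<eta> K. smooth_form01 A (patch 0) \<phi> \<Longrightarrow> (\<And>x. smooth_at A \<eta> x) \<Longrightarrow> closed K \<Longrightarrow> K \<subseteq> V \<Longrightarrow>
      (\<And>x. x \<notin> K \<Longrightarrow> \<eta> x = 0) \<Longrightarrow> solvable l (\<lambda>ch x. \<eta> x * \<phi> ch x)"
proof -
  obtain U z r g where u: "(U, z) \<in> A" "a \<in> U" and r: "r > 0" "ball (z a) r \<subseteq> z ` (U \<inter> patch 0)"
    and gd: "\<And>t. t \<in> ball (z a) r \<Longrightarrow> good (inv_into U z t)"
    and inj: "inj_on (xcoord \<circ> inv_into U z) (ball (z a) r)"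
    and S: "open ((xcoord \<circ> inv_into U z) ` ball (z a) r)" and g: "g holomorphic_on (xcoord \<circ> inv_into U z) ` ball (z a) r"
    "\<And>t. t \<in> ball (z a) r \<Longrightarrow> g ((xcoord \<circ> inv_into U z) t) = t"
    "\<And>t. t \<in> ball (z a) r \<Longrightarrow> deriv (xcoord \<circ> inv_into U z) t * deriv g ((xcoord \<circ> inv_into U z) t) = 1"
    using good_disc[OF a] by metis
  define S where "S = (xcoord \<circ> inv_into U z) ` ball (z a) r"
  define V where "V = inv_into U z ` ball (z a) r"
  have subU: "ball (z a) r \<subseteq> z ` U" using r(2) by blast
  have Vt: "x \<in> U" "x \<in> patch 0" "z x \<in> ball (z a) r" "inv_into U z (z x) = x" "good x" if xV: "x \<in> V" for x
  proof -
    obtain t where t: "t \<in> ball (z a) r" "x = inv_into U z t" using xV unfolding V_def by blast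
    have tz: "t \<in> z ` (U \<inter> patch 0)" using t(1) r(2) by blast
    note i = inv_chart_image[OF u(1) tz]
    show "x \<in> U" "x \<in> patch 0" "z x \<in> ball (z a) r" "inv_into U z (z x) = x" using i t by auto
    show "good x" using gd t by blast
  qed
  have xV: "xcoord x \<in> S" "g (xcoord x) = z x" "deriv (xcoord \<circ> inv_into U z) (z x) * deriv g (xcoord x) = 1" if "x \<in> V" for x
    using Vt[OF that] g(2)[of "z x"] g(3)[of "z x"] unfolding S_def by (auto intro!: image_eqI[of _ _ "z x"])
  have xinj: "x = y" if "x \<in> V" "y \<in> V" "xcoord x = xcoord y" for x y
    using xV(2)[OF that(1)] xV(2)[OF that(2)] that Vt(4) by metis
  have SV: "\<exists>x\<in>V. s = xcoord x" if "s \<in> S" for s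
    using that unfolding S_def V_def by auto
  have oS: "open S" using S by (simp add: S_def)
  have holg: "g holomorphic_on S" using g(1) by (simp add: S_def)
  have gS: "g ` S \<subseteq> ball (z a) r" using SV xV(2) Vt(3) by force
  have oV: "open V" unfolding V_def by (rule inv_chart_image_open[OF u(1) open_ball subU])
  have aV: "a \<in> V" unfolding V_def by (rule image_eqI[of _ _ "z a"]) (use u r in auto)
  define pt where "pt s = inv_into U z (g s)" for s
  have pt: "pt (xcoord x) = x" if "x \<in> V" for x using xV(2)[OF that] Vt(4)[OF that] by (simp add: pt_def)
  have wcoord_pt: "(\<lambda>s. wcoord (pt s)) holomorphic_on S"
  proof -
    have "(\<lambda>t. wcoord (inv_into U z t)) holomorphic_on ball (z a) r"
      unfolding wcoord_def by (rule holomorphic_on_subset[OF rep_holo[OF u(1)] r(2)])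
    from holomorphic_on_compose_gen[OF holg this gS] show ?thesis by (simp add: o_def pt_def)
  qed
  have hol_coeff: "(\<lambda>s. ker_coeff k s (wcoord (pt s))) holomorphic_on S" for k
  proof -
    have "(\<lambda>s. if k < j then poly (eqc j) s * wcoord (pt s) ^ (j - Suc k) else 0) holomorphic_on S" for j
      by (cases "k < j") (auto intro!: holomorphic_intros wcoord_pt)
    then show ?thesis unfolding ker_coeff_def by (intro holomorphic_on_sum)
  qed
  have hol_ker: "(\<lambda>s. ker s (wcoord (pt s)) (wcoord (pt s))) holomorphic_on S"
    unfolding ker_def by (intro holomorphic_intros hol_coeff wcoord_pt)
  have ker_nz: "ker s (wcoord (pt s)) (wcoord (pt s)) \<noteq> 0" if "s \<in> S" for s
    using SV[OF that] pt Vt(5) ker_diag_nonzero by metis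
  \<comment> \<open>Two points with the same \<open>xcoord\<close> and \<open>wcoord\<close> have
    the same image, which is not a node, and \<open>\<rho>\<close> is injective off the nodes. So
    distinct points over one \<open>xcoord\<close> differ in \<open>wcoord\<close>, and the factor
    \<open>wcoord y - wcoord x\<close> can be cancelled in \<open>ker_mult\<close>.\<close>
  have ker_0: "ker (xcoord x) (wcoord x) (wcoord y) = 0" if x: "x \<in> V" and y: "y \<in> patch 0" "xcoord y = xcoord x" "y \<noteq> x" for x y
  proof -
    have "wcoord y \<noteq> wcoord x"
    proof
      assume "wcoord y = wcoord x"
      then have "rep 0 y = rep 0 x" using rep0[OF y(1)] rep0[OF Vt(2)[OF x]] y(2) by simp
      then have "\<rho> y = \<rho> x"
        using rep_hcoords[OF y(1)] rep_hcoords[OF Vt(2)[OF x]] hcoords_disjoint by metis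
      moreover have "\<rho> x \<notin> nodes P" using Vt(5)[OF x] by (simp add: good_def)
      ultimately show False using inj_\<rho> y(3) by (auto dest: inj_onD)
    qed
    moreover have "(wcoord y - wcoord x) * ker (xcoord x) (wcoord x) (wcoord y) = 0"
      using ker_mult[of "wcoord y" "wcoord x" "xcoord x"] P_rep[OF y(1)] P_rep[OF Vt(2)[OF x]]
        rep0[OF y(1)] rep0[OF Vt(2)[OF x]] y(2) by simp
    ultimately show ?thesis by simp
  qed
  show ?thesis
  proof (rule that[OF oV aV])
    fix \<phi> \<eta> K
    assume \<phi>: "smooth_form01 A (patch 0) \<phi>" and \<eta>: "\<And>x. smooth_at A \<eta> x"
      and K: "closed K" "K \<subseteq> V" "\<And>x. x \<notin> K \<Longrightarrow> \<eta> x = 0"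
    \<comment> \<open>The coefficient, in the coordinate \<open>s = xcoord\<close>, of the cut-off
      form times \<open>ker_coeff k\<close> over the diagonal value of \<open>ker\<close>; the
      factor \<open>cnj (deriv g s)\<close> comes from the change of coordinate from
      \<open>z\<close> to \<open>s\<close>.\<close>
    define F where "F k s = (if s \<in> S then \<eta> (pt s) * \<phi> (U, z) (pt s) * cnj (deriv g s) *
       (ker_coeff k s (wcoord (pt s)) * inverse (ker s (wcoord (pt s)) (wcoord (pt s)))) else 0)" for k s
    have "compact K" using K(1) cpt by (metis compact_Int_closed inf_top_left)
    moreover have "continuous_on K xcoord"
      using smooth_at_isCont[OF holo_at_imp_smooth_at[OF xcoord_holo_at]] Vt(2) K(2)
      by (intro continuous_at_imp_continuous_on) blast
    ultimately have cL: "compact (xcoord ` K)" by (rule compact_continuous_image[rotated])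
    have F0: "F k s = 0" if "s \<notin> xcoord ` K" for k s
    proof (cases "s \<in> S")
      case True
      then obtain x where x: "x \<in> V" "s = xcoord x" using SV by blast
      then have "\<eta> (pt s) = 0" using that K(3) pt by auto
      then show ?thesis by (simp add: F_def)
    qed (simp add: F_def)
    have sF: "smooth_on UNIV (F k)" for k
    proof (rule smooth_on_local)
      fix s
      show "\<exists>W. open W \<and> s \<in> W \<and> smooth_on W (F k)"
      proof (cases "s \<in> xcoord ` K")
        case False
        have "open (- (xcoord ` K))" using cL compact_imp_closed by blast
        moreover from this have "smooth_on (- (xcoord ` K)) (F k)"
          by (rule smooth_on_cong[OF _ smooth_on_const[of _ 0]]) (simp add: F0)
        ultimately show ?thesis using False by blast
      next
        case True
        then have "s \<in> S" using K(2) xV(1) by blast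
        moreover have "smooth_on S (F k)"
        proof -
          have o: "open (z ` (patch 0 \<inter> U))" using chart_image_open[OF u(1) patch_open] by (simp add: Int_commute)
          have gS': "g ` S \<subseteq> z ` (patch 0 \<inter> U)" using gS r(2) by (auto simp: Int_commute)
          have 1: "smooth_on (z ` (patch 0 \<inter> U)) (\<eta> \<circ> inv_into U z)"
            using smooth_functionI[of "patch 0" \<eta>, OF \<eta>] u(1) unfolding smooth_function_def by fast
          have 2: "smooth_on S (\<lambda>s. (\<eta> \<circ> inv_into U z) (g s))"
            by (rule smooth_on_compose_holomorphic[OF 1 o oS holg gS'])
          have 3: "smooth_on S (\<lambda>s. (\<phi> (U, z) \<circ> inv_into U z) (g s))"
            by (rule smooth_on_compose_holomorphic[OF smooth_formD(1)[OF \<phi> u(1)] o oS holg gS'])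
          have 4: "smooth_on S (\<lambda>s. cnj (deriv g s))"
            by (intro smooth_on_cnj smooth_on_holomorphic oS holomorphic_deriv holg)
          have 5: "smooth_on S (\<lambda>s. ker_coeff k s (wcoord (pt s)) * inverse (ker s (wcoord (pt s)) (wcoord (pt s))))"
            by (intro smooth_on_mult smooth_on_inverse smooth_on_holomorphic oS hol_coeff hol_ker ker_nz)
          have "smooth_on S (\<lambda>s. (\<eta> \<circ> inv_into U z) (g s) * (\<phi> (U, z) \<circ> inv_into U z) (g s) * cnj (deriv g s) *
             (ker_coeff k s (wcoord (pt s)) * inverse (ker s (wcoord (pt s)) (wcoord (pt s)))))"
            by (intro smooth_on_mult oS 2 3 4 5)
          then show ?thesis
            by (rule smooth_on_cong[OF oS]) (simp add: F_def pt_def)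
        qed
        ultimately show ?thesis using oS by blast
      qed
    qed
    obtain M where M: "\<And>s. s \<in> xcoord ` K \<Longrightarrow> norm s < M"
      using compact_imp_bounded[OF cL] by (metis bounded_pos_less)
    then have FM: "F k s = 0" if "norm s \<ge> M" for k s using F0 that by fastforce
    have "\<exists>u C. smooth_on UNIV u \<and> (\<forall>t. dzbar u t = F k t) \<and> (\<forall>t. norm (u t) * (1 + norm t) \<le> C)" for k
      by (rule compact_support_dbar[OF sF FM]) blast+
    then obtain v C where v: "\<And>k. smooth_on UNIV (v k)" "\<And>k t. dzbar (v k) t = F k t"
      "\<And>k t. norm (v k t) * (1 + norm t) \<le> C k" by metis
    define G where "G y = (\<Sum>k<d. v k (xcoord y) * wcoord y ^ k)" for y
    have s1: "smooth_at A (\<lambda>y. v k (xcoord y)) y" if "y \<in> patch 0" for k y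
      by (rule smooth_at_compose[OF xcoord_holo_at[OF that] open_UNIV UNIV_I v(1)])
    have hw: "holo_at A (\<lambda>y. wcoord y ^ k) y" if y: "y \<in> patch 0" for k y
    proof -
      obtain U z where u: "(U, z) \<in> A" "y \<in> U" by (rule chart_at)
      show ?thesis
        by (rule holo_atI[OF u chart_nhd(1-3)[OF u patch_open y]])
           (use rep_holo[OF u(1), of 0 1] in \<open>auto simp: o_def wcoord_def intro!: holomorphic_intros\<close>)
    qed
    have s2: "smooth_at A (\<lambda>y. v k (xcoord y) * wcoord y ^ k) y" if "y \<in> patch 0" for k y
      by (rule smooth_at_mult[OF s1[OF that] holo_at_imp_smooth_at[OF hw[OF that]]])
    have sG: "smooth_at A G y" if "y \<in> patch 0" for y
      unfolding G_def by (rule smooth_at_sum) (rule s2[OF that])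
    have "dbar_form G (U', z') y = \<eta> y * \<phi> (U', z') y" if c': "(U', z') \<in> A" "y \<in> U'" and y: "y \<in> patch 0" for U' z' y
    proof -
      let ?s = "xcoord y" and ?D = "cnj (deriv (xcoord \<circ> inv_into U' z') (z' y))"
      have "dbar_form G (U', z') y = (\<Sum>k<d. dbar_form (\<lambda>y. v k (xcoord y) * wcoord y ^ k) (U', z') y)"
        unfolding G_def by (rule dbar_form_sum[OF s2[OF y] c'])
      also have "\<dots> = (\<Sum>k<d. F k ?s * ?D * wcoord y ^ k)"
      proof (rule sum.cong[OF refl])
        fix k
        have "dbar_form (\<lambda>y. v k (xcoord y)) (U', z') y = dzbar (v k) ?s * ?D"
          by (rule dbar_form_compose[OF xcoord_holo_at[OF y] _ c'])
             (rule smooth_imp_differentiable[OF v(1) open_UNIV UNIV_I])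
        then show "dbar_form (\<lambda>y. v k (xcoord y) * wcoord y ^ k) (U', z') y = F k ?s * ?D * wcoord y ^ k"
          by (simp add: dbar_form_mult[OF s1[OF y] holo_at_imp_smooth_at[OF hw[OF y]] c']
              dbar_form_holo_at[OF hw[OF y] c'] v(2))
      qed
      also have "\<dots> = \<eta> y * \<phi> (U', z') y"
      proof (cases "?s \<in> S")
        case False
        then have "y \<notin> K" using K(2) xV(1) by blast
        then show ?thesis using False K(3) by (simp add: F_def)
      next
        case True
        then obtain x where x: "x \<in> V" "?s = xcoord x" using SV by blast
        define E where "E = \<eta> x * \<phi> (U, z) x * cnj (deriv g ?s) * inverse (ker ?s (wcoord x) (wcoord x)) * ?D"
        have Fk: "F k ?s * ?D * wcoord y ^ k = E * (ker_coeff k ?s (wcoord x) * wcoord y ^ k)" for k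
          using True x pt[OF x(1)] by (simp add: F_def E_def mult_ac)
        have e: "(\<Sum>k<d. F k ?s * ?D * wcoord y ^ k) = E * ker ?s (wcoord x) (wcoord y)"
          unfolding ker_def sum_distrib_left Fk ..
        show ?thesis
        proof (cases "y = x")
          case True
          then have yU: "y \<in> U" and yV: "y \<in> V" using x Vt by auto
          have nz: "ker ?s (wcoord y) (wcoord y) \<noteq> 0" using ker_diag_nonzero Vt(5)[OF yV] by blast
          have "deriv (xcoord \<circ> inv_into U' z') (z' y) =
              deriv (xcoord \<circ> inv_into U z) (z y) * deriv (z \<circ> inv_into U' z') (z' y)"
          proof -
            have 1: "(z \<circ> inv_into U' z' has_field_derivative deriv (z \<circ> inv_into U' z') (z' y)) (at (z' y))"
              by (rule holo_at_differentiable[OF holo_at_chart[OF u(1) yU] c'])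
            have 2: "(xcoord \<circ> inv_into U z has_field_derivative deriv (xcoord \<circ> inv_into U z) (z y)) (at ((z \<circ> inv_into U' z') (z' y)))"
              using holo_at_differentiable[OF xcoord_holo_at[OF y] u(1) yU] c' by simp
            have 3: "((xcoord \<circ> inv_into U z) \<circ> (z \<circ> inv_into U' z') has_field_derivative
                deriv (xcoord \<circ> inv_into U z) (z y) * deriv (z \<circ> inv_into U' z') (z' y)) (at (z' y))"
              by (rule DERIV_chain[OF 2 1])
            have n: "open (z' ` (U' \<inter> U))" "z' y \<in> z' ` (U' \<inter> U)"
              using chart_nhd[OF c' chart_open[OF u(1)] yU] by auto
            have "(xcoord \<circ> inv_into U' z' has_field_derivative
                deriv (xcoord \<circ> inv_into U z) (z y) * deriv (z \<circ> inv_into U' z') (z' y)) (at (z' y))"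
              by (rule has_field_derivative_transform_within_open[OF 3 n]) (use u(1) c' in auto)
            then show ?thesis by (rule DERIV_imp_deriv)
          qed
          \<comment> \<open>\<open>g\<close> inverts \<open>xcoord\<close> in the chart
            \<open>(U, z)\<close>, so the two derivatives of \<open>xcoord\<close> and
            \<open>g\<close> cancel and only the transition from \<open>z'\<close> to
            \<open>z\<close> remains, as in the transformation law of \<open>\<phi>\<close>.\<close>
          then have D: "?D * cnj (deriv g ?s) = cnj (deriv (z \<circ> inv_into U' z') (z' y))"
            using xV(3)[OF yV] by (simp add: complex_cnj_mult[symmetric] mult_ac del: complex_cnj_mult)
          have "E * ker ?s (wcoord x) (wcoord y) = \<eta> y * \<phi> (U, z) y * (?D * cnj (deriv g ?s))"
            using nz True by (simp add: E_def)
          also have "\<dots> = \<eta> y * \<phi> (U', z') y"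
            using smooth_formD(2)[OF \<phi> c'(1) u(1) y c'(2) yU] by (simp add: D)
          finally show ?thesis by (simp add: e)
        next
          case False
          have "y \<notin> K"
          proof
            assume "y \<in> K"
            then have "y \<in> V" using K(2) by blast
            then show False using xinj x False by blast
          qed
          then show ?thesis using K(3) e x ker_0[OF x(1) y x(2) False] by simp
        qed
      qed
      finally show ?thesis .
    qed
    moreover have "growth_bounded l G y" for y
      unfolding G_def
    proof (cases "y \<in> patch 0")
      case True
      then show "growth_bounded l (\<lambda>y. \<Sum>k<d. v k (xcoord y) * wcoord y ^ k) y"
        using growth_bounded_isCont[OF True smooth_at_isCont[OF sG[OF True]]] by (simp add: G_def[abs_def])
    next
      case False
      then show "growth_bounded l (\<lambda>y. \<Sum>k<d. v k (xcoord y) * wcoord y ^ k) y" by (rule growth_bounded_kernel[OF l _ v(3)])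
    qed
    ultimately show "solvable l (\<lambda>ch x. \<eta> x * \<phi> ch x)" unfolding solvable_def using sG by blast
  qed
qed

end

section \<open>Local solutions\<close>

lemma (in riemann_surface) dbar_form_chart:
  assumes c: "(U, z) \<in> A" "x \<in> U" and F: "F differentiable (at (z x))"
  shows "dbar_form (\<lambda>y. F (z y)) (U, z) x = dzbar F (z x)"
proof -
  have "(z \<circ> inv_into U z has_field_derivative 1) (at (z x))"
    by (rule has_field_derivative_transform_within_open[where f = "\<lambda>t. t", OF DERIV_ident chart_open_image[OF c(1)]])
       (use c in auto)
  then have "deriv (z \<circ> inv_into U z) (z x) = 1" by (rule DERIV_imp_deriv)
  then show ?thesis using dbar_form_compose[OF holo_at_chart[OF c] F c] by simp
qed

lemma (in riemann_surface) dbar_eq_chart: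
  assumes \<phi>: "smooth_form01 A S \<phi>" and x: "x \<in> S" and h: "smooth_at A h x"
    and c: "(U, z) \<in> A" "x \<in> U" and eq: "dbar_form h (U, z) x = \<phi> (U, z) x"
    and c': "(V, w) \<in> A" "x \<in> V"
  shows "dbar_form h (V, w) x = \<phi> (V, w) x"
  using dbar_form_transition[OF h c c'] smooth_formD(2)[OF \<phi> c'(1) c(1) x c'(2) c(2)] eq by simp

definition (in riemann_surface) cutoff :: "'a set \<Rightarrow> 'a \<Rightarrow> ('a \<Rightarrow> complex) \<Rightarrow> 'a set \<Rightarrow> 'a set \<Rightarrow> bool" where
  "cutoff V b \<eta> V' K \<longleftrightarrow> (\<forall>x. smooth_at A \<eta> x) \<and> open V' \<and> b \<in> V' \<and> closed K \<and> K \<subseteq> V \<and>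
     (\<forall>x\<in>V'. \<eta> x = 1) \<and> (\<forall>x. x \<notin> K \<longrightarrow> \<eta> x = 0) \<and> (\<forall>x. norm (\<eta> x) \<le> 1)"

lemma (in riemann_surface) cutoff_exists:
  assumes "open V" "b \<in> V" shows "\<exists>\<eta> V' K. cutoff V b \<eta> V' K"
  by (rule surface_bump[OF assms]) (unfold cutoff_def, blast)

lemma (in riemann_surface) cutoffD:
  assumes "cutoff V b \<eta> V' K"
  shows "smooth_at A \<eta> x" "open V'" "b \<in> V'" "closed K" "K \<subseteq> V" "x \<in> V' \<Longrightarrow> \<eta> x = 1" "x \<notin> K \<Longrightarrow> \<eta> x = 0"
    "norm (\<eta> x) \<le> 1"
  using assms by (simp_all add: cutoff_def)

context plane_curve begin

definition local_solution :: "int \<Rightarrow> 'a form \<Rightarrow> 'a \<Rightarrow> 'a set \<Rightarrow> ('a \<Rightarrow> complex) \<Rightarrow> bool" where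
  "local_solution l \<phi> b V h \<longleftrightarrow> open V \<and> b \<in> V \<and> (\<forall>x\<in>V \<inter> patch 0. smooth_at A h x) \<and> (\<forall>y\<in>V. growth_bounded l h y) \<and>
     (\<forall>U z x. (U, z) \<in> A \<longrightarrow> x \<in> U \<longrightarrow> x \<in> V \<longrightarrow> x \<in> patch 0 \<longrightarrow> dbar_form h (U, z) x = \<phi> (U, z) x)"

text \<open>Cut off in a chart, the form has compact support in the plane and
  \<open>compact_support_dbar\<close> applies. The solution is valid where the cutoff is 1, and
  growth is automatic at points off infinity, where the solution is continuous.\<close>

lemma local_solution_interior:
  assumes \<phi>: "smooth_form01 A (patch 0) \<phi>" and b: "b \<in> patch 0"
  shows "\<exists>V h. local_solution l \<phi> b V h"
proof -
  obtain U z where u: "(U, z) \<in> A" "b \<in> U" by (rule chart_at)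
  obtain R where R: "R > 0" "ball (z b) R \<subseteq> z ` (U \<inter> patch 0)"
    using chart_disc[OF u patch_open b] by metis
  have sub: "ball (z b) R \<subseteq> z ` U" using R(2) by blast
  define e where "e = R / 4"
  have e: "e > 0" "2 * e < R" "e \<le> R" using R(1) by (auto simp: e_def)
  obtain \<beta> where \<beta>: "smooth_on UNIV \<beta>" "\<And>t. dist t (z b) \<le> e \<Longrightarrow> \<beta> t = 1"
    "\<And>t. dist t (z b) \<ge> 2 * e \<Longrightarrow> \<beta> t = 0" "\<And>t. norm (\<beta> t) \<le> 1"
    by (rule bump_at[OF e(1), of "z b"]) blast
  define f where "f t = (if t \<in> ball (z b) R then \<beta> t * (\<phi> (U, z) \<circ> inv_into U z) t else 0)" for t
  have f0: "f t = 0" if "dist t (z b) \<ge> 2 * e" for t using \<beta>(3)[OF that] by (simp add: f_def)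
  have sf: "smooth_on UNIV f"
  proof (rule smooth_on_local)
    fix t
    show "\<exists>W. open W \<and> t \<in> W \<and> smooth_on W f"
    proof (cases "dist t (z b) < R")
      case True
      have "smooth_on (ball (z b) R) (\<lambda>t. \<beta> t * (\<phi> (U, z) \<circ> inv_into U z) t)"
        by (intro smooth_on_mult smooth_on_subset[OF \<beta>(1)] smooth_on_subset[OF smooth_formD(1)[OF \<phi> u(1)]])
           (use R(2) in \<open>auto simp: Int_commute\<close>)
      then have "smooth_on (ball (z b) R) f" by (rule smooth_on_cong[rotated]) (auto simp: f_def)
      then show ?thesis using True by (intro exI[of _ "ball (z b) R"]) (auto simp: dist_commute)
    next
      case False
      have o: "open {t. dist t (z b) > 2 * e}" by (intro open_Collect_less continuous_intros)
      have "smooth_on {t. dist t (z b) > 2 * e} f"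
        by (rule smooth_on_cong[OF o smooth_on_const[of _ 0]]) (simp add: f0)
      then show ?thesis using False o e by (intro exI[of _ "{t. dist t (z b) > 2 * e}"]) auto
    qed
  qed
  have fM: "f t = 0" if "norm t \<ge> norm (z b) + 2 * e" for t
    by (rule f0) (use that norm_triangle_ineq2[of t "z b"] in \<open>auto simp: dist_norm\<close>)
  obtain v C where v: "smooth_on UNIV v" "\<And>t. dzbar v t = f t" "\<And>t. norm (v t) * (1 + norm t) \<le> C"
    using compact_support_dbar[OF sf fM] by metis
  define V where "V = inv_into U z ` ball (z b) e"
  have Vt: "x \<in> U" "x \<in> patch 0" "z x \<in> ball (z b) e" if xV: "x \<in> V" for x
  proof -
    obtain t where t: "t \<in> ball (z b) e" "x = inv_into U z t" using xV unfolding V_def by blast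
    then have "t \<in> z ` (U \<inter> patch 0)" using R(2) e(3) by auto
    then show "x \<in> U" "x \<in> patch 0" "z x \<in> ball (z b) e" using inv_chart_image[OF u(1)] t by auto
  qed
  have sm: "smooth_at A (\<lambda>y. v (z y)) x" if "x \<in> V" for x
    by (rule smooth_at_compose[OF holo_at_chart[OF u(1) Vt(1)[OF that]] open_UNIV UNIV_I v(1)])
  have "local_solution l \<phi> b V (\<lambda>y. v (z y))"
    unfolding local_solution_def
  proof (intro conjI ballI allI impI)
    show "open V" "b \<in> V" unfolding V_def using nhd_of_disc[OF u R(1) sub e(1,3)] by auto
    show "smooth_at A (\<lambda>y. v (z y)) x" if "x \<in> V \<inter> patch 0" for x using sm that by blast
    show "growth_bounded l (\<lambda>y. v (z y)) y" if "y \<in> V" for y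
      by (rule growth_bounded_isCont[OF Vt(2)[OF that] smooth_at_isCont[OF sm[OF that]]])
    fix U' z' x assume c': "(U', z') \<in> A" "x \<in> U'" and x: "x \<in> V" "x \<in> patch 0"
    note xU = Vt(1)[OF x(1)]
    have "dbar_form (\<lambda>y. v (z y)) (U, z) x = f (z x)"
      using dbar_form_chart[OF u(1) xU smooth_imp_differentiable[OF v(1) open_UNIV UNIV_I]] v(2) by simp
    also have "\<dots> = \<phi> (U, z) x"
      using Vt(3)[OF x(1)] \<beta>(2)[of "z x"] e xU u(1) by (simp add: f_def dist_commute)
    finally show "dbar_form (\<lambda>y. v (z y)) (U', z') x = \<phi> (U', z') x"
      by (rule dbar_eq_chart[OF \<phi> x(2) sm[OF x(1)] u(1) xU _ c'])
  qed
  then show ?thesis by blast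
qed

text \<open>If \<open>F\<close> is a bounded solution for the continuous data \<open>\<psi>\<close>,
  then \<open>F\<close> times the coordinate 0 to the power \<open>- l\<close> solves the equation
  for \<open>\<phi>\<close>: this power is holomorphic off \<open>b\<close>. Boundedness of
  \<open>F\<close> is exactly the growth condition.\<close>

lemma local_solution_infinity:
  assumes \<phi>: "smooth_form01 A (patch 0) \<phi>" and b: "b \<notin> patch 0" "b \<in> patch i"
    and u: "(U, z) \<in> A" "b \<in> U" and R: "R > 0" "ball (z b) R \<subseteq> z ` (U \<inter> patch i)"
    and \<psi>: "continuous_on (ball (z b) R) \<psi>"
    and patch0: "\<And>t. t \<in> ball (z b) R - {z b} \<Longrightarrow> inv_into U z t \<in> patch 0"
    and \<psi>\<phi>: "\<And>t. t \<in> ball (z b) R - {z b} \<Longrightarrow> \<psi> t = (rep i (inv_into U z t) $ 0) powi l * \<phi> (U, z) (inv_into U z t)"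
  shows "\<exists>V h. local_solution l \<phi> b V h"
proof -
  have sub: "ball (z b) R \<subseteq> z ` U" using R(2) by blast
  define e where "e = R / 4"
  have e: "e > 0" "2 * e < R" "e \<le> R" using R(1) by (auto simp: e_def)
  obtain \<beta> where \<beta>: "smooth_on UNIV \<beta>" "\<And>t. dist t (z b) \<le> e \<Longrightarrow> \<beta> t = 1"
    "\<And>t. dist t (z b) \<ge> 2 * e \<Longrightarrow> \<beta> t = 0" "\<And>t. norm (\<beta> t) \<le> 1"
    by (rule bump_at[OF e(1), of "z b"]) blast
  let ?k = "\<psi> (z b)"
  \<comment> \<open>\<open>puncture_dbar\<close> requires data vanishing at the puncture, hence the
    subtraction of the value \<open>?k\<close>.\<close>
  define f where "f t = (if t \<in> ball (z b) R then \<beta> t * (\<psi> t - ?k) else 0)" for t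
  have f0: "f t = 0" if "dist t (z b) \<ge> 2 * e" for t using \<beta>(3)[OF that] by (simp add: f_def)
  let ?O = "{t. dist t (z b) > 2 * e}"
  have o: "open ?O" by (intro open_Collect_less continuous_intros)
  have sO: "smooth_on ?O f"
    by (rule smooth_on_cong[OF o smooth_on_const[of _ 0]]) (simp add: f0)
  have "Ck_on 0 UNIV f"
  proof (rule Ck_on_local)
    fix t
    show "\<exists>W. open W \<and> t \<in> W \<and> Ck_on 0 W f"
    proof (cases "dist t (z b) < R")
      case True
      have "continuous_on (ball (z b) R) (\<lambda>t. \<beta> t * (\<psi> t - ?k))"
        by (intro continuous_intros \<psi> continuous_on_subset[OF smooth_on_continuous[OF \<beta>(1)]]) auto
      then have "continuous_on (ball (z b) R) f" by (rule continuous_on_eq) (auto simp: f_def)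
      then show ?thesis using True by (intro exI[of _ "ball (z b) R"]) (auto simp: dist_commute)
    next
      case False
      then show ?thesis using smooth_on_continuous[OF sO] o e by (intro exI[of _ ?O]) auto
    qed
  qed
  then have cf: "continuous_on UNIV f" by simp
  let ?P = "ball (z b) R - {z b}"
  have oP: "open ?P" by (intro open_delete open_ball)
  have repZ: "(\<lambda>t. rep i (inv_into U z t) $ 0) holomorphic_on ?P"
    by (rule holomorphic_on_subset[OF rep_holo[OF u(1)]]) (use R(2) in blast)
  have in_patch: "inv_into U z t \<in> patch i" if "t \<in> ball (z b) R" for t
    by (rule inv_chart_image(2)[OF u(1)]) (use that R(2) in blast)
  have rep_nz: "rep i (inv_into U z t) $ 0 \<noteq> 0" if "t \<in> ?P" for t
    using patch_iff[OF in_patch] patch0[OF that] that by blast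
  have sP: "smooth_on ?P f"
  proof -
    have "?P \<subseteq> z ` (patch 0 \<inter> U)"
    proof
      fix t assume t: "t \<in> ?P"
      then have "t \<in> z ` (U \<inter> patch i)" using R(2) by blast
      note w = inv_chart_image[OF u(1) this]
      show "t \<in> z ` (patch 0 \<inter> U)" by (rule image_eqI[of _ _ "inv_into U z t"]) (use w patch0[OF t] in auto)
    qed
    note s1 = smooth_on_subset[OF smooth_formD(1)[OF \<phi> u(1)] this]
    have s2: "smooth_on ?P (\<lambda>t. (rep i (inv_into U z t) $ 0) powi l)"
      by (intro smooth_on_holomorphic oP holomorphic_on_power_int repZ) (use rep_nz in blast)
    have s3: "smooth_on ?P \<beta>" by (rule smooth_on_subset[OF \<beta>(1)]) simp
    have "smooth_on ?P (\<lambda>t. \<beta> t * ((rep i (inv_into U z t) $ 0) powi l * (\<phi> (U, z) \<circ> inv_into U z) t - ?k))"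
      by (intro smooth_on_mult smooth_on_diff smooth_on_const oP s1 s2 s3)
    then show ?thesis by (rule smooth_on_cong[OF oP]) (use \<psi>\<phi> in \<open>simp add: f_def\<close>)
  qed
  have sf: "smooth_on (- {z b}) f"
  proof (rule smooth_on_local)
    fix t assume t: "t \<in> - {z b}"
    show "\<exists>W. open W \<and> t \<in> W \<and> smooth_on W f"
    proof (cases "dist t (z b) < R")
      case True
      then show ?thesis using t sP oP by (intro exI[of _ ?P]) (auto simp: dist_commute)
    next
      case False
      then show ?thesis using sO o e by (intro exI[of _ ?O]) auto
    qed
  qed
  define M where "M = norm (z b) + 2 * e"
  have M: "M > 0" using e by (simp add: M_def add_nonneg_pos)
  have fM: "f t = 0" if "norm t \<ge> M" for t
    by (rule f0) (use that norm_triangle_ineq2[of t "z b"] in \<open>auto simp: dist_norm M_def\<close>)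
  have fb: "f (z b) = 0" by (simp add: f_def)
  obtain v C where v: "smooth_on (ball 0 M - {z b}) v"
    "\<And>t. t \<in> ball 0 M - {z b} \<Longrightarrow> dzbar v t = f t" "\<And>t. norm (v t) \<le> C"
    using puncture_dbar[OF cf fM sf fb M] by metis
  let ?B = "ball 0 M - {z b}"
  have oB: "open ?B" by (intro open_delete open_ball)
  \<comment> \<open>\<open>?k * cnj t\<close> has \<open>dzbar\<close> equal to \<open>?k\<close>
    and restores the constant that was subtracted.\<close>
  define F where "F t = v t + ?k * cnj t" for t
  have cs: "smooth_on ?B (\<lambda>t. ?k * cnj t)"
    by (intro smooth_on_mult smooth_on_cnj smooth_on_const smooth_on_holomorphic[OF _ holomorphic_on_ident] oB)
  have sF: "smooth_on ?B F" unfolding F_def by (intro smooth_on_add oB v(1) cs)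
  have dF: "dzbar F t = f t + ?k" if "t \<in> ?B" for t
  proof -
    have "((\<lambda>t. ?k * cnj t) has_derivative (\<lambda>h. ?k * cnj h)) (at t)"
      by (auto intro!: derivative_eq_intros)
    then have "dzbar (\<lambda>t. ?k * cnj t) t = ?k"
      by (subst dzbar_eqI) (assumption, simp add: complex_eq_iff)
    then show ?thesis unfolding F_def
      by (subst dzbar_add) (use v(2) that smooth_imp_differentiable[OF v(1) oB that] smooth_imp_differentiable[OF cs oB that] in auto)
  qed
  let ?g = "\<lambda>s::complex. s powi (- l)"
  have hg: "?g holomorphic_on (- {0})" by (intro holomorphic_intros) auto
  have o0: "open (- {0::complex})" by (simp add: open_Compl)
  define h where "h y = F (z y) * ?g (rep i y $ 0)" for y
  define V where "V = inv_into U z ` ball (z b) e"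
  have Vt: "x \<in> U" "x \<in> patch i" "z x \<in> ball (z b) e" if xV: "x \<in> V" for x
  proof -
    obtain t where t: "t \<in> ball (z b) e" "x = inv_into U z t" using xV unfolding V_def by blast
    then have "t \<in> z ` (U \<inter> patch i)" using R(2) e(3) by auto
    then show "x \<in> U" "x \<in> patch i" "z x \<in> ball (z b) e" using inv_chart_image[OF u(1)] t by auto
  qed
  have VB: "z x \<in> ?B" "rep i x $ 0 \<noteq> 0" "z x \<in> ?P" if x: "x \<in> V" "x \<in> patch 0" for x
  proof -
    have "z x \<noteq> z b" using x(2) b(1) u Vt(1)[OF x(1)] by (metis inv_chart)
    moreover have "norm (z x) < M"
      using Vt(3)[OF x(1)] e norm_triangle_ineq2[of "z x" "z b"] by (auto simp: dist_norm M_def norm_minus_commute)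
    ultimately show "z x \<in> ?B" by simp
    show "rep i x $ 0 \<noteq> 0" using patch_iff[OF Vt(2)[OF x(1)]] x(2) by blast
    show "z x \<in> ?P" using \<open>z x \<noteq> z b\<close> Vt(3)[OF x(1)] e by auto
  qed
  have sm1: "smooth_at A (\<lambda>y. F (z y)) x" if "x \<in> V" "x \<in> patch 0" for x
    by (rule smooth_at_compose[OF holo_at_chart[OF u(1) Vt(1)[OF that(1)]] oB VB(1)[OF that] sF])
  have sm2: "smooth_at A (\<lambda>y. ?g (rep i y $ 0)) x" if "x \<in> V" "x \<in> patch 0" for x
    by (rule smooth_at_compose[OF rep_holo_at[OF Vt(2)[OF that(1)]] o0 _ smooth_on_holomorphic[OF o0 hg]])
       (use VB(2)[OF that] in simp)
  have sm: "smooth_at A h x" if "x \<in> V" "x \<in> patch 0" for x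
    unfolding h_def by (rule smooth_at_mult[OF sm1[OF that] sm2[OF that]])
  have "local_solution l \<phi> b V h"
    unfolding local_solution_def
  proof (intro conjI ballI allI impI)
    show oV: "open V" and "b \<in> V" unfolding V_def using nhd_of_disc[OF u R(1) sub e(1,3)] by auto
    show "smooth_at A h x" if "x \<in> V \<inter> patch 0" for x using sm that by blast
    show "growth_bounded l h y" if y: "y \<in> V" for y
    proof (rule growth_boundedI[OF Vt(2)[OF y] oV y, of _ _ "C + norm ?k * M"])
      fix x assume x: "x \<in> V" "x \<in> patch 0" "x \<in> patch i"
      have nz: "norm (rep i x $ 0) > 0" using VB(2)[OF x(1,2)] by simp
      have "norm (h x) * norm (rep i x $ 0) powi l = norm (F (z x)) * (norm (rep i x $ 0) powi (- l) * norm (rep i x $ 0) powi l)"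
        by (simp add: h_def norm_mult norm_power_int)
      also have "\<dots> = norm (F (z x))" using nz by (simp add: power_int_minus)
      also have "\<dots> \<le> norm (v (z x)) + norm ?k * norm (z x)"
        unfolding F_def by (rule order_trans[OF norm_triangle_ineq]) (simp add: norm_mult)
      also have "\<dots> \<le> C + norm ?k * M"
        using v(3)[of "z x"] VB(1)[OF x(1,2)] by (intro add_mono mult_left_mono) auto
      finally show "norm (h x) * norm (rep i x $ 0) powi l \<le> C + norm ?k * M" .
    qed
    fix U' z' x assume c': "(U', z') \<in> A" "x \<in> U'" and x: "x \<in> V" "x \<in> patch 0"
    note xU = Vt(1)[OF x(1)]
    have g': "?g field_differentiable at (rep i x $ 0)"
      using holomorphic_on_imp_differentiable_at[OF hg o0] VB(2)[OF x] by simp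
    have "dzbar ?g (rep i x $ 0) = 0"
      using g' dzbar_holomorphic unfolding field_differentiable_def by blast
    moreover have "?g differentiable at (rep i x $ 0)"
      using g' field_differentiable_imp_differentiable by blast
    ultimately have d2: "dbar_form (\<lambda>y. ?g (rep i y $ 0)) (U, z) x = 0"
      by (subst dbar_form_compose[where F = ?g, OF rep_holo_at[OF Vt(2)[OF x(1)]] _ u(1) xU]) simp_all
    have d1: "dbar_form (\<lambda>y. F (z y)) (U, z) x = f (z x) + ?k"
      using dbar_form_chart[OF u(1) xU smooth_imp_differentiable[OF sF oB VB(1)[OF x]]] dF[OF VB(1)[OF x]] by simp
    have "f (z x) + ?k = \<psi> (z x)"
      using VB(3)[OF x] Vt(3)[OF x(1)] \<beta>(2)[of "z x"] by (simp add: f_def dist_commute)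
    also have "\<dots> = (rep i x $ 0) powi l * \<phi> (U, z) x" using \<psi>\<phi>[OF VB(3)[OF x]] xU u(1) by simp
    finally have "dbar_form h (U, z) x = (rep i x $ 0) powi l * \<phi> (U, z) x * ?g (rep i x $ 0)"
      unfolding h_def by (simp add: dbar_form_mult[OF sm1[OF x] sm2[OF x] u(1) xU] d1 d2)
    also have "\<dots> = \<phi> (U, z) x" using VB(2)[OF x] by (simp add: power_int_minus)
    finally show "dbar_form h (U', z') x = \<phi> (U', z') x"
      by (rule dbar_eq_chart[OF \<phi> x(2) sm[OF x] u(1) xU _ c'])
  qed
  then show ?thesis by blast
qed

section \<open>Global solution\<close>


definition solving_nhd :: "int \<Rightarrow> 'a \<Rightarrow> 'a set \<Rightarrow> bool" where
  "solving_nhd l a V \<longleftrightarrow> open V \<and> a \<in> V \<and>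
    (\<forall>\<phi> \<eta> K. smooth_form01 A (patch 0) \<phi> \<longrightarrow> (\<forall>x. smooth_at A \<eta> x) \<longrightarrow> closed K \<longrightarrow> K \<subseteq> V \<longrightarrow>
      (\<forall>x. x \<notin> K \<longrightarrow> \<eta> x = 0) \<longrightarrow> solvable l (\<lambda>ch x. \<eta> x * \<phi> ch x))"

lemma solving_nhd_exists: "good a \<Longrightarrow> l > int d - 3 \<Longrightarrow> \<exists>V. solving_nhd l a V"
  by (rule good_solvable) (auto simp: solving_nhd_def)

lemma solving_nhdD:
  assumes "solving_nhd l a V"
  shows "open V" "a \<in> V"
    "smooth_form01 A (patch 0) \<phi> \<Longrightarrow> (\<And>x. smooth_at A \<eta> x) \<Longrightarrow> closed K \<Longrightarrow> K \<subseteq> V \<Longrightarrow>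
      (\<And>x. x \<notin> K \<Longrightarrow> \<eta> x = 0) \<Longrightarrow> solvable l (\<lambda>ch x. \<eta> x * \<phi> ch x)"
  using assms unfolding solving_nhd_def by blast+

text \<open>Instead of a partition of unity, one cutoff at a time is split off:
  \<open>\<eta> a\<close> times the form is solvable, and the remainder \<open>1 - \<eta> a\<close>
  times the form vanishes on \<open>V' a\<close> and wherever the form did. After the last step
  nothing is left on \<open>patch 0\<close>.\<close>

lemma good_form_solvable:
  assumes l: "l > int d - 3" and F: "finite F" "\<And>a. a \<in> F \<Longrightarrow> good a"
    and V: "\<And>a \<phi> \<eta> K. good a \<Longrightarrow> smooth_form01 A (patch 0) \<phi> \<Longrightarrow> (\<And>x. smooth_at A \<eta> x) \<Longrightarrow> closed K \<Longrightarrow>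
      K \<subseteq> V a \<Longrightarrow> (\<And>x. x \<notin> K \<Longrightarrow> \<eta> x = 0) \<Longrightarrow> solvable l (\<lambda>ch x. \<eta> x * \<phi> ch x)"
    and \<eta>: "\<And>a x. good a \<Longrightarrow> smooth_at A (\<eta> a) x" "\<And>a. good a \<Longrightarrow> closed (K a)" "\<And>a. good a \<Longrightarrow> K a \<subseteq> V a"
      "\<And>a x. good a \<Longrightarrow> x \<notin> K a \<Longrightarrow> \<eta> a x = 0" "\<And>a x. good a \<Longrightarrow> x \<in> V' a \<Longrightarrow> \<eta> a x = 1"
    and \<phi>: "smooth_form01 A (patch 0) \<phi>"
      "\<And>U z x. (U, z) \<in> A \<Longrightarrow> x \<in> U \<Longrightarrow> x \<in> patch 0 \<Longrightarrow> x \<notin> (\<Union>a\<in>F. V' a) \<Longrightarrow> \<phi> (U, z) x = 0"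
  shows "solvable l \<phi>"
  using F \<phi>
proof (induction F arbitrary: \<phi> rule: finite_induct)
  case empty
  show ?case unfolding solvable_def
  proof (intro exI[of _ "\<lambda>_. 0"] conjI ballI allI impI)
    show "growth_bounded l (\<lambda>_. 0) y" for y by (rule growth_bounded_zero[of UNIV]) auto
  qed (use empty in \<open>auto simp: dbar_form_const\<close>)
next
  case (insert a F)
  have a: "good a" using insert.prems(1) by blast
  have "solvable l (\<lambda>ch x. \<eta> a x * \<phi> ch x)"
    by (rule V[OF a insert.prems(2) \<eta>(1)[OF a] \<eta>(2,3)[OF a] \<eta>(4)[OF a]])
  moreover have "solvable l (\<lambda>ch x. (1 + (- 1) * \<eta> a x) * \<phi> ch x)"
  proof (rule insert.IH)
    show "smooth_form01 A (patch 0) (\<lambda>ch x. (1 + (- 1) * \<eta> a x) * \<phi> ch x)"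
      by (intro smooth_form_mult patch_open insert.prems smooth_at_add smooth_at_mult smooth_at_const \<eta>(1) a)
    fix U z x assume x: "(U, z) \<in> A" "x \<in> U" "x \<in> patch 0" "x \<notin> (\<Union>a\<in>F. V' a)"
    show "(1 + (- 1) * \<eta> a x) * \<phi> (U, z) x = 0"
      using \<eta>(5)[OF a, of x] insert.prems(3)[OF x(1-3)] x(4) by (cases "x \<in> V' a") auto
  qed (use insert.prems in auto)
  ultimately show ?case by (rule solvable_add) (simp add: algebra_simps)
qed

lemma form_solvable:
  assumes l: "l > int d - 3" and \<phi>: "smooth_form01 A (patch 0) \<phi>"
    and loc: "\<And>b. \<exists>V h. local_solution l \<phi> b V h"
  shows "solvable l \<phi>"
proof -
  define B where "B = {y. \<not> good y}"
  have finB: "finite B" using finite_bad by (simp add: B_def)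
  obtain V h where Vh: "\<And>b. local_solution l \<phi> b (V b) (h b)" using loc by metis
  \<comment> \<open>Keeping the other bad points out of the support ensures that near each bad point
    only its own summand of \<open>G\<close> survives.\<close>
  have "\<exists>\<eta> V' K. cutoff (V b - (B - {b})) b \<eta> V' K" for b
    by (rule cutoff_exists)
       (use Vh[of b] finB in \<open>auto simp: local_solution_def intro!: open_Diff finite_imp_closed\<close>)
  then obtain \<eta> V' K where "\<And>b. cutoff (V b - (B - {b})) b (\<eta> b) (V' b) (K b)" by metis
  note \<eta> = cutoffD[OF this]
  define G where "G x = (\<Sum>b\<in>B. \<eta> b x * h b x)" for x
  have off: "\<eta> b x * h b x = 0" if "x \<in> - K b" for b x using \<eta>(7) that by simp
  have oK: "open (- K b)" for b using \<eta>(4) by (simp add: open_Compl)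
  have s: "smooth_at A (\<lambda>x. \<eta> b x * h b x) x" if "x \<in> patch 0" for b x
  proof (cases "x \<in> K b")
    case True
    then have "x \<in> V b" using \<eta>(5) by blast
    then have "smooth_at A (h b) x" using Vh[of b] that unfolding local_solution_def by blast
    then show ?thesis by (rule smooth_at_mult[OF \<eta>(1)])
  next
    case False
    then show ?thesis by (intro smooth_at_cong[OF smooth_at_const[of 0] oK[of b]]) (simp_all add: \<eta>(7))
  qed
  have w: "growth_bounded l (\<lambda>x. \<eta> b x * h b x) y" for b y
  proof (cases "y \<in> K b")
    case True
    then have "y \<in> V b" using \<eta>(5) by blast
    then have "growth_bounded l (h b) y" using Vh[of b] unfolding local_solution_def by blast
    then show ?thesis
    proof (rule growth_bounded_le)
      show "norm (\<eta> b x * h b x) \<le> norm (h b x)" for x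
        using mult_right_mono[OF \<eta>(8)[of b x], of "norm (h b x)"] by (simp add: norm_mult)
    qed
  next
    case False
    then show ?thesis by (intro growth_bounded_zero[OF oK[of b]]) (simp_all add: \<eta>(7))
  qed
  have sG: "smooth_at A G x" if "x \<in> patch 0" for x
    unfolding G_def by (rule smooth_at_sum) (rule s[OF that])
  have wG: "growth_bounded l G y" for y unfolding G_def by (rule growth_bounded_sum) (rule w)
  \<comment> \<open>Here the cutoff of \<open>b\<close> is 1 and all the others are 0, so
    \<open>G\<close> coincides with \<open>h b\<close> and solves the equation exactly.\<close>
  define O' where "O' b = (V' b \<inter> V b) \<inter> (\<Inter>b'\<in>B - {b}. - K b')" for b
  have oO: "open (O' b)" for b
    unfolding O'_def using \<eta>(2) Vh[of b] finB oK unfolding local_solution_def by (intro open_Int open_INT) auto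
  have bO: "b \<in> O' b" if "b \<in> B" for b
    unfolding O'_def using \<eta>(3,5) Vh[of b] that unfolding local_solution_def by blast
  have dG: "dbar_form G (U, z) x = \<phi> (U, z) x"
    if c: "(U, z) \<in> A" "x \<in> U" and x: "x \<in> patch 0" "x \<in> O' b" "b \<in> B" for U z x b
  proof -
    have "G y = h b y" if y: "y \<in> O' b" for y
    proof -
      have "G y = (\<Sum>b'\<in>{b}. \<eta> b' y * h b' y)"
        unfolding G_def
        by (rule sum.mono_neutral_right[OF finB]) (use x(3) y off in \<open>auto simp: O'_def\<close>)
      then show ?thesis using \<eta>(6) y by (simp add: O'_def)
    qed
    then have "dbar_form G (U, z) x = dbar_form (h b) (U, z) x"
      by (rule dbar_form_cong[OF sG[OF x(1)] oO x(2) _ c])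
    then show ?thesis using Vh[of b] c x unfolding local_solution_def O'_def by auto
  qed
  define \<phi>' :: "'a form" where "\<phi>' = (\<lambda>ch x. \<phi> ch x - dbar_form G ch x)"
  have \<phi>': "smooth_form01 A (patch 0) \<phi>'"
    unfolding \<phi>'_def by (rule smooth_form_diff_dbar[OF patch_open \<phi> sG])
  have "\<exists>V. good a \<longrightarrow> solving_nhd l a V" for a
    using solving_nhd_exists[OF _ l] by blast
  then obtain Y where "\<And>a. good a \<Longrightarrow> solving_nhd l a (Y a)" by metis
  note Y = solving_nhdD[OF this]
  have "\<exists>\<eta> Y' K. good a \<longrightarrow> cutoff (Y a) a \<eta> Y' K" for a
    using cutoff_exists[OF Y(1,2)] by blast
  then obtain \<theta> Y' L where "\<And>a. good a \<Longrightarrow> cutoff (Y a) a (\<theta> a) (Y' a) (L a)" by metis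
  note \<theta> = cutoffD[OF this]
  \<comment> \<open>A point in no \<open>Y' a\<close> with good \<open>a\<close> from the finite
    subcover lies in some \<open>O' a\<close> with bad \<open>a\<close>, where the corrected form is
    zero; this is the vanishing that \<open>good_form_solvable\<close> asks for.\<close>
  define N where "N a = (if good a then Y' a else O' a)" for a
  have N: "open (N a)" "a \<in> N a" for a
    using \<theta>(2,3) oO bO by (auto simp: N_def B_def)
  obtain F where F: "finite F" "UNIV \<subseteq> (\<Union>a\<in>F. N a)"
    by (rule finite_subcover[OF N])
  have "solvable l \<phi>'"
  proof (rule good_form_solvable[OF l, of "{a \<in> F. good a}" Y \<theta> L Y'])
    show "finite {a \<in> F. good a}" using F(1) by simp
    fix U z x assume x: "(U, z) \<in> A" "x \<in> U" "x \<in> patch 0" "x \<notin> (\<Union>a\<in>{a \<in> F. good a}. Y' a)"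
    obtain a where a: "a \<in> F" "x \<in> N a" using F(2) by blast
    then have "\<not> good a" using x(4) by (auto simp: N_def)
    then have "x \<in> O' a" "a \<in> B" using a(2) by (auto simp: N_def B_def)
    then show "\<phi>' (U, z) x = 0" using dG[OF x(1-3)] by (simp add: \<phi>'_def)
  next
    fix a \<phi> \<eta> K
    assume "good a" "smooth_form01 A (patch 0) \<phi>" "\<And>x. smooth_at A \<eta> x" "closed K" "K \<subseteq> Y a"
      "\<And>x. x \<notin> K \<Longrightarrow> \<eta> x = 0"
    then show "solvable l (\<lambda>ch x. \<eta> x * \<phi> ch x)" by (rule Y(3))
  qed (use \<theta>(1,4-7) \<phi>' in simp_all)
  moreover have "solvable l (dbar_form G)"
    unfolding solvable_def using sG wG by blast
  ultimately show ?thesis by (rule solvable_add) (simp add: \<phi>'_def)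
qed

text \<open>\<open>\<psi>\<close> is the pullback of \<open>\<Psi>\<close> to a chart disc: its
  value on the velocity vector \<open>v t\<close> of the immersed disc. It is continuous also at
  \<open>b\<close>, since \<open>\<Psi>\<close> is locally the restriction of a continuous ambient
  form. On a small punctured disc there are neither points at infinity nor points over nodes, so
  there the direct image is plain transport and returns the coefficient of
  \<open>\<phi>\<close>.\<close>

lemma boundary_form:
  assumes direct: "is_direct_image A \<rho> P (patch 0) \<phi> \<Phi>"
    and \<Psi>: "continuous_curve_form01 P (curve P) l \<Psi>"
    and eq: "\<forall>\<zeta>\<in>cone_over (curve P - line_at_infinity). \<forall>v\<in>cone_tangent P \<zeta>. \<Psi> \<zeta> v = ((\<zeta> $ 0) powi l) * \<Phi> \<zeta> v"
    and u: "(U, z) \<in> A" "b \<in> U" and i: "b \<in> patch i"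
  obtains R \<psi> where "R > 0" "ball (z b) R \<subseteq> z ` (U \<inter> patch i)" "continuous_on (ball (z b) R) \<psi>"
    "\<And>t. t \<in> ball (z b) R - {z b} \<Longrightarrow> inv_into U z t \<in> patch 0"
    "\<And>t. t \<in> ball (z b) R - {z b} \<Longrightarrow> \<psi> t = (rep i (inv_into U z t) $ 0) powi l * \<phi> (U, z) (inv_into U z t)"
proof -
  obtain R0 where R0: "R0 > 0" "ball (z b) R0 \<subseteq> z ` (U \<inter> patch i)"
    using chart_disc[OF u patch_open i] by metis
  obtain r1 where r1: "0 < r1" "r1 \<le> R0" "\<And>t. t \<in> ball (z b) r1 - {z b} \<Longrightarrow> rep i (inv_into U z t) $ 0 \<noteq> 0"
    by (rule infinity_isolated[OF u R0]) blast
  obtain r2 where r2: "0 < r2" "r2 \<le> R0" "\<And>t. t \<in> ball (z b) r2 - {z b} \<Longrightarrow> \<rho> (inv_into U z t) \<notin> nodes P"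
    by (rule nodes_isolated[OF u R0]) blast
  let ?Z = "\<lambda>t. rep i (inv_into U z t)"
  have in_patch: "inv_into U z t \<in> patch i" and inU: "inv_into U z t \<in> U" and zi: "z (inv_into U z t) = t"
    if "t \<in> ball (z b) R0" for t
  proof -
    have "t \<in> z ` (U \<inter> patch i)" using that R0(2) by blast
    from inv_chart_image[OF u(1) this]
    show "inv_into U z t \<in> patch i" "inv_into U z t \<in> U" "z (inv_into U z t) = t" by auto
  qed
  have holZ: "(\<lambda>t. ?Z t $ j) holomorphic_on ball (z b) R0" for j
    by (rule holomorphic_on_subset[OF rep_holo[OF u(1)] R0(2)])
  define v where "v t = affine_rep_deriv \<rho> (U, z) i t" for t
  have vj: "v t $ j = deriv (\<lambda>t. ?Z t $ j) t" for t j
    by (simp add: v_def affine_rep_deriv_def affine_rep_def rep_def o_def)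
  have cone: "?Z t \<in> cone_over (curve P)" if "t \<in> ball (z b) R0" for t
    unfolding cone_over_def using rep_hcoords[OF in_patch[OF that]] \<rho>_curve by blast
  have tang: "v t \<in> cone_tangent P (?Z t)" if t: "t \<in> ball (z b) R0" for t
  proof -
    have "((\<lambda>t. P (?Z t)) has_field_derivative (\<Sum>j\<in>UNIV. v t $ j * pd j P (?Z t))) (at t)"
      by (rule polyfun_compose[OF polyfun_P]) (simp add: vj holomorphic_derivI[OF holZ open_ball t])
    moreover have "((\<lambda>t. P (?Z t)) has_field_derivative 0) (at t)"
      by (rule has_field_derivative_transform_within_open[where f = "\<lambda>_. 0", OF DERIV_const open_ball t])
         (simp add: P_rep in_patch)
    ultimately show ?thesis
      unfolding cone_tangent_def polyfun_frechet_derivative[OF polyfun_P] using DERIV_unique by blast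
  qed
  have zb: "z b \<in> ball (z b) R0" using R0(1) by simp
  have "\<exists>W (a :: complex^3 \<Rightarrow> complex^3). open W \<and> ?Z (z b) \<in> W \<and> continuous_on W a \<and>
      (\<forall>\<eta>\<in>cone_over (curve P) \<inter> W. \<forall>v\<in>cone_tangent P \<eta>. \<Psi> \<eta> v = (\<Sum>j\<in>UNIV. a \<eta> $ j * cnj (v $ j)))"
    using \<Psi> cone[OF zb] unfolding continuous_curve_form01_def by blast
  then obtain W and a :: "complex^3 \<Rightarrow> complex^3" where W: "open W" "?Z (z b) \<in> W" "continuous_on W a"
    and W': "\<forall>\<eta>\<in>cone_over (curve P) \<inter> W. \<forall>v\<in>cone_tangent P \<eta>. \<Psi> \<eta> v = (\<Sum>j\<in>UNIV. a \<eta> $ j * cnj (v $ j))"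
    by (elim exE conjE)
  have cZ: "continuous_on (ball (z b) R0) ?Z"
    unfolding continuous_on_def
    by (intro ballI vec_tendstoI) (use holomorphic_on_imp_continuous_on[OF holZ] in \<open>simp add: continuous_on_def\<close>)
  have "open (?Z -` W \<inter> ball (z b) R0)"
    using cZ W(1) by (simp add: continuous_on_open_vimage)
  moreover have "z b \<in> ?Z -` W \<inter> ball (z b) R0" using W(2) zb by simp
  ultimately obtain r3 where r3: "r3 > 0" "ball (z b) r3 \<subseteq> ?Z -` W \<inter> ball (z b) R0"
    using open_contains_ball by blast
  define R where "R = min r1 (min r2 r3)"
  have R: "R > 0" "R \<le> r1" "R \<le> r2" "R \<le> r3" using r1 r2 r3 by (auto simp: R_def)
  have bR: "ball (z b) R \<subseteq> ball (z b) R0" "ball (z b) R \<subseteq> ?Z -` W" using R r3 by auto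
  define \<psi> where "\<psi> t = (\<Sum>j\<in>UNIV. a (?Z t) $ j * cnj (deriv (\<lambda>t. ?Z t $ j) t))" for t
  have \<psi>\<Psi>: "\<Psi> (?Z t) (v t) = \<psi> t" if "t \<in> ball (z b) R" for t
    unfolding \<psi>_def vj[symmetric]
    by (rule W'[rule_format, OF _ tang]) (use that bR cone in auto)
  show ?thesis
  proof (rule that[of R \<psi>])
    show "R > 0" by fact
    show "ball (z b) R \<subseteq> z ` (U \<inter> patch i)" using bR R0(2) by blast
    have "continuous_on (ball (z b) R) (\<lambda>t. a (?Z t))"
      by (rule continuous_on_compose2[OF W(3) continuous_on_subset[OF cZ bR(1)]]) (use bR(2) in auto)
    moreover have "continuous_on (ball (z b) R) (deriv (\<lambda>t. ?Z t $ j))" for j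
      by (rule continuous_on_subset[OF holomorphic_on_imp_continuous_on[OF holomorphic_deriv[OF holZ open_ball]] bR(1)])
    ultimately show "continuous_on (ball (z b) R) \<psi>"
      unfolding \<psi>_def by (intro continuous_intros)
    fix t assume t: "t \<in> ball (z b) R - {z b}"
    then have t': "t \<in> ball (z b) R0" "t \<in> ball (z b) R" using bR by auto
    have Z0: "?Z t $ 0 \<noteq> 0" using r1(3)[of t] t R by auto
    show d0: "inv_into U z t \<in> patch 0" using patch_iff[OF in_patch[OF t'(1)], of 0] Z0 by simp
    have nn: "\<rho> (inv_into U z t) \<notin> nodes P" using r2(3)[of t] t R by auto
    have "?Z t \<in> cone_over (curve P - line_at_infinity)"
      unfolding cone_over_def
      using rep_hcoords[OF in_patch[OF t'(1)]] \<rho>_curve line_at_infinity_iff[OF rep_hcoords[OF in_patch[OF t'(1)]]] Z0 by blast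
    then have "\<Psi> (?Z t) (v t) = (?Z t $ 0) powi l * \<Phi> (?Z t) (v t)"
      using eq tang[OF t'(1)] by blast
    moreover have "\<Phi> (?Z t) (v t) = \<phi> (U, z) (inv_into U z t)"
      using direct u(1) d0 inU[OF t'(1)] nn in_patch[OF t'(1)] zi[OF t'(1)]
      unfolding is_direct_image_def rep_def v_def patch_def by fastforce
    ultimately show "\<psi> t = (?Z t $ 0) powi l * \<phi> (U, z) (inv_into U z t)"
      using \<psi>\<Psi>[OF t'(2)] by simp
  qed
qed

text \<open>Finitely many of the local estimates cover the compact surface, and the sum of the
  absolute values of their constants dominates each of them.\<close>

lemma solvable_imp_bounded_solution:
  assumes "solvable l \<phi>"
  shows "\<exists>g C. smooth_function A (patch 0) g \<and> dbar_eq A (patch 0) g \<phi> \<and>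
    (\<forall>x\<in>patch 0. \<forall>\<zeta>\<in>hcoords (\<rho> x). norm \<zeta> = 1 \<longrightarrow> norm (g x) \<le> C * norm (\<zeta> $ 0) powi (- l))"
proof -
  obtain g where g: "\<And>x. x \<in> patch 0 \<Longrightarrow> smooth_at A g x" "\<And>y. growth_bounded l g y"
    "\<And>U z x. (U, z) \<in> A \<Longrightarrow> x \<in> U \<Longrightarrow> x \<in> patch 0 \<Longrightarrow> dbar_form g (U, z) x = \<phi> (U, z) x"
    using assms unfolding solvable_def by metis
  obtain V C where V: "\<And>y. open (V y)" "\<And>y. y \<in> V y"
    "\<And>y x \<zeta>. x \<in> V y \<inter> patch 0 \<Longrightarrow> \<zeta> \<in> hcoords (\<rho> x) \<Longrightarrow> norm \<zeta> = 1 \<Longrightarrow> norm (g x) \<le> C y * norm (\<zeta> $ 0) powi (- l)"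
    using g(2) unfolding growth_bounded_def by metis
  obtain F where F: "finite F" "UNIV \<subseteq> (\<Union>y\<in>F. V y)"
    by (rule finite_subcover[OF V(1,2)])
  show ?thesis
  proof (intro exI conjI ballI impI)
    show "smooth_function A (patch 0) g" by (rule smooth_functionI[OF g(1)])
    show "dbar_eq A (patch 0) g \<phi>"
      unfolding dbar_eq_def using g(3) by (auto simp: dbar_form_def)
    fix x \<zeta> assume x: "x \<in> patch 0" "\<zeta> \<in> hcoords (\<rho> x)" "norm \<zeta> = 1"
    obtain y where y: "y \<in> F" "x \<in> V y" using F(2) by blast
    have "norm (g x) \<le> C y * norm (\<zeta> $ 0) powi (- l)" using V(3)[of x y \<zeta>] x y by blast
    also have "C y \<le> (\<Sum>y\<in>F. \<bar>C y\<bar>)"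
      using member_le_sum[of y F "\<lambda>y. \<bar>C y\<bar>"] y F(1) by fastforce
    finally show "norm (g x) \<le> (\<Sum>y\<in>F. \<bar>C y\<bar>) * norm (\<zeta> $ 0) powi (- l)"
      by (simp add: mult_right_mono)
  qed
qed

end

theorem proposition4p1:
  fixes A :: "'a::t2_space chart set"
    and \<rho> :: "'a \<Rightarrow> cp2"
    and P :: "complex^3 \<Rightarrow> complex"
    and d r :: nat
    and pt :: "nat \<Rightarrow> cp2"
    and m :: "nat \<Rightarrow> nat"
    and C0 :: "cp2 set"
    and X0 :: "'a set"
    and \<phi> :: "'a form"
    and \<Phi> \<Psi> :: "complex^3 \<Rightarrow> complex^3 \<Rightarrow> complex"
    and l :: int
  assumes "complex_atlas A" and "compact (UNIV :: 'a set)"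
    and "holomorphic_immersion A \<rho>"
    and "hom_poly d P"
    and "range \<rho> = curve P"
    and "singular_points P \<subseteq> nodes P"
    and "inj_on \<rho> {x. \<rho> x \<notin> nodes P}"
    and "curve P \<inter> line_at_infinity = pt ` {1..r}" and "inj_on pt {1..r}"
    and "\<forall>i\<in>{1..r}. has_multiplicity_at_infinity P (pt i) (m i)"
    and "(\<Sum>i=1..r. m i) = d"
    and "C0 = curve P - pt ` {1..r}"
    and "X0 = UNIV - \<rho> -` (pt ` {1..r})"
    and "smooth_form01 A X0 \<phi>"
    and "is_direct_image A \<rho> P X0 \<phi> \<Phi>"
    and "l > int d - 3"
    and "continuous_curve_form01 P (curve P) l \<Psi>"
    and "\<forall>\<zeta>\<in>cone_over C0. \<forall>v\<in>cone_tangent P \<zeta>. \<Psi> \<zeta> v = ((\<zeta> $ 0) powi l) * \<Phi> \<zeta> v"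
  shows "\<exists>g C. smooth_function A X0 g \<and> dbar_eq A X0 g \<phi> \<and>
           (\<forall>x\<in>X0. \<forall>\<zeta>\<in>hcoords (\<rho> x). norm \<zeta> = 1 \<longrightarrow>
              norm (g x) \<le> C * norm (\<zeta> $ 0) powi (- l))"
proof -
  have fin: "finite (curve P \<inter> line_at_infinity)" using assms(8) by simp
  interpret homogeneous_polynomial d P by unfold_locales (rule assms(4))
  obtain c where c: "P (vec3 0 1 c) \<noteq> 0" using center_exists[OF fin] .
  interpret plane_curve A d P \<rho> c
    by unfold_locales (use assms fin c in auto)
  have C0: "C0 = curve P - line_at_infinity" using assms(8,12) by auto
  have "x \<in> X0 \<longleftrightarrow> x \<in> patch 0" for x
  proof -
    obtain i where i: "x \<in> patch i" by (rule patch_cover)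
    have "x \<in> X0 \<longleftrightarrow> \<rho> x \<notin> line_at_infinity" using assms(8,13) \<rho>_curve[of x] by auto
    also have "\<dots> \<longleftrightarrow> rep i x $ 0 \<noteq> 0" using line_at_infinity_iff[OF rep_hcoords[OF i]] by simp
    finally show ?thesis using patch_iff[OF i, of 0] by simp
  qed
  then have X0: "X0 = patch 0" by blast
  have \<phi>: "smooth_form01 A (patch 0) \<phi>" using assms(14) X0 by simp
  have "\<exists>V h. local_solution l \<phi> b V h" for b
  proof (cases "b \<in> patch 0")
    case True
    then show ?thesis by (rule local_solution_interior[OF \<phi>])
  next
    case False
    obtain i where i: "b \<in> patch i" by (rule patch_cover)
    obtain U z where u: "(U, z) \<in> A" "b \<in> U" by (rule chart_at)
    show ?thesis
      by (rule boundary_form[OF assms(15)[unfolded X0] assms(17) assms(18)[unfolded C0] u i])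
         (rule local_solution_infinity[OF \<phi> False i u])
  qed
  from solvable_imp_bounded_solution[OF form_solvable[OF assms(16) \<phi> this]] show ?thesis
    unfolding X0 .
qed

end
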